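(* Let $G\subset\mathbb{K}[\mathbf{x}][\boldsymbol{\partial}]$ be a finite Gröbner basis with respect to $\prec$ such that $\mathbb{K}(\mathbf{x})[\boldsymbol{\partial}]G$ is D-finite, and let $d=\mathrm{rank}(G)$. Assume the origin is a singularity of $G$, and let $S$ be a set of initial exponent candidates of $G$ with $|S|\ge d$. Let $m=\max\{|\mathbf{u}|:\mathbf{u}\in S\}$ and $U_m=\{\mathbf{u}\in\mathbb{N}^n: |\mathbf{u}|\le m\}$. Then the following are equivalent: (i) the origin is an apparent singularity of $G$, i.e. $G$ has $d$ many $\mathbb{K}$-linearly independent formal power series solutions; (ii) there is a subset $B\subseteq S$ with $|B|=d$ such that the origin is an ordinary point of $M$, where $M\subset\mathbb{K}[\mathbf{x}][\boldsymbol{\partial}]$ is the Gröbner basis (with respect to $\prec$, elements normalized to be primitive operators with polynomial coefficients) of the left ideal $$\mathbb{K}(\mathbf{x})[\boldsymbol{\partial}]G\ \cap\bigcap_{\mathbf{u}\in U_m\setminus B}\mathbb{K}(\mathbf{x})[\boldsymbol{\partial}]\{x_i\partial_i-u_i: 1\le i\le n\}.$$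
   Context: $\mathbb{K}$ is a field of characteristic zero; $\mathbb{K}(\mathbf{x})[\boldsymbol{\partial}]$ and $\mathbb{K}[\mathbf{x}][\boldsymbol{\partial}]$ are the rings of partial differential operators in $\partial_1,\dots,\partial_n$ with rational, resp. polynomial, coefficients in $x_1,\dots,x_n$. A left ideal is D-finite if the quotient is finite-dimensional over $\mathbb{K}(\mathbf{x})$. $\prec$ is a fixed graded term order on $\mathbb{N}^n$, used on $\boldsymbol{\partial}$-terms and on $\mathbf{x}$-terms. For a Gröbner basis $G$: head term, head coefficient (in $\mathbb{K}[\mathbf{x}]$), parametric terms (terms not divisible by any head term), $\mathrm{rank}(G)$ = number of parametric terms. Singularities of $G=\{G_1,\dots,G_k\}$: zeros in $\overline{\mathbb{K}}^n$ of the lcm of the head coefficients; other points are ordinary. Primitive operator: gcd of its polynomial coefficients is $1$. Formal power series solution: $f\in\mathbb{K}[[\mathbf{x}]]$ annihilated by every element of $G$; initial exponent of nonzero $f$: $\prec$-smallest exponent occurring in $f$. $|\mathbf{u}|=u_1+\dots+u_n$. Indicial polynomial: let $\delta_i=x_i\partial_i$. For nonzero $P=\sum_{|\mathbf{u}|\le m}c_{\mathbf{u}}\boldsymbol{\partial}^{\mathbf{u}}\in\mathbb{K}[\mathbf{x}][\boldsymbol{\partial}]$ of order $m$ (some $c_{\mathbf{u}}\neq0$ with $|\mathbf{u}|=m$), with $\mathbf{m}=(m,\dots,m)$ write uniquely $\mathbf{x}^{\mathbf{m}}P=\sum_{\mathbf{v}\in T}\mathbf{x}^{\mathbf{v}}\big(\sum_{|\mathbf{u}|\le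 m}c_{\mathbf{u},\mathbf{v}}\boldsymbol{\delta}^{\mathbf{u}}\big)$ with $c_{\mathbf{u},\mathbf{v}}\in\mathbb{K}$ and each inner sum nonzero; if $\mathbf{v}_0$ is the $\prec$-minimal element of $T$, then $\mathrm{ind}(P)=\sum_{|\mathbf{u}|\le m}c_{\mathbf{u},\mathbf{v}_0}\mathbf{y}^{\mathbf{u}}\in\mathbb{K}[y_1,\dots,y_n]$; $\mathrm{ind}(0)=0$. The indicial ideal is $\mathrm{ind}(G)=\{\mathrm{ind}(P):P\in\mathbb{K}(\mathbf{x})[\boldsymbol{\partial}]G\cap\mathbb{K}[\mathbf{x}][\boldsymbol{\partial}]\}$. If $\langle f_1,\dots,f_\ell\rangle\subseteq\mathrm{ind}(G)$ is a zero-dimensional ideal of $\mathbb{K}[\mathbf{y}]$, then $\{\mathbf{w}\in\mathbb{N}^n: f_i(\mathbf{w})=0,\ 1\le i\le\ell\}$ is called a set of initial exponent candidates of $G$. When the origin is a singularity of $G$, it is called apparent if $G$ has $\mathrm{rank}(G)$ many $\mathbb{K}$-linearly independent formal power series solutions. *)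

theory Defs
  imports Main "HOL-Library.Poly_Mapping"
begin

(*
Conventions.  The variables are indexed by a finite type 'n (so n = CARD('n)).
Exponent vectors (elements of N^n) are  'n \<Rightarrow>\<^sub>0 nat.
K[x] (and K[y]) is  ('n \<Rightarrow>\<^sub>0 nat) \<Rightarrow>\<^sub>0 'k  with the library's (commutative) ring structure.
An operator in K[x][d] is represented as  ('n \<Rightarrow>\<^sub>0 nat) \<Rightarrow>\<^sub>0 K[x]:
a finitely supported map from d-exponents u to the polynomial coefficient c_u(x),
meaning  sum_u c_u(x) d^u.  The built-in product on this type is NOT the operator
product; the (Weyl) operator product is dmult below.
*)

type_synonym 'n mexp = "'n \<Rightarrow>\<^sub>0 nat"
type_synonym ('n,'k) xpoly = "'n mexp \<Rightarrow>\<^sub>0 'k"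
type_synonym ('n,'k) dop = "'n mexp \<Rightarrow>\<^sub>0 ('n,'k) xpoly"

definition tdeg :: "'n::finite mexp \<Rightarrow> nat" where
  "tdeg u = (\<Sum>i\<in>UNIV. Poly_Mapping.lookup u i)"

definition mdvd :: "'n mexp \<Rightarrow> 'n mexp \<Rightarrow> bool" where
  "mdvd a b \<longleftrightarrow> (\<forall>i. Poly_Mapping.lookup a i \<le> Poly_Mapping.lookup b i)"

definition ffall :: "nat \<Rightarrow> nat \<Rightarrow> nat" where
  "ffall a k = (\<Prod>j<k. (a - j))"

definition ffallm :: "'n::finite mexp \<Rightarrow> 'n mexp \<Rightarrow> nat" where
  "ffallm a k = (\<Prod>i\<in>UNIV. ffall (Poly_Mapping.lookup a i) (Poly_Mapping.lookup k i))"

definition binomm :: "'n::finite mexp \<Rightarrow> 'n mexp \<Rightarrow> nat" where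
  "binomm b k = (\<Prod>i\<in>UNIV. (Poly_Mapping.lookup b i choose Poly_Mapping.lookup k i))"

definition xderiv :: "'n::finite mexp \<Rightarrow> ('n,'k::comm_ring_1) xpoly \<Rightarrow> ('n,'k) xpoly" where
  "xderiv k e = (\<Sum>a\<in>Poly_Mapping.keys e. Poly_Mapping.single (a - k) (of_nat (ffallm a k) * Poly_Mapping.lookup e a))"

definition dmult :: "('n::finite,'k::comm_ring_1) dop \<Rightarrow> ('n,'k) dop \<Rightarrow> ('n,'k) dop" where
  "dmult P Q = (\<Sum>b\<in>Poly_Mapping.keys P. \<Sum>d\<in>Poly_Mapping.keys Q. \<Sum>k\<in>{k. mdvd k b}.
      Poly_Mapping.single (b - k + d)
        (of_nat (binomm b k) * Poly_Mapping.lookup P b * xderiv k (Poly_Mapping.lookup Q d)))"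

definition xop :: "('n,'k::zero) xpoly \<Rightarrow> ('n,'k) dop" where
  "xop q = Poly_Mapping.single 0 q"

inductive_set lideal :: "('n::finite,'k::comm_ring_1) dop set \<Rightarrow> ('n,'k) dop set"
  for F where
  zero: "0 \<in> lideal F"
| gen: "f \<in> F \<Longrightarrow> dmult A f \<in> lideal F"
| add: "P \<in> lideal F \<Longrightarrow> Q \<in> lideal F \<Longrightarrow> P + Q \<in> lideal F"

(*Membership of a polynomial operator P in K(x)[d]F.  Every element of K(x)[d] is
 q^{-1} A with q in K[x] nonzero and A in K[x][d], hence
 K(x)[d]F = { q^{-1} A : A in K[x][d]F, q <> 0 }, and P lies in it iff q P in K[x][d]F
 for some nonzero q.*)
definition in_ratideal :: "('n::finite,'k::comm_ring_1) dop set \<Rightarrow> ('n,'k) dop \<Rightarrow> bool" where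
  "in_ratideal F P \<longleftrightarrow> (\<exists>q. q \<noteq> 0 \<and> dmult (xop q) P \<in> lideal F)"

definition graded_term_order :: "('n::finite mexp \<Rightarrow> 'n mexp \<Rightarrow> bool) \<Rightarrow> bool" where
  "graded_term_order ord \<longleftrightarrow>
     (\<forall>a. ord a a) \<and> (\<forall>a b. ord a b \<and> ord b a \<longrightarrow> a = b) \<and>
     (\<forall>a b c. ord a b \<and> ord b c \<longrightarrow> ord a c) \<and> (\<forall>a b. ord a b \<or> ord b a) \<and>
     (\<forall>a. ord 0 a) \<and> (\<forall>a b c. ord a b \<longrightarrow> ord (a + c) (b + c)) \<and>
     (\<forall>a b. tdeg a < tdeg b \<longrightarrow> ord a b \<and> a \<noteq> b)"

definition HT :: "('n mexp \<Rightarrow> 'n mexp \<Rightarrow> bool) \<Rightarrow> ('n,'k::zero) dop \<Rightarrow> 'n mexp" where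
  "HT ord P = (THE u. u \<in> Poly_Mapping.keys P \<and> (\<forall>v\<in>Poly_Mapping.keys P. ord v u))"

definition HC :: "('n mexp \<Rightarrow> 'n mexp \<Rightarrow> bool) \<Rightarrow> ('n,'k::zero) dop \<Rightarrow> ('n,'k) xpoly" where
  "HC ord P = Poly_Mapping.lookup P (HT ord P)"

(*M is a Groebner basis (w.r.t. ord) of the left ideal of K(x)[d] whose elements in
 K[x][d] are those satisfying I (the nonzero elements of such an ideal are K(x)-multiples
 of elements of K[x][d], which have the same head term).*)
definition is_GB :: "('n::finite mexp \<Rightarrow> 'n mexp \<Rightarrow> bool) \<Rightarrow> ('n,'k::comm_ring_1) dop set
    \<Rightarrow> (('n,'k) dop \<Rightarrow> bool) \<Rightarrow> bool" where
  "is_GB ord M I \<longleftrightarrow> 0 \<notin> M \<and> (\<forall>g\<in>M. I g) \<and>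
     (\<forall>P. I P \<and> P \<noteq> 0 \<longrightarrow> (\<exists>g\<in>M. mdvd (HT ord g) (HT ord P)))"

definition rank :: "('n mexp \<Rightarrow> 'n mexp \<Rightarrow> bool) \<Rightarrow> ('n,'k::zero) dop set \<Rightarrow> nat" where
  "rank ord G = card {u. \<forall>g\<in>G. \<not> mdvd (HT ord g) u}"

(*K(x)[d]G is D-finite: K(x)[d]/K(x)[d]G is spanned over K(x) by finitely many
 classes of d-terms, i.e. every P equals (1/q) sum_t c_t d^t modulo the ideal.*)
definition dfinite :: "('n::finite,'k::comm_ring_1) dop set \<Rightarrow> bool" where
  "dfinite G \<longleftrightarrow> (\<exists>T. finite T \<and> (\<forall>P. \<exists>q c. q \<noteq> 0 \<and>
      in_ratideal G (dmult (xop q) P - (\<Sum>t\<in>T. Poly_Mapping.single t (c t)))))"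

(*The origin is a zero of lcm of the head coefficients iff some head coefficient
 vanishes at the origin, i.e. has zero constant term.*)
definition singular_origin :: "('n mexp \<Rightarrow> 'n mexp \<Rightarrow> bool) \<Rightarrow> ('n,'k::zero) dop set \<Rightarrow> bool" where
  "singular_origin ord G \<longleftrightarrow> (\<exists>g\<in>G. Poly_Mapping.lookup (HC ord g) 0 = 0)"

definition ordinary_origin :: "('n mexp \<Rightarrow> 'n mexp \<Rightarrow> bool) \<Rightarrow> ('n,'k::zero) dop set \<Rightarrow> bool" where
  "ordinary_origin ord G \<longleftrightarrow> \<not> singular_origin ord G"

(*action of an operator on a formal power series f (coefficient function):
 coefficient of x^w in  x^v d^u f  is  [v <= w] ffall(w-v+u,u) f(w-v+u)*)
definition apply_op :: "('n::finite,'k::comm_ring_1) dop \<Rightarrow> ('n mexp \<Rightarrow> 'k) \<Rightarrow> ('n mexp \<Rightarrow> 'k)" where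
  "apply_op P f w = (\<Sum>u\<in>Poly_Mapping.keys P. \<Sum>v\<in>Poly_Mapping.keys (Poly_Mapping.lookup P u).
      (if mdvd v w then Poly_Mapping.lookup (Poly_Mapping.lookup P u) v * of_nat (ffallm (w - v + u) u) * f (w - v + u)
       else 0))"

definition is_solution :: "('n::finite,'k::comm_ring_1) dop set \<Rightarrow> ('n mexp \<Rightarrow> 'k) \<Rightarrow> bool" where
  "is_solution G f \<longleftrightarrow> (\<forall>g\<in>G. apply_op g f = (\<lambda>_. 0))"

definition has_indep_solutions :: "('n::finite,'k::field) dop set \<Rightarrow> nat \<Rightarrow> bool" where
  "has_indep_solutions G d \<longleftrightarrow> (\<exists>fs. (\<forall>i<d. is_solution G (fs i)) \<and>
      (\<forall>c. (\<forall>w. (\<Sum>i<d. c i * fs i w) = 0) \<longrightarrow> (\<forall>i<d. c i = 0)))"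

definition apparent_origin :: "('n::finite mexp \<Rightarrow> 'n mexp \<Rightarrow> bool) \<Rightarrow> ('n,'k::field) dop set \<Rightarrow> bool" where
  "apparent_origin ord G \<longleftrightarrow> singular_origin ord G \<and> has_indep_solutions G (rank ord G)"

definition dorder :: "('n::finite,'k::zero) dop \<Rightarrow> nat" where
  "dorder P = Max (insert 0 (tdeg ` Poly_Mapping.keys P))"

definition mconst :: "nat \<Rightarrow> 'n::finite mexp" where
  "mconst m = (\<Sum>i\<in>UNIV. Poly_Mapping.single i m)"

(*prod_i y_i (y_i - 1) ... (y_i - u_i + 1) in K[y]; equals x^u d^u written in delta*)
definition ffpoly :: "'n::finite mexp \<Rightarrow> ('n,'k::comm_ring_1) xpoly" where
  "ffpoly u = (\<Prod>i\<in>UNIV. \<Prod>j<Poly_Mapping.lookup u i.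
      (Poly_Mapping.single (Poly_Mapping.single i 1) 1 - Poly_Mapping.single 0 (of_nat j)))"

(*the delta-polynomial multiplying x^w in  x^m P = sum_w x^w Q_w(delta), m = order P;
 here x^m c_{v,u} x^v d^u = c_{v,u} x^(m+v-u) (x^u d^u), so v = w + u - m*)
definition indq :: "('n::finite,'k::comm_ring_1) dop \<Rightarrow> 'n mexp \<Rightarrow> ('n,'k) xpoly" where
  "indq P w = (\<Sum>u\<in>Poly_Mapping.keys P.
      (if \<forall>i. dorder P \<le> Poly_Mapping.lookup w i + Poly_Mapping.lookup u i
       then Poly_Mapping.single 0 (Poly_Mapping.lookup (Poly_Mapping.lookup P u) (w + u - mconst (dorder P))) * ffpoly u
       else 0))"

definition ind :: "('n::finite mexp \<Rightarrow> 'n mexp \<Rightarrow> bool) \<Rightarrow> ('n,'k::comm_ring_1) dop \<Rightarrow> ('n,'k) xpoly" where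
  "ind ord P = (if P = 0 then 0 else
     indq P (THE v. indq P v \<noteq> 0 \<and> (\<forall>w. indq P w \<noteq> 0 \<longrightarrow> ord v w)))"

definition ind_ideal :: "('n::finite mexp \<Rightarrow> 'n mexp \<Rightarrow> bool) \<Rightarrow> ('n,'k::comm_ring_1) dop set
    \<Rightarrow> ('n,'k) xpoly set" where
  "ind_ideal ord G = {ind ord P | P. in_ratideal G P}"

definition pideal :: "('n,'k::comm_ring_1) xpoly list \<Rightarrow> ('n,'k) xpoly set" where
  "pideal fs = {\<Sum>i<length fs. hs i * fs ! i | hs. True}"

(*zero-dimensional: K[y]/<fs> is finite-dimensional over K (equivalently, finitely
 many common zeros over the algebraic closure)*)
definition zero_dim :: "('n,'k::comm_ring_1) xpoly list \<Rightarrow> bool" where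
  "zero_dim fs \<longleftrightarrow> (\<exists>T. finite T \<and> (\<forall>p. \<exists>c.
      p - (\<Sum>t\<in>T. Poly_Mapping.single t (c t)) \<in> pideal fs))"

definition peval :: "('n::finite,'k::comm_ring_1) xpoly \<Rightarrow> 'n mexp \<Rightarrow> 'k" where
  "peval f w = (\<Sum>a\<in>Poly_Mapping.keys f. Poly_Mapping.lookup f a * (\<Prod>i\<in>UNIV. of_nat (Poly_Mapping.lookup w i) ^ Poly_Mapping.lookup a i))"

definition initial_exponent_candidates ::
  "('n::finite mexp \<Rightarrow> 'n mexp \<Rightarrow> bool) \<Rightarrow> ('n,'k::comm_ring_1) dop set \<Rightarrow> 'n mexp set \<Rightarrow> bool" where
  "initial_exponent_candidates ord G S \<longleftrightarrow> (\<exists>fs. pideal fs \<subseteq> ind_ideal ord G \<and> zero_dim fs \<and>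
      S = {w. \<forall>f\<in>set fs. peval f w = 0})"

definition primitive_op :: "('n,'k::comm_ring_1) dop \<Rightarrow> bool" where
  "primitive_op P \<longleftrightarrow> (\<forall>q. (\<forall>u. q dvd Poly_Mapping.lookup P u) \<longrightarrow> q dvd 1)"

definition reduced_prim_GB :: "('n::finite mexp \<Rightarrow> 'n mexp \<Rightarrow> bool) \<Rightarrow> ('n,'k::comm_ring_1) dop set
    \<Rightarrow> (('n,'k) dop \<Rightarrow> bool) \<Rightarrow> bool" where
  "reduced_prim_GB ord M I \<longleftrightarrow> finite M \<and> is_GB ord M I \<and> (\<forall>g\<in>M. primitive_op g) \<and>
     (\<forall>g\<in>M. \<forall>h\<in>M. h \<noteq> g \<longrightarrow> (\<forall>t\<in>Poly_Mapping.keys g. \<not> mdvd (HT ord h) t))"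

definition euler_ops :: "'n mexp \<Rightarrow> ('n,'k::comm_ring_1) dop set" where
  "euler_ops u = {Poly_Mapping.single (Poly_Mapping.single i 1)
                    (Poly_Mapping.single (Poly_Mapping.single i 1) 1)
                  - Poly_Mapping.single 0 (Poly_Mapping.single 0 (of_nat (Poly_Mapping.lookup u i))) | i. True}"

end

theory Submission
  imports Defs "HOL.Vector_Spaces" "HOL-Library.FuncSet" "HOL-Library.Infinite_Set"
begin

text \<open>
  Suppose that \<open>M\<close> is ordinary at the origin. Then, modulo the ideal of \<open>G\<close>, every operator is a
  combination of finitely many derivative terms with coefficients regular at the origin.
  Power series solutions of \<open>G\<close> correspond to linear functionals on the fibre at the origin of
  the quotient by the ideal, and by Nakayama's lemma the dimension of this fibre is at
  least the rank of \<open>G\<close>.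

  Conversely, \<open>d\<close> independent solutions have at least \<open>d\<close> distinct initial exponents; these are
  roots of all indicial polynomials, which gives \<open>B\<close>. Adding the monomials of the remaining
  exponents and eliminating, one obtains series \<open>h\<^sub>u\<close> for \<open>|u| \<le> m\<close> that are annihilated by the
  intersection ideal and agree with \<open>x\<^sup>u\<close> up to degree \<open>m\<close>. Hence no nonzero operator of order at
  most \<open>m\<close> lies in this ideal, while for each \<open>t\<close> of degree \<open>m + 1\<close> a dimension count yields
  an element \<open>a \<partial>\<^sup>t + b\<close> with \<open>b\<close> of order at most \<open>m\<close>. Applying it to the \<open>h\<^sub>u\<close> shows that the
  lowest term of \<open>a\<close> divides that of every \<open>s b - a c\<close>, and a reduction in the style of Mora then
  produces \<open>s b = a c\<close> with \<open>s(0) \<noteq> 0\<close>. So \<open>s \<partial>\<^sup>t + c\<close> lies in the ideal, and the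
  primitive parts of these operators form \<open>M\<close>.
\<close>

text \<open>The derivatives of the series h_u form a matrix that is diagonal with factorial entries
  at the origin, hence invertible there. Solving for b / a in the equations (a d^t + b) h_u = 0
  therefore yields power series. What remains is that a rational function which is a power series
  has a denominator nonzero at the origin. Division by the lowest term of a need not stop in a
  polynomial ring, which is not local; the reduction in the style of Mora bounds the degree in x and
  puts the correction into the unit s. The condition |B| = d makes the dimension count exact: modulo
  the intersection there are at most d + |U_m - B| = |U_m| independent classes, so U_m and one
  further derivative term are dependent. For the other implication, a series f is recovered from the
  values (d^v f)(0), and it solves G as soon as P |-> (P f)(0) vanishes on the ideal. Identities
  between operators are checked on power series, where the action is faithful in characteristic
  zero.\<close>

abbreviation "lookup \<equiv> Poly_Mapping.lookup"
abbreviation "keys \<equiv> Poly_Mapping.keys"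
abbreviation "single \<equiv> Poly_Mapping.single"

section \<open>Exponent vectors\<close>

lemma mdvd_refl [simp]: "mdvd a a"
  by (simp add: mdvd_def)

lemma mdvd_zero_left [simp]: "mdvd 0 a"
  by (simp add: mdvd_def)

lemma mdvd_zero_right [simp]: "mdvd a 0 \<longleftrightarrow> a = 0"
  by (auto simp: mdvd_def intro: poly_mapping_eqI)

lemma mdvd_trans: "mdvd a b \<Longrightarrow> mdvd b c \<Longrightarrow> mdvd a c"
  by (meson mdvd_def order_trans)

lemma mdvd_add [simp]: "mdvd a (a + b)" "mdvd a (b + a)"
  by (simp_all add: mdvd_def lookup_add)

lemma mdvd_diff_add: "mdvd a b \<Longrightarrow> b - a + a = b"
  by (rule poly_mapping_eqI) (simp add: mdvd_def lookup_add lookup_minus)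

lemma mdvd_iff_add: "mdvd a b \<longleftrightarrow> (\<exists>c. b = a + c)"
  by (metis add.commute mdvd_add(1) mdvd_diff_add)

lemma mdvd_add_iff: "mdvd (a + b) c \<longleftrightarrow> mdvd a c \<and> mdvd b (c - a)"
proof -
  have "x + y \<le> z \<longleftrightarrow> x \<le> z \<and> y \<le> z - x" for x y z :: nat by auto
  then show ?thesis by (simp add: mdvd_def lookup_add lookup_minus all_conj_distrib)
qed

lemma diff_diff_mexp: "(a::'n mexp) - b - c = a - (b + c)"
  by (rule poly_mapping_eqI) (simp add: lookup_add lookup_minus)

lemma tdeg_zero [simp]: "tdeg 0 = 0"
  by (simp add: tdeg_def)

lemma tdeg_add: "tdeg (a + b) = tdeg a + tdeg b"
  by (simp add: tdeg_def lookup_add sum.distrib)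

lemma tdeg_eq_0_iff [simp]: "tdeg a = 0 \<longleftrightarrow> a = 0"
  by (auto simp: tdeg_def intro: poly_mapping_eqI)

lemma lookup_le_tdeg: "lookup a i \<le> tdeg a"
  unfolding tdeg_def by (rule member_le_sum) auto

lemma tdeg_single [simp]: "tdeg (single i k) = k"
  by (simp add: tdeg_def lookup_single when_def)

lemma mdvd_tdeg: "mdvd a b \<Longrightarrow> tdeg a \<le> tdeg b"
  by (auto simp: mdvd_iff_add tdeg_add)

lemma mdvd_tdeg_diff: "mdvd a b \<Longrightarrow> tdeg (b - a) = tdeg b - tdeg a"
  by (metis add_diff_cancel_right' mdvd_diff_add tdeg_add)

lemma mdvd_tdeg_eq: "mdvd a b \<Longrightarrow> tdeg b \<le> tdeg a \<Longrightarrow> a = b"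
  by (metis add.left_neutral diff_is_0_eq mdvd_diff_add mdvd_tdeg_diff tdeg_eq_0_iff)

lemma lookup_of_fun [simp]: "lookup (Abs_poly_mapping (g :: 'n::finite \<Rightarrow> nat)) = g"
  by (rule Abs_poly_mapping_inverse) simp

lemma finite_tdeg_le: "finite {u :: 'n::finite mexp. tdeg u \<le> m}"
proof (rule finite_imageD)
  have "lookup ` {u :: 'n mexp. tdeg u \<le> m} \<subseteq> PiE UNIV (\<lambda>_. {..m})"
    using lookup_le_tdeg order_trans by (fastforce simp: PiE_def extensional_def)
  then show "finite (lookup ` {u :: 'n mexp. tdeg u \<le> m})"
    by (rule finite_subset) (auto intro: finite_PiE)
  show "inj_on lookup {u :: 'n mexp. tdeg u \<le> m}"
    by (rule inj_onI) (simp add: lookup_inject)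
qed

lemma finite_mdvd [simp]: "finite {k. mdvd k (b :: 'n::finite mexp)}"
  by (rule finite_subset[OF _ finite_tdeg_le[of "tdeg b"]]) (auto dest: mdvd_tdeg)

lemma mexp_induct [case_names zero add]:
  fixes v :: "'n::finite mexp"
  assumes "P 0" and "\<And>v i. P v \<Longrightarrow> P (v + single i 1)"
  shows "P v"
proof (induction "tdeg v" arbitrary: v)
  case 0
  then show ?case using assms(1) by simp
next
  case (Suc k)
  then obtain i where i: "lookup v i \<noteq> 0"
    by (metis nat.distinct(1) poly_mapping_eqI lookup_zero tdeg_eq_0_iff)
  then have d: "mdvd (single i 1) v"
    by (auto simp: mdvd_def lookup_single when_def)
  have "tdeg (v - single i 1) = k"
    using Suc.hyps(2) mdvd_tdeg_diff[OF d] by simp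
  then have "P (v - single i 1 + single i 1)"
    using Suc.hyps(1) assms(2) by blast
  then show ?case using mdvd_diff_add[OF d] by simp
qed

text \<open>The divisors of \<open>b\<close> form a product of intervals, so a product of
  one-variable sums expands into a sum over them. This carries one-variable identities over to
  exponent vectors.\<close>

lemma sum_prod_mdvd:
  fixes b :: "'n::finite mexp" and F :: "'n \<Rightarrow> nat \<Rightarrow> 'a::comm_semiring_1"
  shows "(\<Sum>k | mdvd k b. \<Prod>i\<in>UNIV. F i (lookup k i)) = (\<Prod>i\<in>UNIV. \<Sum>j\<le>lookup b i. F i j)"
proof -
  have "(\<Prod>i\<in>UNIV. \<Sum>j\<le>lookup b i. F i j) =
      (\<Sum>g\<in>PiE UNIV (\<lambda>i. {..lookup b i}). \<Prod>i\<in>UNIV. F i (g i))"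
    by (rule prod_sum_PiE) auto
  also have "\<dots> = (\<Sum>k | mdvd k b. \<Prod>i\<in>UNIV. F i (lookup k i))"
    by (rule sum.reindex_bij_witness[of _ lookup Abs_poly_mapping])
      (auto simp: PiE_def extensional_def mdvd_def)
  finally show ?thesis by simp
qed

section \<open>Falling factorials and Vandermonde's identity\<close>

lemma ffall_eq: "ffall a k = fact k * (a choose k)"
proof (induction k)
  case (Suc k)
  have "(a - k) * (a choose k) = Suc k * (a choose Suc k)"
    by (metis binomial_absorb_comp binomial_absorption)
  then show ?case using Suc by (simp add: ffall_def algebra_simps)
qed (simp add: ffall_def)

lemma ffall_eq_0: "a < k \<Longrightarrow> ffall a k = 0"
  by (simp add: ffall_eq)

lemma ffall_vandermonde:
  "(\<Sum>k\<le>b. (b choose k) * (ffall x k * ffall y (b - k))) = ffall (x + y) b"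
proof -
  have "(b choose k) * (ffall x k * ffall y (b - k)) = fact b * ((x choose k) * (y choose (b - k)))"
    if "k \<le> b" for k
    by (simp add: ffall_eq binomial_fact_lemma[OF that, symmetric] algebra_simps)
  then have "(\<Sum>k\<le>b. (b choose k) * (ffall x k * ffall y (b - k))) =
      fact b * (\<Sum>k\<le>b. (x choose k) * (y choose (b - k)))"
    by (simp add: sum_distrib_left)
  also have "\<dots> = ffall (x + y) b"
    by (simp add: vandermonde ffall_eq)
  finally show ?thesis .
qed

lemma ffallm_vandermonde:
  "(\<Sum>k | mdvd k b. binomm b k * (ffallm x k * ffallm y (b - k))) = ffallm (x + y) b"
proof -
  have "(\<Sum>k | mdvd k b. binomm b k * (ffallm x k * ffallm y (b - k))) =
    (\<Sum>k | mdvd k b. \<Prod>i\<in>UNIV. (lookup b i choose lookup k i) *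
       (ffall (lookup x i) (lookup k i) * ffall (lookup y i) (lookup b i - lookup k i)))"
    by (simp add: binomm_def ffallm_def lookup_minus prod.distrib)
  also have "\<dots> = ffallm (x + y) b"
    unfolding sum_prod_mdvd[where F = "\<lambda>i j. (lookup b i choose j) *
       (ffall (lookup x i) j * ffall (lookup y i) (lookup b i - j))"]
    by (simp add: ffall_vandermonde ffallm_def lookup_add)
  finally show ?thesis .
qed

lemma ffall_add: "ffall a (j + k) = ffall a j * ffall (a - j) k"
  by (induction k) (simp_all add: ffall_def algebra_simps)

lemma ffallm_add: "ffallm a (j + k) = ffallm a j * ffallm (a - j) k"
  by (simp add: ffallm_def lookup_add lookup_minus ffall_add prod.distrib)

text \<open>Exponents are subtracted with truncation; this vanishing removes the terms d^k x^a in
  which \<open>a - k\<close> would be truncated.\<close>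

lemma ffallm_eq_0: "\<not> mdvd k a \<Longrightarrow> ffallm a k = 0"
  by (auto simp: mdvd_def ffallm_def not_le) (metis ffall_eq_0)

lemma ffallm_zero [simp]: "ffallm a 0 = 1"
  by (simp add: ffallm_def ffall_def)

lemma ffallm_self_neq_0 [simp]: "ffallm a a \<noteq> 0"
  by (simp add: ffallm_def ffall_eq)

lemma binomm_zero [simp]: "binomm b 0 = 1"
  by (simp add: binomm_def)

section \<open>The action of operators on formal power series\<close>

text \<open>Product of a polynomial and a series. Summing over the divisors of \<open>w\<close>
  instead of the support of \<open>p\<close> makes additivity in \<open>p\<close> immediate.\<close>

definition pact :: "('n::finite,'k::comm_ring_1) xpoly \<Rightarrow> ('n mexp \<Rightarrow> 'k) \<Rightarrow> 'n mexp \<Rightarrow> 'k" where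
  "pact p f w = (\<Sum>v | mdvd v w. lookup p v * f (w - v))"

definition dact :: "'n::finite mexp \<Rightarrow> ('n mexp \<Rightarrow> 'k::comm_ring_1) \<Rightarrow> 'n mexp \<Rightarrow> 'k" where
  "dact u f w = of_nat (ffallm (w + u) u) * f (w + u)"

lemma poly_mapping_sum_single: "(\<Sum>a\<in>keys p. single a (lookup p a)) = p"
  by (rule poly_mapping_eqI)
    (auto simp: lookup_sum lookup_single when_def in_keys_iff sum.delta)

lemma pact_zero [simp]: "pact 0 f = (\<lambda>_. 0)"
  by (rule ext) (simp add: pact_def)

lemma pact_zero_right [simp]: "pact p (\<lambda>_. 0) = (\<lambda>_. 0)"
  by (rule ext) (simp add: pact_def)

lemma pact_add: "pact (p + q) f w = pact p f w + pact q f w"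
  by (simp add: pact_def lookup_add algebra_simps sum.distrib)

lemma pact_sum: "pact (sum p A) f w = (\<Sum>a\<in>A. pact (p a) f w)"
  by (induction A rule: infinite_finite_induct) (simp_all add: pact_add)

lemma pact_right_add: "pact p (\<lambda>w. f w + g w) w = pact p f w + pact p g w"
  by (simp add: pact_def algebra_simps sum.distrib)

lemma pact_right_cmul: "pact p (\<lambda>w. c * f w) w = c * pact p f w"
  by (simp add: pact_def algebra_simps sum_distrib_left)

lemma pact_right_sum: "pact p (\<lambda>w. \<Sum>a\<in>A. f a w) w = (\<Sum>a\<in>A. pact p (f a) w)"
  by (induction A rule: infinite_finite_induct) (simp_all add: pact_right_add)

lemma pact_of_nat: "pact (of_nat n * p) f w = of_nat n * pact p f w"
  by (induction n) (simp_all add: pact_add algebra_simps)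

lemma pact_single: "pact (single a c) f w = (if mdvd a w then c * f (w - a) else 0)"
proof -
  have "pact (single a c) f w = (\<Sum>v | mdvd v w. if v = a then c * f (w - a) else 0)"
    unfolding pact_def by (rule sum.cong) (auto simp: lookup_single when_def)
  then show ?thesis by (simp add: sum.delta')
qed

lemma pact_expand: "pact p f w = (\<Sum>a\<in>keys p. pact (single a (lookup p a)) f w)"
  by (metis pact_sum poly_mapping_sum_single)

lemma pact_mult: "pact (p * q) f = pact p (pact q f)"
proof
  fix w
  have *: "pact (single a c * single b d) f w = pact (single a c) (pact (single b d) f) w" for a b c d
    by (simp add: mult_single pact_single mdvd_add_iff diff_diff_mexp mult.assoc)
  have "p * q = (\<Sum>a\<in>keys p. \<Sum>b\<in>keys q. single a (lookup p a) * single b (lookup q b))"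
    by (simp only: sum_product[symmetric] poly_mapping_sum_single)
  then have "pact (p * q) f w = (\<Sum>a\<in>keys p. \<Sum>b\<in>keys q.
      pact (single a (lookup p a)) (pact (single b (lookup q b)) f) w)"
    by (simp only: pact_sum *)
  also have "\<dots> = (\<Sum>a\<in>keys p. pact (single a (lookup p a)) (pact q f) w)"
    by (simp only: pact_right_sum[symmetric] pact_expand[of q, symmetric])
  also have "\<dots> = pact p (pact q f) w"
    by (rule pact_expand[symmetric])
  finally show "pact (p * q) f w = pact p (pact q f) w" .
qed

lemma pact_one [simp]: "pact 1 f = f"
  by (rule ext) (simp add: pact_single flip: single_one)

lemma dact_zero [simp]: "dact 0 f = f"
  by (rule ext) (simp add: dact_def)

lemma dact_add: "dact (u + v) f = dact u (dact v f)"
proof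
  fix w
  have "w + (u + v) - v = w + u" by (metis add.assoc add_diff_cancel_right')
  then have "ffallm (w + (u + v)) (u + v) = ffallm (w + (u + v)) v * ffallm (w + u) u"
    using ffallm_add[of "w + (u + v)" v u] by (simp add: add.commute)
  then show "dact (u + v) f w = dact u (dact v f) w"
    by (simp add: dact_def algebra_simps)
qed

lemma dact_right_sum: "dact u (\<lambda>w. \<Sum>a\<in>A. f a w) w = (\<Sum>a\<in>A. dact u (f a) w)"
  by (simp add: dact_def sum_distrib_left)

text \<open>For a monomial every summand is a multiple of the one value
  \<open>c * g (w + b - a)\<close>, and the scalars add up by Vandermonde's identity for
  \<open>a\<close> and \<open>w + b - a\<close>. The case distinctions show that summands with
  truncated exponents vanish.\<close>

lemma leibniz_single:
  "dact b (pact (single a c) g) w = (\<Sum>k | mdvd k b. of_nat (binomm b k) *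
     pact (single (a - k) (of_nat (ffallm a k) * c)) (dact (b - k) g) w)"
proof (cases "mdvd a (w + b)")
  case False
  have "\<not> mdvd (a - k) w" if "mdvd k b" for k
  proof -
    obtain i where "\<not> lookup a i \<le> lookup (w + b) i"
      using False unfolding mdvd_def by metis
    moreover have "lookup k i \<le> lookup b i"
      using that by (simp add: mdvd_def)
    ultimately have "lookup w i < lookup (a - k) i" by (simp add: lookup_minus lookup_add)
    then show ?thesis unfolding mdvd_def by (meson not_le)
  qed
  then show ?thesis using False by (simp add: dact_def pact_single)
next
  case True
  have *: "of_nat (binomm b k) * pact (single (a - k) (of_nat (ffallm a k) * c)) (dact (b - k) g) w
     = of_nat (binomm b k * (ffallm a k * ffallm (w + b - a) (b - k))) * (c * g (w + b - a))"
    if k: "mdvd k b" for k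
  proof (cases "mdvd k a")
    case False
    then show ?thesis by (simp add: ffallm_eq_0)
  next
    case ka: True
    show ?thesis
    proof (cases "mdvd (a - k) w")
      case False
      then obtain i where i: "lookup a i - lookup k i > lookup w i"
        unfolding mdvd_def lookup_minus by (meson not_le)
      have "lookup a i \<le> lookup w i + lookup b i" "lookup k i \<le> lookup a i" "lookup k i \<le> lookup b i"
        using True ka k by (simp_all add: mdvd_def lookup_add)
      with i have "lookup (w + b - a) i < lookup (b - k) i"
        by (simp add: lookup_minus lookup_add)
      then have "\<not> mdvd (b - k) (w + b - a)"
        unfolding mdvd_def by (meson not_le)
      then show ?thesis using False by (simp add: pact_single ffallm_eq_0)
    next
      case aw: True
      have "w - (a - k) + (b - k) = w + b - a"
      proof (rule poly_mapping_eqI)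
        fix i
        have "lookup a i \<le> lookup w i + lookup b i" "lookup k i \<le> lookup a i"
            "lookup k i \<le> lookup b i" "lookup a i - lookup k i \<le> lookup w i"
          using True ka k aw by (simp_all add: mdvd_def lookup_add lookup_minus)
        then show "lookup (w - (a - k) + (b - k)) i = lookup (w + b - a) i"
          by (simp add: lookup_add lookup_minus)
      qed
      then show ?thesis using aw by (simp add: pact_single dact_def algebra_simps)
    qed
  qed
  have "(\<Sum>k | mdvd k b. of_nat (binomm b k) *
     pact (single (a - k) (of_nat (ffallm a k) * c)) (dact (b - k) g) w)
    = of_nat (\<Sum>k | mdvd k b. binomm b k * (ffallm a k * ffallm (w + b - a) (b - k))) * (c * g (w + b - a))"
    by (simp add: * sum_distrib_right del: of_nat_mult)
  also have "\<dots> = of_nat (ffallm (w + b) b) * (c * g (w + b - a))"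
    by (simp add: ffallm_vandermonde mdvd_diff_add[OF True] add.commute[of a])
  finally show ?thesis using True by (simp add: dact_def pact_single)
qed

lemma leibniz:
  "dact b (pact e g) w = (\<Sum>k | mdvd k b. of_nat (binomm b k) * pact (xderiv k e) (dact (b - k) g) w)"
proof -
  have "pact e g = (\<lambda>w. \<Sum>a\<in>keys e. pact (single a (lookup e a)) g w)"
    by (rule ext) (rule pact_expand)
  then have "dact b (pact e g) w = (\<Sum>a\<in>keys e. dact b (pact (single a (lookup e a)) g) w)"
    by (simp only: dact_right_sum)
  also have "\<dots> = (\<Sum>k | mdvd k b. \<Sum>a\<in>keys e. of_nat (binomm b k) *
     pact (single (a - k) (of_nat (ffallm a k) * lookup e a)) (dact (b - k) g) w)"
    unfolding leibniz_single by (rule sum.swap)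
  also have "\<dots> = (\<Sum>k | mdvd k b. of_nat (binomm b k) * pact (xderiv k e) (dact (b - k) g) w)"
    by (simp add: xderiv_def pact_sum sum_distrib_left)
  finally show ?thesis .
qed

text \<open>A common finite superset of the supports allows operators with different supports to be
  compared term by term.\<close>

lemma apply_op_eq:
  assumes "finite A" "keys P \<subseteq> A"
  shows "apply_op P f w = (\<Sum>u\<in>A. pact (lookup P u) (dact u f) w)"
proof -
  have "apply_op P f w = (\<Sum>u\<in>keys P. pact (lookup P u) (dact u f) w)"
    unfolding apply_op_def pact_expand[of "lookup P _"]
    by (intro sum.cong refl) (simp add: pact_single dact_def mult.assoc)
  also have "\<dots> = (\<Sum>u\<in>A. pact (lookup P u) (dact u f) w)"
    using assms by (intro sum.mono_neutral_left) (auto simp: in_keys_iff)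
  finally show ?thesis .
qed

lemma apply_op_add: "apply_op (P + Q) f w = apply_op P f w + apply_op Q f w"
  using keys_add[of P Q]
  by (simp add: apply_op_eq[of "keys P \<union> keys Q"] lookup_add pact_add sum.distrib)

lemma apply_op_zero [simp]: "apply_op 0 f = (\<lambda>_. 0)"
  by (rule ext) (simp add: apply_op_def)

lemma apply_op_sum: "apply_op (sum P A) f w = (\<Sum>a\<in>A. apply_op (P a) f w)"
  by (induction A rule: infinite_finite_induct) (simp_all add: apply_op_add)

lemma apply_op_uminus: "apply_op (- P) f w = - apply_op P f w"
  using apply_op_add[of P "- P" f w] by (simp add: eq_neg_iff_add_eq_0 add.commute)

lemma apply_op_diff: "apply_op (P - Q) f w = apply_op P f w - apply_op Q f w"
  using apply_op_add[of P "- Q" f w] by (simp add: apply_op_uminus)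

lemma apply_op_single: "apply_op (single u c) f = pact c (dact u f)"
  by (rule ext) (simp add: apply_op_eq[of "{u}"])

lemma apply_op_expand: "apply_op P f w = (\<Sum>u\<in>keys P. pact (lookup P u) (dact u f) w)"
  by (simp add: apply_op_eq)

lemma apply_op_right_add: "apply_op P (\<lambda>w. f w + g w) w = apply_op P f w + apply_op P g w"
proof -
  have "dact u (\<lambda>w. f w + g w) = (\<lambda>w. dact u f w + dact u g w)" for u
    by (rule ext) (simp add: dact_def algebra_simps)
  then show ?thesis by (simp add: apply_op_expand pact_right_add sum.distrib)
qed

lemma apply_op_right_cmul: "apply_op P (\<lambda>w. c * f w) w = c * apply_op P f w"
proof -
  have "dact u (\<lambda>w. c * f w) = (\<lambda>w. c * dact u f w)" for u
    by (rule ext) (simp add: dact_def algebra_simps)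
  then show ?thesis by (simp add: apply_op_expand pact_right_cmul sum_distrib_left)
qed

lemma apply_op_right_zero [simp]: "apply_op P (\<lambda>_. 0) = (\<lambda>_. 0)"
  using apply_op_right_cmul[of P 0 "\<lambda>_. 0"] by (simp add: fun_eq_iff)

lemma apply_op_right_sum: "apply_op P (\<lambda>w. \<Sum>a\<in>A. f a w) w = (\<Sum>a\<in>A. apply_op P (f a) w)"
  by (induction A rule: infinite_finite_induct) (simp_all add: apply_op_right_add)

text \<open>\<open>dmult\<close> is the Leibniz rule written out on coefficients, so composing the
  actions reproduces it summand by summand.\<close>

lemma apply_op_dmult: "apply_op (dmult P Q) f = apply_op P (apply_op Q f)"
proof
  fix w
  have *: "(\<Sum>k | mdvd k b. pact (of_nat (binomm b k) * lookup P b * xderiv k (lookup Q d)) (dact (b - k + d) f) w)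
     = pact (lookup P b) (dact b (pact (lookup Q d) (dact d f))) w" for b d
  proof -
    have "dact b (pact (lookup Q d) (dact d f)) =
       (\<lambda>w. \<Sum>k | mdvd k b. of_nat (binomm b k) * pact (xderiv k (lookup Q d)) (dact (b - k) (dact d f)) w)"
      by (rule ext) (rule leibniz)
    then show ?thesis
      by (simp add: pact_right_sum pact_right_cmul mult.assoc pact_of_nat[where p = 1, simplified] pact_mult dact_add)
  qed
  have Q: "apply_op Q f = (\<lambda>w. \<Sum>d\<in>keys Q. pact (lookup Q d) (dact d f) w)"
    by (rule ext) (rule apply_op_expand)
  have dQ: "dact b (apply_op Q f) = (\<lambda>w. \<Sum>d\<in>keys Q. dact b (pact (lookup Q d) (dact d f)) w)" for b
    unfolding Q by (rule ext) (rule dact_right_sum)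
  show "apply_op (dmult P Q) f w = apply_op P (apply_op Q f) w"
    unfolding dmult_def apply_op_expand[of P] dQ pact_right_sum
    by (simp add: apply_op_sum apply_op_single *)
qed

section \<open>Monomials as test series and faithfulness of the action\<close>

definition mono_series :: "'n mexp \<Rightarrow> 'n mexp \<Rightarrow> 'k::comm_ring_1" where
  "mono_series u w = (if w = u then 1 else 0)"

lemma dact_mono_series:
  "dact v (mono_series u) w = (if mdvd v u \<and> w = u - v then of_nat (ffallm u v) else 0)"
  by (auto simp: dact_def mono_series_def mdvd_diff_add)

lemma pact_mono_zero: "pact p (\<lambda>w. if w = 0 then c else 0) w = lookup p w * c"
proof -
  have "pact p (\<lambda>w. if w = 0 then c else 0) w = (\<Sum>v | mdvd v w. if v = w then lookup p w * c else 0)"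
    unfolding pact_def
    by (rule sum.cong) (auto, metis add.left_neutral mdvd_diff_add)
  then show ?thesis by (simp add: sum.delta')
qed

text \<open>Test \<open>P\<close> on x^u for a derivative exponent \<open>u\<close> of least degree
  in \<open>P\<close>. No other derivative exponent of \<open>P\<close> divides \<open>u\<close>, so
  only u! times the coefficient of d^u survives, and u! is nonzero in characteristic zero.\<close>

lemma apply_op_faithful_0:
  fixes P :: "('n::finite,'k::field_char_0) dop"
  assumes "\<And>u. apply_op P (mono_series u) = (\<lambda>_. 0)"
  shows "P = 0"
proof (rule ccontr)
  assume "P \<noteq> 0"
  then obtain u where u: "u \<in> keys P" and min: "\<And>v. v \<in> keys P \<Longrightarrow> tdeg u \<le> tdeg v"
    using ex_has_least_nat[of "\<lambda>u. u \<in> keys P" _ tdeg] by (metis all_not_in_conv keys_eq_empty)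
  have "lookup (lookup P u) w = 0" for w
  proof -
    have "pact (lookup P v) (dact v (mono_series u)) w = (if v = u then lookup (lookup P u) w * of_nat (ffallm u u) else 0)"
      if "v \<in> keys P" for v
    proof (cases "v = u")
      case True
      have "dact u (mono_series u) = (\<lambda>w. if w = 0 then of_nat (ffallm u u) :: 'k else 0)"
        by (rule ext) (auto simp: dact_mono_series)
      then show ?thesis using True by (simp add: pact_mono_zero)
    next
      case False
      then have "\<not> mdvd v u" using min[OF that] mdvd_tdeg_eq by blast
      then have "dact v (mono_series u) = (\<lambda>_. 0 :: 'k)" by (auto simp: dact_mono_series)
      then show ?thesis using False by simp
    qed
    then have "apply_op P (mono_series u) w = lookup (lookup P u) w * of_nat (ffallm u u)"
      using u by (simp add: apply_op_expand sum.delta')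
    then show ?thesis using assms[of u] by simp
  qed
  then have "lookup P u = 0" by (intro poly_mapping_eqI) simp
  then show False using u by (simp add: in_keys_iff)
qed

lemma apply_op_faithful:
  fixes P Q :: "('n::finite,'k::field_char_0) dop"
  assumes "\<And>f w. apply_op P f w = apply_op Q f w"
  shows "P = Q"
  using apply_op_faithful_0[of "P - Q"] assms by (simp add: apply_op_diff fun_eq_iff)

section \<open>Ring laws of the operator product\<close>

text \<open>Left multiplication by a coefficient involves no commutation, so the built-in
  commutative product computes it and brings its algebra along; \<open>dmult_xop\<close> is the link
  to \<open>dmult\<close>.\<close>

abbreviation smul :: "('n,'k::comm_ring_1) xpoly \<Rightarrow> ('n,'k) dop \<Rightarrow> ('n,'k) dop" (infixr "\<odot>" 75) where
  "q \<odot> P \<equiv> single 0 q * P"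

abbreviation dterm :: "'n mexp \<Rightarrow> ('n,'k::comm_ring_1) dop" where
  "dterm u \<equiv> single u 1"

lemma lookup_smul [simp]: "lookup (q \<odot> P) u = q * lookup P u"
  by (simp add: mult_map_scale_conv_mult[symmetric] Poly_Mapping.map.rep_eq when_def)

lemma keys_smul: "keys (q \<odot> P) \<subseteq> keys P"
  by (auto simp: in_keys_iff)

lemma smul_dterm: "q \<odot> dterm u = single u q"
  by (simp add: mult_single)

lemma dop_expand: "P = (\<Sum>u\<in>keys P. lookup P u \<odot> dterm u)"
  by (simp add: smul_dterm poly_mapping_sum_single)

lemma apply_op_smul: "apply_op (q \<odot> P) f = pact q (apply_op P f)"
proof
  fix w
  have P: "apply_op P f = (\<lambda>w. \<Sum>d\<in>keys P. pact (lookup P d) (dact d f) w)"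
    by (rule ext) (rule apply_op_expand)
  show "apply_op (q \<odot> P) f w = pact q (apply_op P f) w"
    unfolding P by (simp add: apply_op_eq[OF finite_keys keys_smul] pact_mult pact_right_sum)
qed

lemma apply_op_dterm: "apply_op (dterm u) f = dact u f"
  by (simp add: apply_op_single)

lemma apply_op_xop: "apply_op (xop q) f = pact q f"
  by (simp add: xop_def apply_op_single)

lemma dmult_xop: "dmult (xop q) (P :: ('n::finite,'k::field_char_0) dop) = q \<odot> P"
  by (rule apply_op_faithful) (simp add: apply_op_dmult apply_op_xop apply_op_smul)

lemma dmult_assoc: "dmult (dmult A B) (P :: ('n::finite,'k::field_char_0) dop) = dmult A (dmult B P)"
  by (rule apply_op_faithful) (simp add: apply_op_dmult)

lemma dmult_add_right: "dmult A (P + Q :: ('n::finite,'k::field_char_0) dop) = dmult A P + dmult A Q"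
proof (rule apply_op_faithful)
  fix f w
  have "apply_op (P + Q) f = (\<lambda>w. apply_op P f w + apply_op Q f w)"
    by (rule ext) (rule apply_op_add)
  then show "apply_op (dmult A (P + Q)) f w = apply_op (dmult A P + dmult A Q) f w"
    by (simp add: apply_op_dmult apply_op_add apply_op_right_add)
qed

lemma dmult_zero_right: "dmult A 0 = (0 :: ('n::finite,'k::field_char_0) dop)"
  by (simp add: dmult_def)

lemma dmult_dterm_zero: "dmult (dterm 0) (P :: ('n::finite,'k::field_char_0) dop) = P"
  by (rule apply_op_faithful) (simp add: apply_op_dmult apply_op_dterm del: single_one)

lemma dmult_dterm_add: "dmult (dterm (u + v)) (P :: ('n::finite,'k::field_char_0) dop) = dmult (dterm u) (dmult (dterm v) P)"
  by (rule apply_op_faithful) (simp add: apply_op_dmult apply_op_dterm dact_add)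

lemma mdvd_unit: "{k. mdvd k (single i (1::nat))} = {0, single i 1}"
proof -
  have "k = 0 \<or> k = single i 1" if k: "mdvd k (single i 1)" for k
  proof -
    have *: "lookup k j \<le> (if i = j then 1 else 0)" for j
      using k unfolding mdvd_def lookup_single when_def by blast
    have "lookup k j = lookup (single i (lookup k i)) j" for j
      using *[of j] by (simp add: lookup_single when_def split: if_splits)
    then have "k = single i (lookup k i)" by (rule poly_mapping_eqI)
    moreover have "lookup k i = 0 \<or> lookup k i = 1" using *[of i] by auto
    ultimately show ?thesis by (metis single_zero)
  qed
  then show ?thesis by auto
qed

lemma xderiv_zero [simp]: "xderiv 0 p = p"
  by (simp add: xderiv_def poly_mapping_sum_single)

text \<open>The product rule for one derivation, used to move derivatives past denominators.\<close>

lemma dmult_unit_smul: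
  fixes P :: "('n::finite,'k::field_char_0) dop" and i :: 'n
  defines "e \<equiv> single i (1::nat)"
  shows "dmult (dterm e) (q \<odot> P) = q \<odot> dmult (dterm e) P + xderiv e q \<odot> P"
proof (rule apply_op_faithful)
  fix f w
  have neq: "e \<noteq> 0" unfolding e_def by (metis lookup_single_eq lookup_zero zero_neq_one)
  have b: "binomm e e = 1" by (simp add: binomm_def)
  have "dact e (pact q g) w = pact q (dact e g) w + pact (xderiv e q) g w" for g w
    unfolding leibniz using neq b by (simp add: mdvd_unit[of i, folded e_def])
  then show "apply_op (dmult (dterm e) (q \<odot> P)) f w
      = apply_op (q \<odot> dmult (dterm e) P + xderiv e q \<odot> P) f w"
    by (simp add: apply_op_dmult apply_op_add apply_op_smul apply_op_dterm)
qed

text \<open>A polynomial is recovered from its action on the constant series 1, so coefficients of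
  products inherit what is known about \<open>pact\<close>.\<close>

lemma lookup_times: "lookup (p * q) = pact p (lookup (q :: ('n::finite,'k::comm_ring_1) xpoly))"
proof -
  have *: "pact p (\<lambda>w. if w = 0 then 1 else 0) = lookup p" for p :: "('n,'k) xpoly"
    by (rule ext) (simp add: pact_mono_zero)
  have "lookup (p * q) = pact (p * q) (\<lambda>w. if w = 0 then 1 else 0)" by (rule *[symmetric])
  also have "\<dots> = pact p (lookup q)" by (subst pact_mult) (simp only: *)
  finally show ?thesis .
qed

lemma lookup_times_0: "lookup (p * q) 0 = lookup p 0 * lookup (q :: ('n::finite,'k::comm_ring_1) xpoly) 0"
  by (simp add: lookup_times pact_def)

section \<open>Graded term orders\<close>

lemma finite_total_has_min:
  assumes "finite A" "A \<noteq> {}" and tot: "\<And>a b. r a b \<or> r b a" and tr: "\<And>a b c. r a b \<Longrightarrow> r b c \<Longrightarrow> r a c"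
  shows "\<exists>a\<in>A. \<forall>b\<in>A. r a b"
  using assms(1,2)
proof (induction A rule: finite_ne_induct)
  case (singleton x)
  then show ?case using tot by blast
next
  case (insert x F)
  then obtain a where a: "a \<in> F" "\<forall>b\<in>F. r a b" by blast
  show ?case
  proof (cases "r a x")
    case True
    then show ?thesis using a by blast
  next
    case False
    then have "r x a" using tot by blast
    then show ?thesis using a tot[of x x] tr by blast
  qed
qed

locale graded_order =
  fixes ord :: "'n::finite mexp \<Rightarrow> 'n mexp \<Rightarrow> bool"
  assumes graded: "graded_term_order ord"
begin

lemmas graded_laws = graded[unfolded graded_term_order_def]

lemma ord_refl [simp]: "ord a a"
  using graded_laws[THEN conjunct1] by blast

lemma ord_antisym: "ord a b \<Longrightarrow> ord b a \<Longrightarrow> a = b"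
  using graded_laws[THEN conjunct2, THEN conjunct1] by blast

lemma ord_trans: "ord a b \<Longrightarrow> ord b c \<Longrightarrow> ord a c"
  using graded_laws[THEN conjunct2, THEN conjunct2, THEN conjunct1] by blast

lemma ord_linear: "ord a b \<or> ord b a"
  using graded_laws[THEN conjunct2, THEN conjunct2, THEN conjunct2, THEN conjunct1] by blast

lemma ord_zero [simp]: "ord 0 a"
  using graded_laws[THEN conjunct2, THEN conjunct2, THEN conjunct2, THEN conjunct2, THEN conjunct1] by blast

lemma ord_add_right: "ord a b \<Longrightarrow> ord (a + c) (b + c)"
  by (rule graded_laws[THEN conjunct2, THEN conjunct2, THEN conjunct2, THEN conjunct2, THEN conjunct2, THEN conjunct1, rule_format])

lemma ord_less_tdeg: "tdeg a < tdeg b \<Longrightarrow> ord a b"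
  using graded_laws[THEN conjunct2, THEN conjunct2, THEN conjunct2, THEN conjunct2, THEN conjunct2, THEN conjunct2] by blast

lemma ord_tdeg: "ord a b \<Longrightarrow> tdeg a \<le> tdeg b"
  using ord_antisym[of a b] ord_less_tdeg[of b a] by (cases "tdeg b < tdeg a") auto

lemma ord_add:
  assumes "ord a b" "ord c d"
  shows "ord (a + c) (b + d)"
proof (rule ord_trans)
  show "ord (a + c) (b + c)" using assms(1) by (rule ord_add_right)
  show "ord (b + c) (b + d)"
    using ord_add_right[OF assms(2), of b] by (simp add: add.commute)
qed

lemma ord_mdvd: "mdvd a b \<Longrightarrow> ord a b"
  by (metis add.left_neutral mdvd_diff_add ord_add_right ord_zero)

text \<open>Strict monotonicity of addition: an extreme term of a product comes from a single pair
  of factors and cannot cancel.\<close>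

lemma ord_add_eq:
  assumes "ord a a'" "ord b b'" "a + b = a' + b'"
  shows "a = a'" "b = b'"
proof -
  have "ord (a + b) (a' + b)" "ord (a' + b) (a' + b')"
    using assms(1,2) by (auto intro: ord_add)
  then have "a + b = a' + b" using assms(3) ord_antisym by metis
  then show "a = a'" by simp
  then show "b = b'" using assms(3) by simp
qed

lemma finite_ord_le: "finite {v. ord v u}"
  by (rule finite_subset[OF _ finite_tdeg_le[of "tdeg u"]]) (auto dest: ord_tdeg)

text \<open>A graded order has only finitely many exponents below a given one, which reduces the
  claim to finite sets.\<close>

lemma ex_ord_min:
  assumes "A \<noteq> {}"
  shows "\<exists>a\<in>A. \<forall>b\<in>A. ord a b"
proof -
  obtain u where u: "u \<in> A" using assms by blast
  have "finite (A \<inter> {v. ord v u})" "A \<inter> {v. ord v u} \<noteq> {}"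
    using u finite_ord_le by auto
  then have "\<exists>a\<in>A \<inter> {v. ord v u}. \<forall>b\<in>A \<inter> {v. ord v u}. ord a b"
    by (rule finite_total_has_min) (use ord_linear ord_trans in blast)+
  then obtain a where a: "a \<in> A" "ord a u" "\<forall>b\<in>A. ord b u \<longrightarrow> ord a b" by auto
  then have "\<forall>b\<in>A. ord a b" by (metis ord_linear ord_trans)
  then show ?thesis using a by blast
qed

lemma ex_ord_max:
  assumes "finite A" "A \<noteq> {}"
  shows "\<exists>a\<in>A. \<forall>b\<in>A. ord b a"
  by (rule finite_total_has_min[OF assms]) (use ord_linear ord_trans in blast)+

lemma ord_induct [case_names less]:
  assumes "\<And>u. (\<And>v. ord v u \<Longrightarrow> v \<noteq> u \<Longrightarrow> P v) \<Longrightarrow> P u"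
  shows "P u"
proof (rule ccontr)
  assume "\<not> P u"
  then obtain a where "\<not> P a" "\<And>b. \<not> P b \<Longrightarrow> ord a b"
    using ex_ord_min[of "{u. \<not> P u}"] by auto
  then show False using assms ord_antisym by blast
qed

lemma HT:
  assumes "P \<noteq> 0"
  shows HT_in_keys: "HT ord P \<in> keys P" and HT_max: "v \<in> keys P \<Longrightarrow> ord v (HT ord P)"
proof -
  have "\<exists>u\<in>keys P. \<forall>v\<in>keys P. ord v u"
    using assms by (intro ex_ord_max) auto
  then have "\<exists>!u. u \<in> keys P \<and> (\<forall>v\<in>keys P. ord v u)"
    using ord_antisym by blast
  then have "HT ord P \<in> keys P \<and> (\<forall>v\<in>keys P. ord v (HT ord P))"
    unfolding HT_def by (rule theI')
  then show "HT ord P \<in> keys P" "v \<in> keys P \<Longrightarrow> ord v (HT ord P)" by blast+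
qed

lemma HT_eqI:
  assumes "u \<in> keys P" "\<And>v. v \<in> keys P \<Longrightarrow> ord v u"
  shows "HT ord P = u"
  using HT[of P] assms by (metis keys_zero empty_iff ord_antisym)

text \<open>\<open>a\<close> and \<open>b\<close> only bound the supports from below. This is used
  with \<open>b = 0\<close> for series whose constant term may vanish.\<close>

lemma pact_lowest:
  assumes p: "\<And>v. lookup p v \<noteq> 0 \<Longrightarrow> ord a v" and f: "\<And>v. f v \<noteq> 0 \<Longrightarrow> ord b v"
  shows pact_lowest_coeff: "pact p f (a + b) = lookup p a * f b"
    and pact_lowest_le: "pact p f w \<noteq> 0 \<Longrightarrow> ord (a + b) w"
proof -
  have "lookup p v * f (a + b - v) = (if v = a then lookup p a * f b else 0)" if "mdvd v (a + b)" for v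
  proof (cases "v = a")
    case False
    have s: "v + (a + b - v) = a + b" using mdvd_diff_add[OF that] by (simp add: add.commute)
    have "v = a" if "lookup p v \<noteq> 0" "f (a + b - v) \<noteq> 0"
      using ord_add_eq(1)[OF p[OF that(1)] f[OF that(2)]] s by simp
    then show ?thesis using False by (metis mult_zero_left mult_zero_right)
  qed simp
  then have "pact p f (a + b) = (\<Sum>v | mdvd v (a + b). if v = a then lookup p a * f b else 0)"
    unfolding pact_def by (intro sum.cong) auto
  then show "pact p f (a + b) = lookup p a * f b" by simp
  assume "pact p f w \<noteq> 0"
  then obtain v where v: "mdvd v w" "lookup p v * f (w - v) \<noteq> 0"
    unfolding pact_def by (auto elim: sum.not_neutral_contains_not_neutral)
  then have "ord (a + b) (v + (w - v))" by (intro ord_add p f) auto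
  then show "ord (a + b) w" using mdvd_diff_add[OF v(1)] by (simp add: add.commute)
qed

lemma ex_lowest:
  assumes "f \<noteq> (\<lambda>_. 0)"
  shows "\<exists>b. f b \<noteq> 0 \<and> (\<forall>v. f v \<noteq> 0 \<longrightarrow> ord b v)"
  using ex_ord_min[of "{v. f v \<noteq> 0}"] assms by (auto simp: fun_eq_iff)

lemma ex_lowest_poly:
  assumes "p \<noteq> 0"
  shows "\<exists>b. lookup p b \<noteq> 0 \<and> (\<forall>v. lookup p v \<noteq> 0 \<longrightarrow> ord b v)"
  using ex_lowest[of "lookup p"] assms by (metis poly_mapping_eqI lookup_zero)

lemma pact_eq_0:
  fixes p :: "('n,'k::field) xpoly"
  assumes "p \<noteq> 0" "pact p f = (\<lambda>_. 0)"
  shows "f = (\<lambda>_. 0)"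
proof (rule ccontr)
  assume "f \<noteq> (\<lambda>_. 0)"
  then obtain b where b: "f b \<noteq> 0" "\<And>v. f v \<noteq> 0 \<Longrightarrow> ord b v" using ex_lowest by blast
  obtain a where a: "lookup p a \<noteq> 0" "\<And>v. lookup p v \<noteq> 0 \<Longrightarrow> ord a v"
    using ex_lowest_poly[OF assms(1)] by blast
  have "pact p f (a + b) \<noteq> 0" using pact_lowest_coeff[of p a f b] a b by simp
  then show False using assms(2) by simp
qed

lemma xpoly_no_zero_divisors:
  fixes p q :: "('n,'k::field) xpoly"
  assumes "p * q = 0"
  shows "p = 0 \<or> q = 0"
proof -
  have "pact p (lookup q) = (\<lambda>_. 0)" using assms lookup_times[of p q] by (auto simp: fun_eq_iff)
  then have "p \<noteq> 0 \<Longrightarrow> lookup q = (\<lambda>_. 0)" by (rule pact_eq_0[rotated])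
  then show ?thesis by (metis poly_mapping_eqI lookup_zero)
qed

end

section \<open>Left ideals of operators\<close>

text \<open>The predicate \<open>I\<close> describes the polynomial elements of a left ideal with rational
  coefficients; saturation reflects that nonzero polynomials are invertible there.\<close>

locale op_ideal = graded_order ord for ord :: "'n::finite mexp \<Rightarrow> 'n mexp \<Rightarrow> bool" +
  fixes I :: "('n,'k::field_char_0) dop \<Rightarrow> bool"
  assumes zero: "I 0"
    and add: "I P \<Longrightarrow> I Q \<Longrightarrow> I (P + Q)"
    and smul: "I P \<Longrightarrow> I (q \<odot> P)"
    and dterm: "I P \<Longrightarrow> I (dmult (dterm u) P)"
    and sat: "q \<noteq> 0 \<Longrightarrow> I (q \<odot> P) \<Longrightarrow> I P"
begin

lemma sum: "(\<And>a. a \<in> A \<Longrightarrow> I (P a)) \<Longrightarrow> I (sum P A)"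
  by (induction A rule: infinite_finite_induct) (auto simp: zero add)

end

lemma dmult_lideal:
  fixes P :: "('n::finite,'k::field_char_0) dop"
  assumes "P \<in> lideal F"
  shows "dmult A P \<in> lideal F"
  using assms
proof induction
  case zero
  then show ?case by (simp add: dmult_zero_right lideal.zero)
next
  case (gen f B)
  then show ?case by (metis dmult_assoc lideal.gen)
next
  case (add P Q)
  then show ?case by (simp add: dmult_add_right lideal.add)
qed

lemma smul_lideal:
  fixes P :: "('n::finite,'k::field_char_0) dop"
  shows "P \<in> lideal F \<Longrightarrow> q \<odot> P \<in> lideal F"
  by (metis dmult_lideal dmult_xop)

lemma in_ratideal_iff:
  fixes P :: "('n::finite,'k::field_char_0) dop"
  shows "in_ratideal F P \<longleftrightarrow> (\<exists>q. q \<noteq> 0 \<and> q \<odot> P \<in> lideal F)"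
  by (simp add: in_ratideal_def dmult_xop)

lemma in_ratideal_lideal:
  fixes P :: "('n::finite,'k::field_char_0) dop"
  shows "P \<in> lideal F \<Longrightarrow> in_ratideal F P"
  unfolding in_ratideal_iff by (rule exI[of _ 1]) simp

lemma smul_smul: "p \<odot> q \<odot> P = (p * q) \<odot> P"
  by (simp add: mult_single mult.assoc[symmetric])

context graded_order
begin

lemma op_ideal_ratideal: "op_ideal ord (in_ratideal (F :: ('n,'k::field_char_0) dop set))"
proof
  show "in_ratideal F 0" by (simp add: in_ratideal_lideal lideal.zero)
next
  fix P Q :: "('n,'k) dop"
  assume "in_ratideal F P" "in_ratideal F Q"
  then obtain p q where pq: "p \<noteq> 0" "q \<noteq> 0" "p \<odot> P \<in> lideal F" "q \<odot> Q \<in> lideal F"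
    by (auto simp: in_ratideal_iff)
  have "(p * q) \<odot> (P + Q) = q \<odot> p \<odot> P + p \<odot> q \<odot> Q"
    by (simp add: smul_smul distrib_left mult.commute[of q p])
  also have "\<dots> \<in> lideal F" using pq by (simp add: lideal.add smul_lideal)
  finally show "in_ratideal F (P + Q)"
    using pq xpoly_no_zero_divisors in_ratideal_iff by blast
next
  fix P :: "('n,'k) dop" and q
  assume "in_ratideal F P"
  then obtain p where p: "p \<noteq> 0" "p \<odot> P \<in> lideal F" by (auto simp: in_ratideal_iff)
  have "p \<odot> q \<odot> P = q \<odot> p \<odot> P" by (simp add: smul_smul mult.commute)
  then show "in_ratideal F (q \<odot> P)" using p smul_lideal in_ratideal_iff by metis
next
  fix P :: "('n,'k) dop" and q
  assume "q \<noteq> 0" "in_ratideal F (q \<odot> P)"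
  then show "in_ratideal F P"
    using xpoly_no_zero_divisors unfolding in_ratideal_iff smul_smul by blast
next
  fix P :: "('n,'k) dop" and u
  assume P: "in_ratideal F P"
  show "in_ratideal F (dmult (dterm u) P)"
  proof (induction u rule: mexp_induct)
    case zero
    show ?case unfolding dmult_dterm_zero by (rule P)
  next
    case (add v i)
    define e where "e = single i (1::nat)"
    let ?Q = "dmult (dterm v) P"
    obtain q where q: "q \<noteq> 0" "q \<odot> ?Q \<in> lideal F" using add by (auto simp: in_ratideal_iff)
    \<comment> \<open>By the product rule, q^2 d_i Q = q d_i (q Q) - (d_i q) q Q. This is the Ore
      condition for one derivation and explains the denominator \<open>q * q\<close>.\<close>
    have "(q * q) \<odot> dmult (dterm e) ?Q = q \<odot> dmult (dterm e) (q \<odot> ?Q) + (- (xderiv e q * q)) \<odot> ?Q"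
      unfolding e_def dmult_unit_smul distrib_left smul_smul mult.commute[of "xderiv _ q" q] mult_minus_left
      by (simp add: single_uminus)
    also have "\<dots> \<in> lideal F"
      using lideal.add[OF smul_lideal[OF dmult_lideal[OF q(2)]] smul_lideal[OF q(2), of "- xderiv e q"]]
      by (simp only: smul_smul mult_minus_left)
    finally have "in_ratideal F (dmult (dterm e) ?Q)"
      using q(1) xpoly_no_zero_divisors in_ratideal_iff by blast
    then show ?case by (simp add: e_def dmult_dterm_add add.commute[of v])
  qed
qed

lemma solution_lideal:
  fixes P :: "('n,'k::field_char_0) dop"
  assumes "is_solution F f" "P \<in> lideal F"
  shows "apply_op P f = (\<lambda>_. 0)"
  using assms(2)
proof induction
  case (gen g A)
  then show ?case using assms(1) by (simp add: apply_op_dmult is_solution_def)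
next
  case (add P Q)
  then show ?case by (simp add: fun_eq_iff apply_op_add)
qed simp

lemma solution_ratideal:
  fixes P :: "('n,'k::field_char_0) dop"
  assumes "is_solution F f" "in_ratideal F P"
  shows "apply_op P f = (\<lambda>_. 0)"
proof -
  obtain q where q: "q \<noteq> 0" "q \<odot> P \<in> lideal F" using assms(2) by (auto simp: in_ratideal_iff)
  then have "pact q (apply_op P f) = (\<lambda>_. 0)"
    using solution_lideal[OF assms(1) q(2)] by (simp add: apply_op_smul)
  then show ?thesis by (rule pact_eq_0[OF q(1)])
qed

end

section \<open>Linear algebra over the coefficient ring\<close>

text \<open>Fraction-free Gaussian elimination, so that the relation has coefficients in the ring
  itself. It serves over the polynomials as well as over the field.\<close>

lemma linear_relation:
  fixes a :: "'x \<Rightarrow> 'j \<Rightarrow> 'a::comm_ring_1"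
  assumes nzd: "\<And>p q :: 'a. p * q = 0 \<Longrightarrow> p = 0 \<or> q = 0"
    and "finite J" "finite X" "card J < card X"
  shows "\<exists>c. (\<exists>x\<in>X. c x \<noteq> 0) \<and> (\<forall>j\<in>J. (\<Sum>x\<in>X. c x * a x j) = 0)"
  using assms(2-4)
proof (induction J arbitrary: X a rule: finite_induct)
  case empty
  then show ?case by (intro exI[of _ "\<lambda>_. 1"]) (auto simp: card_gt_0_iff)
next
  case (insert j J)
  show ?case
  proof (cases "\<forall>x\<in>X. a x j = 0")
    case True
    have "\<exists>c. (\<exists>x\<in>X. c x \<noteq> 0) \<and> (\<forall>j\<in>J. (\<Sum>x\<in>X. c x * a x j) = 0)"
      using insert by (intro insert.IH) auto
    then obtain c where "\<exists>x\<in>X. c x \<noteq> 0" "\<forall>j\<in>J. (\<Sum>x\<in>X. c x * a x j) = 0" by blast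
    then show ?thesis using True by (intro exI[of _ c]) simp
  next
    case False
    then obtain y where y: "y \<in> X" "a y j \<noteq> 0" by blast
    \<comment> \<open>Cross-multiplication with the pivot \<open>y\<close> clears coordinate
      \<open>j\<close> of all other vectors.\<close>
    define a' where "a' x k = a y j * a x k - a x j * a y k" for x k
    have "\<exists>c. (\<exists>x\<in>X - {y}. c x \<noteq> 0) \<and> (\<forall>k\<in>J. (\<Sum>x\<in>X - {y}. c x * a' x k) = 0)"
      using insert y by (intro insert.IH) auto
    then obtain c z where z: "z \<in> X" "z \<noteq> y" "c z \<noteq> 0"
      and c: "\<And>k. k \<in> J \<Longrightarrow> (\<Sum>x\<in>X - {y}. c x * a' x k) = 0" by blast
    \<comment> \<open>The coefficient of \<open>y\<close> collects what the cross-multiplication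
      subtracted, so that a relation for \<open>a'\<close> becomes one for \<open>a\<close>.\<close>
    define c' where "c' x = (if x = y then - (\<Sum>x\<in>X - {y}. c x * a x j) else a y j * c x)" for x
    have eq: "(\<Sum>x\<in>X. c' x * a x k) = (\<Sum>x\<in>X - {y}. c x * a' x k)" for k
    proof -
      have "(\<Sum>x\<in>X. c' x * a x k) = c' y * a y k + (\<Sum>x\<in>X - {y}. c' x * a x k)"
        using y(1) insert.prems(1) by (rule sum.remove[rotated])
      also have "(\<Sum>x\<in>X - {y}. c' x * a x k) = (\<Sum>x\<in>X - {y}. a y j * c x * a x k)"
        by (rule sum.cong) (auto simp: c'_def)
      also have "c' y * a y k + (\<Sum>x\<in>X - {y}. a y j * c x * a x k) = (\<Sum>x\<in>X - {y}. c x * a' x k)"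
        by (simp add: c'_def a'_def sum_distrib_right sum_distrib_left algebra_simps sum_subtractf)
      finally show ?thesis .
    qed
    have "(\<Sum>x\<in>X - {y}. c x * a' x j) = 0"
      by (simp add: a'_def mult.commute)
    moreover have "c' z \<noteq> 0" using z y(2) nzd by (auto simp: c'_def)
    ultimately show ?thesis using c z(1) eq by (intro exI[of _ c']) auto
  qed
qed

section \<open>Spanning modulo the ideal with prescribed denominators\<close>

definition multiplicative :: "'a::comm_monoid_mult set \<Rightarrow> bool" where
  "multiplicative \<Sigma> \<longleftrightarrow> 1 \<in> \<Sigma> \<and> (\<forall>s\<in>\<Sigma>. \<forall>t\<in>\<Sigma>. s * t \<in> \<Sigma>)"

context op_ideal
begin

text \<open>Membership in the span of \<open>J\<close> modulo the ideal after inverting \<Sigma>.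
  With all nonzero polynomials this is linear algebra over K(x); with the polynomials that are
  nonzero at the origin it takes place over the local ring of the origin.\<close>

definition spanned :: "('n,'k) xpoly set \<Rightarrow> ('n,'k) dop set \<Rightarrow> ('n,'k) dop \<Rightarrow> bool" where
  "spanned \<Sigma> J P \<longleftrightarrow> (\<exists>s\<in>\<Sigma>. \<exists>c. I (s \<odot> P - (\<Sum>j\<in>J. c j \<odot> j)))"

lemma spanned_mono: "\<Sigma> \<subseteq> \<Sigma>' \<Longrightarrow> spanned \<Sigma> J P \<Longrightarrow> spanned \<Sigma>' J P"
  unfolding spanned_def by auto

lemma spanned_I:
  assumes "multiplicative \<Sigma>" "I P"
  shows "spanned \<Sigma> J P"
  unfolding spanned_def using assms
  by (intro bexI[of _ 1] exI[of _ "\<lambda>_. 0"]) (auto simp: multiplicative_def)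

lemma spanned_generator:
  assumes "multiplicative \<Sigma>" "finite J" "P \<in> J"
  shows "spanned \<Sigma> J P"
  unfolding spanned_def
proof (intro bexI exI)
  have "(\<Sum>j\<in>J. (if j = P then 1 else 0) \<odot> j) = (\<Sum>j\<in>J. if j = P then j else 0)"
    by (rule sum.cong) auto
  then show "I (1 \<odot> P - (\<Sum>j\<in>J. (if j = P then 1 else 0) \<odot> j))"
    using assms by (simp add: zero)
  show "1 \<in> \<Sigma>" using assms(1) by (simp add: multiplicative_def)
qed

lemma spanned_add:
  assumes "multiplicative \<Sigma>" "spanned \<Sigma> J P" "spanned \<Sigma> J Q"
  shows "spanned \<Sigma> J (P + Q)"
proof -
  obtain s c t d where s: "s \<in> \<Sigma>" "I (s \<odot> P - (\<Sum>j\<in>J. c j \<odot> j))"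
    and t: "t \<in> \<Sigma>" "I (t \<odot> Q - (\<Sum>j\<in>J. d j \<odot> j))"
    using assms(2,3) unfolding spanned_def by blast
  have "(s * t) \<odot> (P + Q) - (\<Sum>j\<in>J. (t * c j + s * d j) \<odot> j) =
      t \<odot> (s \<odot> P - (\<Sum>j\<in>J. c j \<odot> j)) + s \<odot> (t \<odot> Q - (\<Sum>j\<in>J. d j \<odot> j))"
    by (simp only: right_diff_distrib sum_distrib_left smul_smul single_add distrib_left distrib_right
        sum.distrib mult.commute[of t s]) (simp only: diff_conv_add_uminus minus_add_distrib ac_simps)
  moreover have "I \<dots>" by (intro add smul s t)
  ultimately have "I ((s * t) \<odot> (P + Q) - (\<Sum>j\<in>J. (t * c j + s * d j) \<odot> j))" by (rule ssubst)
  moreover have "s * t \<in> \<Sigma>" using assms(1) s t by (simp add: multiplicative_def)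
  ultimately show ?thesis unfolding spanned_def by (intro bexI exI)
qed

lemma spanned_smul:
  assumes "spanned \<Sigma> J P"
  shows "spanned \<Sigma> J (q \<odot> P)"
proof -
  obtain s c where s: "s \<in> \<Sigma>" "I (s \<odot> P - (\<Sum>j\<in>J. c j \<odot> j))"
    using assms unfolding spanned_def by blast
  have "s \<odot> q \<odot> P - (\<Sum>j\<in>J. (q * c j) \<odot> j) = q \<odot> (s \<odot> P - (\<Sum>j\<in>J. c j \<odot> j))"
    by (simp only: right_diff_distrib sum_distrib_left smul_smul mult.commute[of q s])
  moreover have "I \<dots>" by (intro smul s)
  ultimately have "I (s \<odot> q \<odot> P - (\<Sum>j\<in>J. (q * c j) \<odot> j))" by (rule ssubst)
  then show ?thesis unfolding spanned_def using s(1) by (intro bexI exI)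
qed

lemma spanned_sum:
  assumes "multiplicative \<Sigma>" "\<And>a. a \<in> A \<Longrightarrow> spanned \<Sigma> J (P a)"
  shows "spanned \<Sigma> J (sum P A)"
  using assms(2)
  by (induction A rule: infinite_finite_induct)
    (auto intro: spanned_add[OF assms(1)] spanned_I[OF assms(1) zero])

lemma spanned_divide:
  assumes "multiplicative \<Sigma>" "s \<in> \<Sigma>" "spanned \<Sigma> J (s \<odot> P)"
  shows "spanned \<Sigma> J P"
  using assms unfolding spanned_def smul_smul multiplicative_def by blast

lemma spanned_trans:
  assumes "multiplicative \<Sigma>" "spanned \<Sigma> J P" "\<And>j. j \<in> J \<Longrightarrow> spanned \<Sigma> J' j"
  shows "spanned \<Sigma> J' P"
proof -
  obtain s c where s: "s \<in> \<Sigma>" "I (s \<odot> P - (\<Sum>j\<in>J. c j \<odot> j))"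
    using assms(2) unfolding spanned_def by blast
  have "spanned \<Sigma> J' (\<Sum>j\<in>J. c j \<odot> j)"
    by (intro spanned_sum spanned_smul assms)
  from spanned_add[OF assms(1) spanned_I[OF assms(1) s(2)] this]
  have "spanned \<Sigma> J' (s \<odot> P)" by simp
  then show ?thesis by (rule spanned_divide[OF assms(1) s(1)])
qed

lemma spanned_if_dterms:
  assumes "multiplicative \<Sigma>" "\<And>u. u \<in> keys P \<Longrightarrow> spanned \<Sigma> J (dterm u)"
  shows "spanned \<Sigma> J P"
  by (subst dop_expand) (intro spanned_sum spanned_smul assms)

lemma multiplicative_nonzero: "multiplicative {q :: ('n,'k) xpoly. q \<noteq> 0}"
  using xpoly_no_zero_divisors by (auto simp: multiplicative_def)

lemma multiplicative_local: "multiplicative {q :: ('n,'k) xpoly. lookup q 0 \<noteq> 0}"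
  by (auto simp: multiplicative_def lookup_times_0)

end

lemma xderiv_single: "xderiv k (single a (1::'k::comm_ring_1)) = single (a - k) (of_nat (ffallm a k))"
  by (simp add: xderiv_def)

lemma dact_mono_series_eq_lookup: "dact x (mono_series u) = lookup (xderiv x (single u (1::'k::comm_ring_1)))"
  by (rule ext) (auto simp: dact_mono_series xderiv_single lookup_single when_def ffallm_eq_0)

text \<open>Each coordinate in \<open>J\<close> imposes one linear equation over K[x], and so does
  each \<open>u\<close> in \<open>V\<close>, since every d^x x^u is a polynomial. There are fewer
  equations than unknowns.\<close>

lemma (in op_ideal) relation_of_dterms:
  assumes J: "finite J" and X: "finite X" and V: "finite V" and card: "card J + card V < card X"
    and span: "\<And>x. x \<in> X \<Longrightarrow> spanned {q. q \<noteq> 0} J (dterm x)"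
  shows "\<exists>P. P \<noteq> 0 \<and> keys P \<subseteq> X \<and> I P \<and> (\<forall>u\<in>V. apply_op P (mono_series u) = (\<lambda>_. 0))"
proof -
  have "\<forall>x\<in>X. \<exists>sc. fst sc \<noteq> 0 \<and> I (fst sc \<odot> dterm x - (\<Sum>j\<in>J. snd sc j \<odot> j))"
    using span unfolding spanned_def by auto
  then obtain sc where sc: "\<forall>x\<in>X. fst (sc x) \<noteq> 0 \<and>
      I (fst (sc x) \<odot> dterm x - (\<Sum>j\<in>J. snd (sc x) j \<odot> j))"
    by (rule bchoice[THEN exE])
  define s where "s x = fst (sc x)" for x
  define c where "c x = snd (sc x)" for x
  have s: "\<And>x. x \<in> X \<Longrightarrow> s x \<noteq> 0"
    and c: "\<And>x. x \<in> X \<Longrightarrow> I (s x \<odot> dterm x - (\<Sum>j\<in>J. c x j \<odot> j))"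
    using sc unfolding s_def c_def by auto
  \<comment> \<open>The coefficients of the operator will be \<open>d x * s x\<close>, hence the
    factor \<open>s x\<close> in the second block of equations.\<close>
  define a where "a x k = (case k of Inl j \<Rightarrow> c x j | Inr u \<Rightarrow> s x * xderiv x (single u 1))" for x k
  have "\<exists>d. (\<exists>x\<in>X. d x \<noteq> 0) \<and> (\<forall>k\<in>J <+> V. (\<Sum>x\<in>X. d x * a x k) = 0)"
    by (rule linear_relation[OF xpoly_no_zero_divisors]) (use assms in \<open>auto simp: card_Plus\<close>)
  then obtain d z where z: "z \<in> X" "d z \<noteq> 0" and d: "\<And>k. k \<in> J <+> V \<Longrightarrow> (\<Sum>x\<in>X. d x * a x k) = 0"
    by blast
  define P where "P = (\<Sum>x\<in>X. (d x * s x) \<odot> dterm x)"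
  have lookup_P: "lookup P x = (if x \<in> X then d x * s x else 0)" for x
    using X by (simp add: P_def smul_dterm lookup_sum lookup_single when_def sum.delta)
  have "lookup P z \<noteq> 0" using z s xpoly_no_zero_divisors by (auto simp: lookup_P)
  then have "P \<noteq> 0" by auto
  moreover have keys: "keys P \<subseteq> X" by (auto simp: in_keys_iff lookup_P split: if_splits)
  moreover have "I P"
  proof -
    have "(\<Sum>x\<in>X. d x \<odot> (\<Sum>j\<in>J. c x j \<odot> j)) = (\<Sum>x\<in>X. \<Sum>j\<in>J. (d x * c x j) \<odot> j)"
      by (simp only: sum_distrib_left smul_smul)
    also have "\<dots> = (\<Sum>j\<in>J. \<Sum>x\<in>X. (d x * c x j) \<odot> j)" by (rule sum.swap)
    also have "\<dots> = (\<Sum>j\<in>J. single 0 (\<Sum>x\<in>X. d x * c x j) * j)"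
    proof (rule sum.cong[OF refl])
      fix j
      have "(\<Sum>x\<in>X. single 0 (d x * c x j)) = (single 0 (\<Sum>x\<in>X. d x * c x j) :: ('n,'k) dop)"
        using X by (induction X rule: finite_induct) (simp_all add: single_add)
      then show "(\<Sum>x\<in>X. (d x * c x j) \<odot> j) = single 0 (\<Sum>x\<in>X. d x * c x j) * j"
        by (simp only: sum_distrib_right[symmetric])
    qed
    also have "\<dots> = 0" using d[OF InlI] by (simp add: a_def)
    finally have "P = (\<Sum>x\<in>X. d x \<odot> (s x \<odot> dterm x - (\<Sum>j\<in>J. c x j \<odot> j)))"
      by (simp only: P_def right_diff_distrib sum_subtractf smul_smul diff_zero)
    then show ?thesis using sum[OF smul[OF c]] by simp
  qed
  moreover have "apply_op P (mono_series u) = (\<lambda>_. 0)" if "u \<in> V" for u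
  proof
    fix w
    have "apply_op P (mono_series u) w = (\<Sum>x\<in>X. lookup (d x * s x * xderiv x (single u 1)) w)"
      unfolding apply_op_eq[OF X keys]
      by (rule sum.cong) (simp_all add: lookup_P dact_mono_series_eq_lookup lookup_times)
    also have "\<dots> = lookup (\<Sum>x\<in>X. d x * a x (Inr u)) w"
      by (simp add: lookup_sum a_def mult.assoc)
    also have "\<dots> = 0" using d[OF InrI[OF that]] by simp
    finally show "apply_op P (mono_series u) w = 0" .
  qed
  ultimately show ?thesis by blast
qed

section \<open>Euler operators\<close>

lemma apply_op_theta: "apply_op (single v (single v 1)) f w = of_nat (ffallm w v) * f w"
  by (auto simp: apply_op_single pact_single dact_def mdvd_diff_add ffallm_eq_0)

lemma ffallm_unit: "ffallm w (single i 1) = lookup w i"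
proof -
  have "ffallm w (single i 1) = (\<Prod>j\<in>UNIV. if j = i then lookup w j else 1)"
    unfolding ffallm_def by (rule prod.cong) (auto simp: lookup_single when_def ffall_def)
  then show ?thesis by simp
qed

lemma of_nat_ffallm_add_unit:
  "of_nat (ffallm w (v + single i 1)) = (of_nat (ffallm w v) * (of_nat (lookup w i) - of_nat (lookup v i)) :: 'k::comm_ring_1)"
proof (cases "mdvd v w")
  case True
  then have "lookup v i \<le> lookup w i" by (simp add: mdvd_def)
  then show ?thesis unfolding ffallm_add ffallm_unit by (simp add: lookup_minus of_nat_diff)
next
  case False
  then show ?thesis unfolding ffallm_add by (simp add: ffallm_eq_0)
qed

definition euler_op :: "'n mexp \<Rightarrow> 'n \<Rightarrow> ('n,'k::comm_ring_1) dop" where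
  "euler_op u i = single (single i 1) (single (single i 1) 1) - single 0 (single 0 (of_nat (lookup u i)))"

lemma euler_ops_eq: "euler_ops u = range (euler_op u)"
  by (auto simp: euler_ops_def euler_op_def)

lemma pact_const: "pact (single 0 c) f w = c * f w"
  by (simp add: pact_single)

lemma apply_op_const: "apply_op (single 0 (single 0 c)) f w = c * f w"
  by (simp add: apply_op_single pact_single)

lemma apply_euler_op: "apply_op (euler_op u i) f w = (of_nat (lookup w i) - of_nat (lookup u i)) * f w"
  unfolding euler_op_def apply_op_diff apply_op_theta ffallm_unit
  by (simp add: apply_op_single pact_single algebra_simps del: single_of_nat)

lemma mono_series_solution: "is_solution (euler_ops u) (mono_series u)"
  unfolding is_solution_def euler_ops_eq
  by (auto simp: fun_eq_iff apply_euler_op mono_series_def)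

text \<open>x^v d^v is a product of factors x_i d_i - j, and modulo the Euler operators each x_i d_i
  may be replaced by u_i.\<close>

lemma theta_mod_euler:
  fixes u v :: "'n::finite mexp"
  shows "single v (single v 1) - single 0 (single 0 (of_nat (ffallm u v)))
    \<in> lideal (euler_ops u :: ('n,'k::field_char_0) dop set)"
proof (induction v rule: mexp_induct)
  case zero
  then show ?case by (simp add: lideal.zero)
next
  case (add v i)
  let ?E = "euler_op u i :: ('n,'k) dop"
  let ?T = "single v (single v 1) :: ('n,'k) dop"
  \<comment> \<open>Write x_i d_i - v_i as the Euler operator plus u_i - v_i. Both sides act
    diagonally on monomials, so only scalars have to be compared.\<close>
  have "single (v + single i 1) (single (v + single i 1) 1) - single 0 (single 0 (of_nat (ffallm u (v + single i 1))))
    = dmult ?T ?E + single 0 (of_nat (lookup u i) - of_nat (lookup v i)) \<odot>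
        (?T - single 0 (single 0 (of_nat (ffallm u v))))"
    by (rule apply_op_faithful)
      (simp only: apply_op_add apply_op_diff apply_op_theta apply_op_dmult apply_euler_op apply_op_smul
        apply_op_const pact_const of_nat_ffallm_add_unit, simp add: algebra_simps)
  also have "\<dots> \<in> lideal (euler_ops u)"
    by (intro lideal.add smul_lideal add lideal.gen) (simp add: euler_ops_eq)
  finally show ?case .
qed

text \<open>Modulo the Euler operators every operator is a rational multiple of 1, so one that
  annihilates x^u reduces to a rational function annihilating x^u, which is zero.\<close>

lemma (in graded_order) in_ratideal_euler_iff:
  fixes P :: "('n,'k::field_char_0) dop"
  shows "in_ratideal (euler_ops u) P \<longleftrightarrow> apply_op P (mono_series u) = (\<lambda>_. 0)"
proof
  assume "in_ratideal (euler_ops u) P"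
  then show "apply_op P (mono_series u) = (\<lambda>_. 0)"
    using solution_ratideal mono_series_solution by blast
next
  assume P: "apply_op P (mono_series u) = (\<lambda>_. 0)"
  interpret E: op_ideal ord "in_ratideal (euler_ops u :: ('n,'k) dop set)"
    by (rule op_ideal_ratideal)
  have "E.spanned {q. q \<noteq> 0} {dterm 0} (dterm v)" for v
    unfolding E.spanned_def
  proof (intro bexI exI)
    \<comment> \<open>The denominator is x^v, because x^v d^v is congruent to the constant
      \<open>ffallm u v\<close>.\<close>
    show "single v 1 \<in> {q :: ('n,'k) xpoly. q \<noteq> 0}"
      by (simp, metis lookup_single_eq lookup_zero zero_neq_one)
    show "in_ratideal (euler_ops u) (single v 1 \<odot> dterm v -
        (\<Sum>j\<in>{dterm 0 :: ('n,'k) dop}. (single 0 (of_nat (ffallm u v))) \<odot> j))"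
      using in_ratideal_lideal[OF theta_mod_euler] by (simp add: smul_dterm mult_single)
  qed
  then have "E.spanned {q. q \<noteq> 0} {dterm 0} P"
    by (rule E.spanned_if_dterms[OF E.multiplicative_nonzero])
  then obtain s c where s: "s \<noteq> 0" "in_ratideal (euler_ops u) (s \<odot> P - c (dterm 0) \<odot> dterm 0)"
    unfolding E.spanned_def by auto
  define p where "p = c (dterm 0)"
  have "apply_op (s \<odot> P - p \<odot> dterm 0) (mono_series u) = (\<lambda>_. 0)"
    using s(2) solution_ratideal mono_series_solution unfolding p_def by blast
  then have "pact p (mono_series u) = (\<lambda>_. 0)"
    unfolding fun_eq_iff apply_op_diff apply_op_smul P apply_op_dterm dact_zero by simp
  moreover have "mono_series u \<noteq> (\<lambda>_. 0 :: 'k)"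
    unfolding fun_eq_iff mono_series_def by auto
  ultimately have "p = 0" using pact_eq_0 by blast
  then show "in_ratideal (euler_ops u) P" using s E.sat unfolding p_def by auto
qed

section \<open>Reduction modulo a Groebner basis\<close>

definition par_terms :: "('n mexp \<Rightarrow> 'n mexp \<Rightarrow> bool) \<Rightarrow> ('n,'k::zero) dop set \<Rightarrow> 'n mexp set" where
  "par_terms ord G = {u. \<forall>g\<in>G. \<not> mdvd (HT ord g) u}"

context graded_order
begin

text \<open>Every correction term of the Leibniz rule has a smaller derivative exponent, so the head
  coefficient is unchanged by derivations.\<close>

lemma dmult_dterm_head:
  fixes g :: "('n,'k::field_char_0) dop"
  assumes "g \<noteq> 0"
  shows "lookup (dmult (dterm w) g) (w + HT ord g) = HC ord g"
    and "v \<in> keys (dmult (dterm w) g) \<Longrightarrow> ord v (w + HT ord g)"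
proof -
  let ?h = "HT ord g"
  have Q: "lookup (dmult (dterm w) g) v = (\<Sum>d\<in>keys g. \<Sum>k | mdvd k w.
      (of_nat (binomm w k) * xderiv k (lookup g d)) when w - k + d = v)" for v
    by (simp add: dmult_def lookup_sum lookup_single)
  have le: "ord (w - k) w" if "mdvd k w" for k
    using that by (metis mdvd_add(1) mdvd_diff_add ord_mdvd)
  have "((of_nat (binomm w k) * xderiv k (lookup g d)) when w - k + d = w + ?h) =
     (if d = ?h then if k = 0 then HC ord g else 0 else 0)" if dk: "d \<in> keys g" "mdvd k w" for d k
  proof -
    have "w - k + d = w + ?h \<longleftrightarrow> d = ?h \<and> k = 0"
    proof
      assume eq: "w - k + d = w + ?h"
      have d: "d = ?h" and "w - k = w"
        using ord_add_eq[OF le[OF dk(2)] HT_max[OF assms dk(1)] eq] by auto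
      then have "w + k = w + 0" using mdvd_diff_add[OF dk(2)] by simp
      then show "d = ?h \<and> k = 0" using d by (simp only: add_left_cancel)
    qed auto
    then show ?thesis by (auto simp: HC_def)
  qed
  then have "lookup (dmult (dterm w) g) (w + ?h) =
      (\<Sum>d\<in>keys g. \<Sum>k | mdvd k w. if d = ?h then if k = 0 then HC ord g else 0 else 0)"
    unfolding Q by (intro sum.cong refl) auto
  also have "\<dots> = (\<Sum>d\<in>keys g. if d = ?h then HC ord g else 0)"
    by (rule sum.cong) auto
  also have "\<dots> = HC ord g" using HT_in_keys[OF assms] by simp
  finally show "lookup (dmult (dterm w) g) (w + ?h) = HC ord g" .
  assume "v \<in> keys (dmult (dterm w) g)"
  then have "lookup (dmult (dterm w) g) v \<noteq> 0" by (simp add: in_keys_iff)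
  then obtain d k where dk: "d \<in> keys g" "mdvd k w" "w - k + d = v"
    unfolding Q by (auto elim!: sum.not_neutral_contains_not_neutral simp: when_def split: if_splits)
  then show "ord v (w + ?h)" using ord_add[OF le[OF dk(2)] HT_max[OF assms dk(1)]] by simp
qed

end

context op_ideal
begin

lemma parametric_independent:
  assumes "is_GB ord M I" "I P" "keys P \<subseteq> par_terms ord M"
  shows "P = 0"
proof (rule ccontr)
  assume "P \<noteq> 0"
  then obtain g where "g \<in> M" "mdvd (HT ord g) (HT ord P)" using assms by (auto simp: is_GB_def)
  moreover have "HT ord P \<in> par_terms ord M" using HT_in_keys[OF \<open>P \<noteq> 0\<close>] assms(3) by blast
  ultimately show False by (auto simp: par_terms_def)
qed

text \<open>Reduction divides by head coefficients only. At an ordinary origin these are units of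
  the local ring, and the normal forms are regular there.\<close>

lemma spanned_parametric:
  assumes gb: "is_GB ord M I" and mult: "multiplicative \<Sigma>" and HC: "\<And>g. g \<in> M \<Longrightarrow> HC ord g \<in> \<Sigma>"
    and fin: "finite (par_terms ord M)"
  shows "spanned \<Sigma> (dterm ` par_terms ord M) P"
proof (rule spanned_if_dterms[OF mult])
  fix u
  show "spanned \<Sigma> (dterm ` par_terms ord M) (dterm u)"
  proof (induction u rule: ord_induct)
    case (less u)
    show ?case
    proof (cases "u \<in> par_terms ord M")
      case True
      then show ?thesis using fin by (intro spanned_generator mult) auto
    next
      case False
      then obtain g where g: "g \<in> M" "mdvd (HT ord g) u" by (auto simp: par_terms_def)
      then have g0: "g \<noteq> 0" and Ig: "I g" using gb by (auto simp: is_GB_def)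
      define Q where "Q = dmult (dterm (u - HT ord g)) g"
      have "I Q" unfolding Q_def using Ig by (rule dterm)
      have u: "u - HT ord g + HT ord g = u" using g(2) by (rule mdvd_diff_add)
      have Qu: "lookup Q u = HC ord g" and le: "\<And>v. v \<in> keys Q \<Longrightarrow> ord v u"
        using dmult_dterm_head(1)[OF g0, of "u - HT ord g"]
          dmult_dterm_head(2)[OF g0, of _ "u - HT ord g"] unfolding u Q_def by auto
      have "HC ord g \<noteq> 0" using HT_in_keys[OF g0] by (simp add: HC_def in_keys_iff)
      then have "u \<in> keys Q" by (simp add: in_keys_iff Qu)
      have "Q = HC ord g \<odot> dterm u + (\<Sum>v\<in>keys Q - {u}. lookup Q v \<odot> dterm v)"
        by (subst dop_expand, subst sum.remove[OF _ \<open>u \<in> keys Q\<close>]) (simp_all add: Qu)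
      then have eq: "HC ord g \<odot> dterm u = Q + (- 1) \<odot> (\<Sum>v\<in>keys Q - {u}. lookup Q v \<odot> dterm v)"
        by (simp add: single_uminus eq_diff_eq)
      have "spanned \<Sigma> (dterm ` par_terms ord M) (HC ord g \<odot> dterm u)"
        unfolding eq
        by (intro spanned_add spanned_I mult \<open>I Q\<close> spanned_smul spanned_sum less) (auto simp: le)
      then show ?thesis using spanned_divide[OF mult] HC g(1) by blast
    qed
  qed
qed

end

section \<open>Finiteness of the parametric terms\<close>

context op_ideal
begin

text \<open>Parametric terms are independent modulo the ideal, so \<open>N\<close> of them would
  contradict \<open>rel\<close>.\<close>

lemma finite_par_terms:
  assumes gb: "is_GB ord M I"
    and rel: "\<And>X. finite X \<Longrightarrow> card X = N \<Longrightarrow> \<exists>P. P \<noteq> 0 \<and> keys P \<subseteq> X \<and> I P"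
  shows "finite (par_terms ord M)"
proof (rule ccontr)
  assume "infinite (par_terms ord M)"
  then obtain X where X: "finite X" "card X = N" "X \<subseteq> par_terms ord M"
    using infinite_arbitrarily_large by blast
  then obtain P where "P \<noteq> 0" "keys P \<subseteq> X" "I P" using rel by blast
  then show False using parametric_independent[OF gb, of P] X(3) by blast
qed

lemma op_ideal_Int:
  assumes "\<And>u. u \<in> V \<Longrightarrow> op_ideal ord (L u)"
  shows "op_ideal ord (\<lambda>P. I P \<and> (\<forall>u\<in>V. L u P))"
proof
  show "I 0 \<and> (\<forall>u\<in>V. L u 0)" using zero op_ideal.zero[OF assms] by blast
  show "I (P + Q) \<and> (\<forall>u\<in>V. L u (P + Q))"
    if "I P \<and> (\<forall>u\<in>V. L u P)" "I Q \<and> (\<forall>u\<in>V. L u Q)" for P Q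
    using that add op_ideal.add[OF assms] by blast
  show "I (q \<odot> P) \<and> (\<forall>u\<in>V. L u (q \<odot> P))" if "I P \<and> (\<forall>u\<in>V. L u P)" for P q
    using that smul op_ideal.smul[OF assms] by blast
  show "I (dmult (dterm u) P) \<and> (\<forall>v\<in>V. L v (dmult (dterm u) P))" if "I P \<and> (\<forall>u\<in>V. L u P)" for P u
    using that dterm op_ideal.dterm[OF assms] by blast
  show "I P \<and> (\<forall>u\<in>V. L u P)" if "q \<noteq> 0" "I (q \<odot> P) \<and> (\<forall>u\<in>V. L u (q \<odot> P))" for P q
    using that sat op_ideal.sat[OF assms] by blast
qed

end

lemma inj_dterm: "inj (dterm :: 'n mexp \<Rightarrow> ('n,'k::comm_ring_1) dop)"
  by (rule injI) (metis keys_single one_neq_zero singleton_inject)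

lemma (in graded_order) finite_par_terms_dfinite:
  fixes G :: "('n,'k::field_char_0) dop set"
  assumes gb: "is_GB ord G (in_ratideal G)" and dfin: "dfinite G"
  shows "finite (par_terms ord G)"
proof -
  interpret L: op_ideal ord "in_ratideal G" by (rule op_ideal_ratideal)
  obtain T where T: "finite T" and red: "\<And>P. \<exists>q c. q \<noteq> 0 \<and>
      in_ratideal G (q \<odot> P - (\<Sum>t\<in>T. single t (c t)))"
    using dfin unfolding dfinite_def dmult_xop by blast
  have span: "L.spanned {q. q \<noteq> 0} (dterm ` T) P" for P
  proof -
    obtain q c where q: "q \<noteq> 0" "in_ratideal G (q \<odot> P - (\<Sum>t\<in>T. single t (c t)))"
      using red by blast
    have "(\<Sum>j\<in>dterm ` T. c (inv dterm j) \<odot> j) = (\<Sum>t\<in>T. single t (c t))"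
      by (subst sum.reindex[OF inj_on_subset[OF inj_dterm]]) (simp_all add: smul_dterm inv_f_f[OF inj_dterm])
    then have "in_ratideal G (q \<odot> P - (\<Sum>j\<in>dterm ` T. c (inv dterm j) \<odot> j))"
      using q(2) by simp
    then show ?thesis unfolding L.spanned_def using q(1) by (intro bexI exI) auto
  qed
  show ?thesis
  proof (rule L.finite_par_terms[OF gb, of "Suc (card (dterm ` T :: ('n,'k) dop set))"])
    fix X :: "'n mexp set"
    assume "finite X" "card X = Suc (card (dterm ` T :: ('n,'k) dop set))"
    then show "\<exists>P. P \<noteq> 0 \<and> keys P \<subseteq> X \<and> in_ratideal G P"
      using L.relation_of_dterms[of "dterm ` T" X "{}"] T span by auto
  qed
qed

section \<open>Ordinary points have many solutions\<close>

definition vanishing0 :: "('n,'k::zero) dop \<Rightarrow> bool" where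
  "vanishing0 P \<longleftrightarrow> (\<forall>v. lookup (lookup P v) 0 = 0)"

context op_ideal
begin

text \<open>Membership, over the local ring, in the maximal ideal of the origin times the span of
  \<open>J\<close>, modulo the ideal.\<close>

definition spanned0 :: "('n,'k) dop set \<Rightarrow> ('n,'k) dop \<Rightarrow> bool" where
  "spanned0 J P \<longleftrightarrow> (\<exists>s c. lookup s 0 \<noteq> 0 \<and> (\<forall>j. lookup (c j) 0 = 0) \<and> I (s \<odot> P - (\<Sum>j\<in>J. c j \<odot> j)))"

lemma spanned0_zero: "spanned0 J 0"
  unfolding spanned0_def by (intro exI[of _ 1] exI[of _ "\<lambda>_. 0"]) (simp add: zero)

lemma spanned0_add:
  assumes "spanned0 J P" "spanned0 J Q"
  shows "spanned0 J (P + Q)"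
proof -
  obtain s c t d where s: "lookup s 0 \<noteq> 0" "\<And>j. lookup (c j) 0 = 0" "I (s \<odot> P - (\<Sum>j\<in>J. c j \<odot> j))"
    and t: "lookup t 0 \<noteq> 0" "\<And>j. lookup (d j) 0 = 0" "I (t \<odot> Q - (\<Sum>j\<in>J. d j \<odot> j))"
    using assms unfolding spanned0_def by blast
  have "(s * t) \<odot> (P + Q) - (\<Sum>j\<in>J. (t * c j + s * d j) \<odot> j) =
      t \<odot> (s \<odot> P - (\<Sum>j\<in>J. c j \<odot> j)) + s \<odot> (t \<odot> Q - (\<Sum>j\<in>J. d j \<odot> j))"
    by (simp only: right_diff_distrib sum_distrib_left smul_smul single_add distrib_left distrib_right
        sum.distrib mult.commute[of t s]) (simp only: diff_conv_add_uminus minus_add_distrib ac_simps)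
  moreover have "I \<dots>" by (intro add smul s t)
  ultimately have "I ((s * t) \<odot> (P + Q) - (\<Sum>j\<in>J. (t * c j + s * d j) \<odot> j))" by (rule ssubst)
  then show ?thesis unfolding spanned0_def using s t
    by (intro exI[of _ "s * t"] exI[of _ "\<lambda>j. t * c j + s * d j"])
      (simp add: lookup_times_0 lookup_add)
qed

lemma spanned0_smul:
  assumes "spanned {q. lookup q 0 \<noteq> 0} J P" "lookup q 0 = 0"
  shows "spanned0 J (q \<odot> P)"
proof -
  obtain s c where s: "lookup s 0 \<noteq> 0" "I (s \<odot> P - (\<Sum>j\<in>J. c j \<odot> j))"
    using assms(1) unfolding spanned_def by blast
  have "s \<odot> q \<odot> P - (\<Sum>j\<in>J. (q * c j) \<odot> j) = q \<odot> (s \<odot> P - (\<Sum>j\<in>J. c j \<odot> j))"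
    by (simp only: right_diff_distrib sum_distrib_left smul_smul mult.commute[of q s])
  moreover have "I \<dots>" by (intro smul s)
  ultimately have "I (s \<odot> q \<odot> P - (\<Sum>j\<in>J. (q * c j) \<odot> j))" by (rule ssubst)
  then show ?thesis unfolding spanned0_def using s(1) assms(2)
    by (intro exI[of _ s] exI[of _ "\<lambda>j. q * c j"]) (simp add: lookup_times_0)
qed

lemma spanned0_vanishing0:
  assumes "\<And>P. spanned {q. lookup q 0 \<noteq> 0} J P" "vanishing0 P"
  shows "spanned0 J P"
proof -
  have "spanned0 J (\<Sum>u\<in>A. lookup P u \<odot> dterm u)" for A
    using assms(2)
    by (induction A rule: infinite_finite_induct)
      (auto simp: vanishing0_def intro: spanned0_zero spanned0_add spanned0_smul assms(1))
  then show ?thesis by (subst dop_expand)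
qed

text \<open>The extra generators are removed one at a time. Modulo \<open>F\<close>, such a
  generator is an operator vanishing at the origin, hence a combination of all generators, itself
  included, with coefficients vanishing there.\<close>

lemma nakayama:
  assumes "finite E" "\<And>P. spanned {q. lookup q 0 \<noteq> 0} (F \<union> E) P" "finite F"
    and gen: "\<And>P. \<exists>a Z. vanishing0 Z \<and> I (P - (\<Sum>f\<in>F. a f \<odot> f) - Z)"
  shows "spanned {q. lookup q 0 \<noteq> 0} F P"
  using assms(1,2)
proof (induction E arbitrary: P rule: finite_induct)
  case empty
  then show ?case by simp
next
  case (insert e E)
  let ?\<Sigma> = "{q :: ('n,'k) xpoly. lookup q 0 \<noteq> 0}"
  let ?J = "F \<union> E"
  note mult = multiplicative_local
  show ?case
  proof (cases "e \<in> F")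
    case True
    then have "F \<union> insert e E = F \<union> E" by blast
    then show ?thesis using insert by simp
  next
    case False
    then have e: "e \<notin> ?J" and fin: "finite ?J" using insert.hyps assms(3) by auto
    obtain a Z where Z: "vanishing0 Z" "I (e - (\<Sum>f\<in>F. a f \<odot> f) - Z)" using gen by blast
    obtain s c where s: "lookup s 0 \<noteq> 0" "\<And>j. lookup (c j) 0 = 0"
      and sZ: "I (s \<odot> Z - (\<Sum>j\<in>insert e ?J. c j \<odot> j))"
      using spanned0_vanishing0[OF insert.prems Z(1)] unfolding spanned0_def by auto
    \<comment> \<open>Moving the multiple of \<open>e\<close> to the left leaves the factor
      \<open>s - c e\<close>, which has the same value at the origin as \<open>s\<close> and can be
      inverted.\<close>
    have "(s - c e) \<odot> e = s \<odot> (e - (\<Sum>f\<in>F. a f \<odot> f) - Z) + (s \<odot> Z - (\<Sum>j\<in>insert e ?J. c j \<odot> j))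
        + (s \<odot> (\<Sum>f\<in>F. a f \<odot> f) + (\<Sum>j\<in>?J. c j \<odot> j))"
      unfolding sum.insert[OF fin e] right_diff_distrib single_diff left_diff_distrib by simp
    moreover have "spanned ?\<Sigma> ?J \<dots>"
      using fin by (intro spanned_add spanned_smul spanned_sum mult)
        (auto intro: spanned_I[OF mult] smul Z(2) sZ spanned_generator[OF mult])
    ultimately have "spanned ?\<Sigma> ?J ((s - c e) \<odot> e)" by simp
    moreover have "s - c e \<in> ?\<Sigma>" using s by (simp add: lookup_minus)
    ultimately have e_span: "spanned ?\<Sigma> ?J e" using spanned_divide[OF mult] by blast
    show ?thesis
    proof (rule insert.IH)
      fix Q
      show "spanned ?\<Sigma> ?J Q"
      proof (rule spanned_trans[OF mult insert.prems])
        fix j assume "j \<in> F \<union> insert e E"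
        then show "spanned ?\<Sigma> ?J j" using e_span fin by (auto intro: spanned_generator[OF mult])
      qed
    qed
  qed
qed

end

section \<open>Functionals on the fibre at the origin as power series\<close>

abbreviation cscale :: "'k::comm_ring_1 \<Rightarrow> ('n,'k) dop \<Rightarrow> ('n,'k) dop" where
  "cscale c P \<equiv> single 0 (single 0 c) * P"

interpretation dop_vs: vector_space "cscale :: 'k::field \<Rightarrow> ('n,'k) dop \<Rightarrow> _"
  by unfold_locales (simp_all add: single_add distrib_left distrib_right smul_smul mult_single)

definition series_of :: "(('n::finite,'k::field) dop \<Rightarrow> 'k) \<Rightarrow> 'n mexp \<Rightarrow> 'k" where
  "series_of \<phi> v = \<phi> (dterm v) / of_nat (ffallm v v)"

text \<open>A linear functional that factors through the fibre at the origin is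
  \<open>P \<mapsto> (P f)(0)\<close> for the series \<open>f\<close> of its values on derivative terms.\<close>

lemma apply_series_of:
  fixes \<phi> :: "('n::finite,'k::field_char_0) dop \<Rightarrow> 'k"
  assumes add: "\<And>P Q. \<phi> (P + Q) = \<phi> P + \<phi> Q" and scale: "\<And>c P. \<phi> (cscale c P) = c * \<phi> P"
    and van: "\<And>P. vanishing0 P \<Longrightarrow> \<phi> P = 0"
  shows "apply_op P (series_of \<phi>) 0 = \<phi> P"
proof -
  \<comment> \<open>\<open>Q\<close> has the coefficients of \<open>P\<close> evaluated at the
    origin; the functional does not see the difference.\<close>
  define Q where "Q = (\<Sum>v\<in>keys P. cscale (lookup (lookup P v) 0) (dterm v))"
  have zero: "\<phi> 0 = 0" using scale[of 0 0] by simp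
  have lookup_Q: "lookup Q v = single 0 (lookup (lookup P v) 0)" for v
    by (auto simp: Q_def lookup_sum smul_dterm lookup_single when_def sum.delta in_keys_iff)
  have "vanishing0 (P - Q)" by (simp add: vanishing0_def lookup_minus lookup_Q)
  then have "\<phi> P = \<phi> Q" using add[of "P - Q" Q] van by simp
  also have "\<dots> = (\<Sum>v\<in>keys P. lookup (lookup P v) 0 * \<phi> (dterm v))"
  proof -
    have "\<phi> (sum X A) = (\<Sum>v\<in>A. \<phi> (X v))" for X :: "'n mexp \<Rightarrow> ('n,'k) dop" and A
      by (induction A rule: infinite_finite_induct) (simp_all add: zero add)
    then show ?thesis by (simp add: Q_def scale)
  qed
  also have "\<dots> = apply_op P (series_of \<phi>) 0"
    unfolding apply_op_expand by (rule sum.cong) (simp_all add: pact_def dact_def series_of_def)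
  finally show ?thesis by simp
qed

lemma (in graded_order) has_indep_solutions_if_spanned:
  fixes G :: "('n,'k::field_char_0) dop set" and E :: "('n,'k) dop set"
  assumes gb: "is_GB ord G (in_ratideal G)" and finG: "finite (par_terms ord G)" and finE: "finite E"
    and span: "\<And>P. op_ideal.spanned (in_ratideal G) {q. lookup q 0 \<noteq> 0} E P"
  shows "has_indep_solutions G (card (par_terms ord G))"
proof -
  interpret L: op_ideal ord "in_ratideal G" by (rule op_ideal_ratideal)
  let ?d = "card (par_terms ord G)"
  let ?\<Sigma> = "{q :: ('n,'k) xpoly. lookup q 0 \<noteq> 0}"
  \<comment> \<open>The kernel of the passage to the fibre at the origin.\<close>
  define Z where "Z = {P. \<exists>Q. vanishing0 Q \<and> in_ratideal G (P - Q)}"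
  have ZI: "P \<in> Z" if "in_ratideal G P" for P
    unfolding Z_def using that by (auto intro!: exI[of _ 0] simp: vanishing0_def)
  have Zv: "P \<in> Z" if "vanishing0 P" for P
    unfolding Z_def using that by (auto intro!: exI[of _ P] simp: L.zero)
  have Z_sub: "dop_vs.subspace Z"
  proof (rule dop_vs.subspaceI)
    show "0 \<in> Z" by (rule ZI) (rule L.zero)
  next
    fix P Q assume "P \<in> Z" "Q \<in> Z"
    then obtain P' Q' where *: "vanishing0 P'" "vanishing0 Q'"
      and "in_ratideal G (P - P')" "in_ratideal G (Q - Q')"
      unfolding Z_def by blast
    then have "in_ratideal G (P - P' + (Q - Q'))" by (intro L.add)
    moreover have "P - P' + (Q - Q') = P + Q - (P' + Q')" by simp
    ultimately have "in_ratideal G (P + Q - (P' + Q'))" by (rule subst[rotated])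
    then show "P + Q \<in> Z" unfolding Z_def using *
      by (auto intro!: exI[of _ "P' + Q'"] simp: vanishing0_def lookup_add)
  next
    fix c P assume "P \<in> Z"
    then obtain P' where "vanishing0 P'" "in_ratideal G (P - P')" unfolding Z_def by blast
    moreover have "cscale c P - cscale c P' = cscale c (P - P')" by (simp add: right_diff_distrib)
    ultimately show "cscale c P \<in> Z" unfolding Z_def
      using L.smul[of "P - P'" "single 0 c"]
      by (auto intro!: exI[of _ "cscale c P'"] simp: vanishing0_def lookup_times_0)
  qed
  obtain BZ where BZ: "BZ \<subseteq> Z" "dop_vs.independent BZ" "Z \<subseteq> dop_vs.span BZ"
    by (rule dop_vs.maximal_independent_subset)
  \<comment> \<open>The part of \<open>EB\<close> outside \<open>BZ\<close> represents a basis of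
    the fibre over K.\<close>
  define EB where "EB = dop_vs.extend_basis BZ"
  have EB: "BZ \<subseteq> EB" "dop_vs.independent EB" "dop_vs.span EB = UNIV"
    unfolding EB_def using BZ(2)
    by (auto simp: dop_vs.extend_basis_superset dop_vs.independent_extend_basis)
  \<comment> \<open>If the fibre had dimension less than d, its basis would by Nakayama span the
    quotient over K(x), against the independence of the d parametric terms.\<close>
  have large: "\<not> (finite (EB - BZ) \<and> card (EB - BZ) < ?d)"
  proof
    assume F: "finite (EB - BZ) \<and> card (EB - BZ) < ?d"
    let ?F = "EB - BZ"
    have gen: "\<exists>a Q. vanishing0 Q \<and> in_ratideal G (P - (\<Sum>f\<in>?F. a f \<odot> f) - Q)" for P
    proof -
      have "P \<in> dop_vs.span (BZ \<union> ?F)" using EB by (simp add: Un_absorb1)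
      then obtain x y where P: "P = x + y" and x: "x \<in> dop_vs.span BZ" and y: "y \<in> dop_vs.span ?F"
        unfolding dop_vs.span_Un by blast
      have "x \<in> Z" using x dop_vs.span_minimal[OF BZ(1) Z_sub] by blast
      then obtain Q where Q: "vanishing0 Q" "in_ratideal G (x - Q)" unfolding Z_def by blast
      obtain a where a: "y = (\<Sum>f\<in>?F. cscale (a f) f)"
        using y F dop_vs.span_finite[of ?F] by auto
      show ?thesis
        using Q P a by (intro exI[of _ "\<lambda>f. single 0 (a f)"] exI[of _ Q]) simp
    qed
    have "L.spanned ?\<Sigma> ?F (dterm x)" for x
    proof (rule L.nakayama[OF finE _ _ gen])
      show "L.spanned ?\<Sigma> (?F \<union> E) P" for P
        by (rule L.spanned_trans[OF L.multiplicative_local span])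
          (use F finE in \<open>auto intro: L.spanned_generator[OF L.multiplicative_local]\<close>)
    qed (use F in auto)
    then have "L.spanned {q. q \<noteq> 0} ?F (dterm x)" for x
      by (rule L.spanned_mono[rotated]) auto
    then obtain P where "P \<noteq> 0" "keys P \<subseteq> par_terms ord G" "in_ratideal G P"
      using L.relation_of_dterms[of ?F "par_terms ord G" "{}"] F finG by auto
    then show False using L.parametric_independent[OF gb] by blast
  qed
  obtain F where F: "F \<subseteq> EB - BZ" "finite F" "card F = ?d"
  proof (cases "finite (EB - BZ)")
    case True
    then show ?thesis using large that by (metis not_less obtain_subset_with_card_n)
  next
    case False
    then show ?thesis using infinite_arbitrarily_large that by metis
  qed
  obtain e where e: "bij_betw e {..<?d} F"
    using ex_bij_betw_nat_finite[OF F(2)] F(3) by (auto simp: atLeast0LessThan)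
  define \<phi> where "\<phi> b P = dop_vs.representation EB P b" for b P
  have l_add: "\<phi> b (P + Q) = \<phi> b P + \<phi> b Q" for b P Q
    unfolding \<phi>_def using EB by (simp add: dop_vs.representation_add)
  have l_scale: "\<phi> b (cscale c P) = c * \<phi> b P" for b c P
    unfolding \<phi>_def using EB by (simp add: dop_vs.representation_scale)
  have l_Z: "\<phi> b P = 0" if "b \<in> F" "P \<in> Z" for b P
  proof -
    have "dop_vs.representation EB P = dop_vs.representation BZ P"
      using EB BZ that by (intro dop_vs.representation_extend) auto
    then show ?thesis using that(1) F(1) dop_vs.representation_ne_zero[of BZ P b]
      unfolding \<phi>_def by auto
  qed
  define fs where "fs i = series_of (\<phi> (e i))" for i
  have eF: "e i \<in> F" if "i < ?d" for i using e that by (auto simp: bij_betw_def)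
  have act: "apply_op P (fs i) 0 = \<phi> (e i) P" if "i < ?d" for i P
    unfolding fs_def by (rule apply_series_of) (auto simp: l_add l_scale intro: l_Z eF that Zv)
  have "is_solution G (fs i)" if i: "i < ?d" for i
    unfolding is_solution_def
  proof (intro ballI ext)
    fix g w assume "g \<in> G"
    \<comment> \<open>Up to the factor w!, the coefficient of x^w in g f is the constant term of d^w
      g f, and d^w g lies in the ideal.\<close>
    then have "in_ratideal G (dmult (dterm w) g)" using gb by (intro L.dterm) (auto simp: is_GB_def)
    then have "apply_op (dmult (dterm w) g) (fs i) 0 = 0" using act[OF i] l_Z[OF eF[OF i] ZI] by simp
    then show "apply_op g (fs i) w = 0"
      by (simp add: apply_op_dmult apply_op_single dact_def)
  qed
  moreover have "c j = 0" if c: "\<forall>w. (\<Sum>i<?d. c i * fs i w) = 0" and j: "j < ?d" for c j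
  proof -
    \<comment> \<open>The series of a functional determines it, so a vanishing combination of the
      series makes \<Phi> zero; its value at the basis vector \<open>e j\<close> is
      \<open>c j\<close>.\<close>
    define \<Phi> where "\<Phi> P = (\<Sum>i<?d. c i * \<phi> (e i) P)" for P
    have "series_of \<Phi> = (\<lambda>_. 0)"
    proof
      fix v
      have "series_of \<Phi> v = (\<Sum>i<?d. c i * fs i v)"
        by (simp add: series_of_def \<Phi>_def fs_def sum_divide_distrib)
      then show "series_of \<Phi> v = 0" using c by simp
    qed
    moreover have "apply_op (e j) (series_of \<Phi>) 0 = \<Phi> (e j)"
      by (rule apply_series_of)
        (auto simp: \<Phi>_def l_add l_scale sum_distrib_left distrib_left sum.distrib mult.left_commute
          intro!: sum.neutral l_Z eF Zv)
    ultimately have "\<Phi> (e j) = 0" by simp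
    moreover have "\<phi> (e i) (e j) = (if i = j then 1 else 0)" if i: "i < ?d" for i
    proof -
      have "e j \<in> EB" using eF[OF j] F(1) by blast
      moreover have "e i = e j \<longleftrightarrow> i = j" using e i j by (auto simp: bij_betw_def inj_on_def)
      ultimately show ?thesis unfolding \<phi>_def using dop_vs.representation_basis[OF EB(2)] by auto
    qed
    ultimately show ?thesis using j unfolding \<Phi>_def by (simp add: if_distrib sum.delta cong: if_cong)
  qed
  ultimately show ?thesis unfolding has_indep_solutions_def by blast
qed

text \<open>The dimension bound d + |V| makes the parametric terms of \<open>M\<close> finite in
  number, and a reduction modulo the intersection is also one modulo the ideal of
  \<open>G\<close>.\<close>

lemma (in graded_order) has_indep_solutions_if_ordinary:
  fixes G M :: "('n,'k::field_char_0) dop set"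
  assumes gb: "is_GB ord G (in_ratideal G)" and dfin: "dfinite G" and V: "finite V"
    and gbM: "is_GB ord M (\<lambda>P. in_ratideal G P \<and> (\<forall>u\<in>V. in_ratideal (euler_ops u) P))"
    and ord: "ordinary_origin ord M"
  shows "has_indep_solutions G (card (par_terms ord G))"
proof -
  interpret L: op_ideal ord "in_ratideal G" by (rule op_ideal_ratideal)
  interpret L': op_ideal ord "\<lambda>P. in_ratideal G P \<and> (\<forall>u\<in>V. in_ratideal (euler_ops u) P)"
    by (rule L.op_ideal_Int) (rule op_ideal_ratideal)
  have finG: "finite (par_terms ord G)" by (rule finite_par_terms_dfinite[OF gb dfin])
  have "finite (par_terms ord M)"
  proof (rule L'.finite_par_terms[OF gbM])
    fix X :: "'n mexp set"
    assume X: "finite X" "card X = Suc (card (dterm ` par_terms ord G :: ('n,'k) dop set) + card V)"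
    have "L.spanned {q. q \<noteq> 0} (dterm ` par_terms ord G) (dterm x)" for x
    proof (rule L.spanned_parametric[OF gb L.multiplicative_nonzero _ finG])
      show "HC ord g \<in> {q. q \<noteq> 0}" if "g \<in> G" for g
        using that gb HT_in_keys[of g] by (auto simp: HC_def in_keys_iff is_GB_def)
    qed
    then show "\<exists>P. P \<noteq> 0 \<and> keys P \<subseteq> X \<and> in_ratideal G P \<and> (\<forall>u\<in>V. in_ratideal (euler_ops u) P)"
      using L.relation_of_dterms[of "dterm ` par_terms ord G" X V] X V finG
      unfolding in_ratideal_euler_iff by auto
  qed
  then have "finite (dterm ` par_terms ord M :: ('n,'k) dop set)" by simp
  moreover have "L.spanned {q. lookup q 0 \<noteq> 0} (dterm ` par_terms ord M) P" for P
  proof -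
    have "L'.spanned {q. lookup q 0 \<noteq> 0} (dterm ` par_terms ord M) P"
      by (rule L'.spanned_parametric[OF gbM L.multiplicative_local _ \<open>finite (par_terms ord M)\<close>])
        (use ord in \<open>auto simp: ordinary_origin_def singular_origin_def\<close>)
    then show ?thesis unfolding L'.spanned_def L.spanned_def by blast
  qed
  ultimately show ?thesis by (rule has_indep_solutions_if_spanned[OF gb finG])
qed

section \<open>Initial exponents are roots of indicial polynomials\<close>

definition eval_mono :: "'n::finite mexp \<Rightarrow> 'n mexp \<Rightarrow> 'k::comm_ring_1" where
  "eval_mono w a = (\<Prod>i\<in>UNIV. of_nat (lookup w i) ^ lookup a i)"

lemma eval_mono_add: "eval_mono w (a + b) = eval_mono w a * eval_mono w b"
  by (simp add: eval_mono_def lookup_add power_add prod.distrib)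

lemma peval_eq:
  assumes "finite A" "keys p \<subseteq> A"
  shows "peval p w = (\<Sum>a\<in>A. lookup p a * eval_mono w a)"
  unfolding peval_def eval_mono_def[symmetric]
  using assms by (intro sum.mono_neutral_left) (auto simp: in_keys_iff)

lemma peval_zero [simp]: "peval 0 w = 0"
  by (simp add: peval_def)

lemma peval_add: "peval (p + q) w = peval p w + peval q w"
  using keys_add[of p q]
  by (simp add: peval_eq[of "keys p \<union> keys q"] lookup_add distrib_right sum.distrib)

lemma peval_diff: "peval (p - q) w = peval p w - peval q w"
  using peval_add[of "p - q" q w] by simp

lemma peval_sum: "peval (sum p A) w = (\<Sum>a\<in>A. peval (p a) w)"
  by (induction A rule: infinite_finite_induct) (simp_all add: peval_add)

lemma peval_single: "peval (single a c) w = c * eval_mono w a"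
  by (simp add: peval_eq[of "{a}"])

lemma peval_mult: "peval (p * q) w = peval p w * peval q w"
proof -
  have "p * q = (\<Sum>a\<in>keys p. \<Sum>b\<in>keys q. single (a + b) (lookup p a * lookup q b))"
    by (simp only: mult_single[symmetric] sum_product[symmetric] poly_mapping_sum_single)
  then have "peval (p * q) w =
      (\<Sum>a\<in>keys p. \<Sum>b\<in>keys q. (lookup p a * eval_mono w a) * (lookup q b * eval_mono w b))"
    by (simp add: peval_sum peval_single eval_mono_add ac_simps)
  also have "\<dots> = peval p w * peval q w"
    by (simp add: peval_eq[OF finite_keys order_refl] sum_product)
  finally show ?thesis .
qed

lemma peval_one: "peval 1 w = 1"
  using peval_single[of 0 1 w] by (simp add: eval_mono_def)

lemma peval_prod: "peval (prod p A) w = (\<Prod>a\<in>A. peval (p a) w)"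
  by (induction A rule: infinite_finite_induct) (simp_all add: peval_mult peval_one)

lemma eval_mono_unit: "eval_mono w (single i 1) = of_nat (lookup w i)"
proof -
  have "eval_mono w (single i 1) = (\<Prod>j\<in>UNIV. if j = i then of_nat (lookup w j) else 1)"
    unfolding eval_mono_def by (rule prod.cong) (auto simp: lookup_single when_def)
  then show ?thesis by simp
qed

lemma of_nat_ffall: "of_nat (ffall a k) = (\<Prod>j<k. (of_nat a - of_nat j :: 'k::comm_ring_1))"
proof (cases "k \<le> a")
  case True
  then show ?thesis unfolding ffall_def of_nat_prod by (intro prod.cong) (auto simp: of_nat_diff)
next
  case False
  then have "(\<Prod>j<k. (of_nat a - of_nat j :: 'k)) = 0"
    using prod.remove[of "{..<k}" a "\<lambda>j. of_nat a - of_nat j :: 'k"] by simp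
  then show ?thesis using False by (simp add: ffall_eq_0)
qed

lemma peval_ffpoly: "peval (ffpoly u) w = (of_nat (ffallm w u) :: 'k::comm_ring_1)"
proof -
  have "peval (single (single i 1) 1 - single 0 (of_nat j)) w = (of_nat (lookup w i) - of_nat j :: 'k)"
    for i j
    unfolding peval_diff peval_single eval_mono_unit by (simp add: eval_mono_def)
  then show ?thesis
    by (simp add: ffpoly_def peval_prod ffallm_def of_nat_prod of_nat_ffall)
qed

lemma lookup_mconst: "lookup (mconst m) i = m"
  by (simp add: mconst_def lookup_sum lookup_single when_def)

lemma lookup_le_dorder:
  assumes "u \<in> keys P"
  shows "lookup u i \<le> dorder P"
proof -
  have "tdeg u \<le> dorder P" unfolding dorder_def using assms by (intro Max_ge) auto
  then show ?thesis using lookup_le_tdeg[of u i] by simp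
qed

lemma peval_indq: "peval (indq P v) w = (\<Sum>u\<in>keys P.
    if \<forall>i. dorder P \<le> lookup v i + lookup u i
    then lookup (lookup P u) (v + u - mconst (dorder P)) * of_nat (ffallm w u) else 0)"
  unfolding indq_def peval_sum
  by (rule sum.cong) (auto simp: peval_mult peval_single peval_ffpoly eval_mono_def)

text \<open>In x^m P = sum_v x^v Q_v(delta) the operator Q_v(delta) multiplies f_w x^w by Q_v(w).
  The coefficient of x^(y + m) collects the pairs with v + w = y + m.\<close>

lemma apply_op_indq:
  fixes P :: "('n::finite,'k::comm_ring_1) dop"
  defines "m \<equiv> mconst (dorder P)"
  shows "apply_op P f y = (\<Sum>w | mdvd w (y + m). peval (indq P (y + m - w)) w * f w)"
proof -
  define g where "g u w = (if \<forall>i. dorder P \<le> lookup (y + m - w) i + lookup u i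
    then lookup (lookup P u) (y + m - w + u - m) * of_nat (ffallm w u) else 0) * f w" for u w
  have "(\<Sum>w | mdvd w (y + m). peval (indq P (y + m - w)) w * f w) =
      (\<Sum>w | mdvd w (y + m). \<Sum>u\<in>keys P. g u w)"
    unfolding peval_indq g_def sum_distrib_right m_def ..
  also have "\<dots> = (\<Sum>u\<in>keys P. \<Sum>w | mdvd w (y + m). g u w)" by (rule sum.swap)
  also have "\<dots> = (\<Sum>u\<in>keys P. pact (lookup P u) (dact u f) y)"
  proof (rule sum.cong[OF refl])
    fix u assume u: "u \<in> keys P"
    have le: "lookup u i \<le> lookup m i" for i
      using lookup_le_dorder[OF u] by (simp add: m_def lookup_mconst)
    \<comment> \<open>Only these \<open>w\<close> contribute: d^u must not kill x^w, and a monomial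
      x^a must carry \<open>w - u\<close> to \<open>y\<close>.\<close>
    define W where "W = {w. mdvd u w \<and> mdvd w (y + u)}"
    have "mdvd w (y + m)" if "w \<in> W" for w
    proof -
      have "lookup w i \<le> lookup y i + lookup u i" for i
        using that by (simp add: W_def mdvd_def lookup_add)
      then have "lookup w i \<le> lookup y i + lookup m i" for i
        using le[of i] by (meson add_left_mono order_trans)
      then show ?thesis by (simp add: mdvd_def lookup_add)
    qed
    moreover have "g u w = 0" if wm: "mdvd w (y + m)" and wW: "w \<notin> W" for w
    proof (cases "mdvd u w")
      case True
      then obtain i where i: "\<not> lookup w i \<le> lookup (y + u) i"
        using wW unfolding W_def mdvd_def by blast
      have "lookup w i \<le> lookup (y + m) i" using wm by (simp add: mdvd_def)
      then have "\<not> dorder P \<le> lookup (y + m - w) i + lookup u i"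
        using i by (simp add: lookup_add lookup_minus m_def lookup_mconst)
      then show ?thesis unfolding g_def by auto
    next
      case False
      then show ?thesis by (simp add: g_def ffallm_eq_0)
    qed
    ultimately have "(\<Sum>w | mdvd w (y + m). g u w) = (\<Sum>w\<in>W. g u w)"
      by (intro sum.mono_neutral_right) auto
    also have "\<dots> = (\<Sum>a | mdvd a y. lookup (lookup P u) a * dact u f (y - a))"
    proof (rule sum.reindex_bij_witness[of _ "\<lambda>a. y - a + u" "\<lambda>w. y + u - w"])
      fix w assume "w \<in> W"
      then have w: "lookup u i \<le> lookup w i" "lookup w i \<le> lookup y i + lookup u i" for i
        by (simp_all add: W_def mdvd_def lookup_add)
      show "y - (y + u - w) + u = w"
      proof (rule poly_mapping_eqI)
        fix i show "lookup (y - (y + u - w) + u) i = lookup w i"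
          using w[of i] by (simp add: lookup_add lookup_minus)
      qed
      show "y + u - w \<in> {a. mdvd a y}"
        using w by (simp add: mdvd_def lookup_add lookup_minus le_diff_conv)
      have "y + m - w + u - m = y + u - w"
      proof (rule poly_mapping_eqI)
        fix i show "lookup (y + m - w + u - m) i = lookup (y + u - w) i"
          using w[of i] le[of i] by (simp add: lookup_add lookup_minus)
      qed
      moreover have "dorder P \<le> lookup (y + m - w) i + lookup u i" for i
        using w[of i] le[of i] by (simp add: lookup_add lookup_minus m_def lookup_mconst)
      ultimately show "lookup (lookup P u) (y + u - w) * dact u f (y - (y + u - w)) = g u w"
        unfolding dact_def \<open>y - (y + u - w) + u = w\<close> by (simp add: g_def mult.assoc)
    next
      fix a assume "a \<in> {a. mdvd a y}"
      then have a: "lookup a i \<le> lookup y i" for i by (simp add: mdvd_def)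
      show "y + u - (y - a + u) = a"
      proof (rule poly_mapping_eqI)
        fix i show "lookup (y + u - (y - a + u)) i = lookup a i"
          using a[of i] by (simp add: lookup_add lookup_minus)
      qed
      show "y - a + u \<in> W" by (simp add: W_def mdvd_def lookup_add lookup_minus)
    qed
    finally show "(\<Sum>w | mdvd w (y + m). g u w) = pact (lookup P u) (dact u f) y"
      by (simp add: pact_def)
  qed
  finally show ?thesis by (simp add: apply_op_expand)
qed

text \<open>Q_v(w) vanishes whenever x^(v + w - m) would have a negative exponent; this keeps the
  later difference \<open>v + b - ?m\<close> from being truncated.\<close>

lemma mdvd_of_peval_indq:
  fixes P :: "('n::finite,'k::comm_ring_1) dop"
  assumes "peval (indq P v) w \<noteq> 0"
  shows "mdvd (mconst (dorder P)) (v + w)"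
proof -
  obtain u where u: "\<forall>i. dorder P \<le> lookup v i + lookup u i"
      "lookup (lookup P u) (v + u - mconst (dorder P)) * of_nat (ffallm w u) \<noteq> 0"
    using assms unfolding peval_indq
    by (auto elim!: sum.not_neutral_contains_not_neutral split: if_splits)
  then have "mdvd u w" using ffallm_eq_0[of u w] by (metis mult_zero_right of_nat_0)
  then have "dorder P \<le> lookup v i + lookup w i" for i
    using u(1) unfolding mdvd_def by (meson add_left_mono order_trans)
  then show ?thesis by (simp add: mdvd_def lookup_mconst lookup_add)
qed

section \<open>Initial exponents of solutions and echelon families\<close>

definition lowest_exp :: "('n mexp \<Rightarrow> 'n mexp \<Rightarrow> bool) \<Rightarrow> ('n mexp \<Rightarrow> 'k::zero) \<Rightarrow> 'n mexp \<Rightarrow> bool" where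
  "lowest_exp ord f b \<longleftrightarrow> f b \<noteq> 0 \<and> (\<forall>v. f v \<noteq> 0 \<longrightarrow> ord b v)"

context graded_order
begin

text \<open>Since \<open>v\<close> and \<open>b\<close> are lowest, they are the only pair
  contributing to the coefficient of x^(v + b) in x^m P f. That coefficient is ind(P)(b) f_b and has
  to vanish.\<close>

lemma indicial_root:
  fixes P :: "('n,'k::field_char_0) dop"
  assumes sol: "apply_op P f = (\<lambda>_. 0)" and b: "lowest_exp ord f b"
  shows "peval (ind ord P) b = 0"
proof (cases "P = 0")
  case True
  then show ?thesis by (simp add: ind_def)
next
  case False
  let ?m = "mconst (dorder P)"
  have "{v. indq P v \<noteq> 0} \<noteq> {}"
  proof
    assume "{v. indq P v \<noteq> 0} = {}"
    then have "indq P v = 0" for v by blast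
    then have "apply_op P (mono_series u) = (\<lambda>_. 0)" for u
      by (rule_tac ext) (simp add: apply_op_indq)
    then show False using apply_op_faithful_0 False by blast
  qed
  then obtain v where v: "indq P v \<noteq> 0" "\<And>w. indq P w \<noteq> 0 \<Longrightarrow> ord v w"
    using ex_ord_min[of "{v. indq P v \<noteq> 0}"] by blast
  then have "(THE v. indq P v \<noteq> 0 \<and> (\<forall>w. indq P w \<noteq> 0 \<longrightarrow> ord v w)) = v"
    using ord_antisym by (intro the_equality) blast+
  then have ind: "ind ord P = indq P v" using False by (simp add: ind_def)
  show ?thesis
  proof (rule ccontr)
    assume neq: "peval (ind ord P) b \<noteq> 0"
    define y where "y = v + b - ?m"
    have y: "y + ?m = v + b"
      unfolding y_def using neq mdvd_of_peval_indq[of P v b] by (intro mdvd_diff_add) (simp add: ind)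
    have "peval (indq P (v + b - w)) w * f w = (if w = b then peval (indq P v) b * f b else 0)"
      if "mdvd w (v + b)" for w
    proof (cases "w = b")
      case wb: False
      have s: "v + b = (v + b - w) + w" using mdvd_diff_add[OF that] by simp
      have "indq P (v + b - w) = 0 \<or> f w = 0"
        using ord_add_eq(2)[OF v(2) _ s] b wb unfolding lowest_exp_def by blast
      then show ?thesis using wb by auto
    qed simp
    then have "apply_op P f y = (\<Sum>w | mdvd w (v + b). if w = b then peval (indq P v) b * f b else 0)"
      unfolding apply_op_indq y by (intro sum.cong) auto
    also have "\<dots> = peval (indq P v) b * f b" by simp
    finally show False using neq sol b by (simp add: ind lowest_exp_def)
  qed
qed

lemma initial_exponent_candidate:
  fixes G :: "('n,'k::field_char_0) dop set"
  assumes S: "initial_exponent_candidates ord G S" and sol: "is_solution G f" and b: "lowest_exp ord f b"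
  shows "b \<in> S"
proof -
  obtain fs where fs: "pideal fs \<subseteq> ind_ideal ord G" "S = {w. \<forall>f\<in>set fs. peval f w = 0}"
    using S unfolding initial_exponent_candidates_def by blast
  have "peval p b = 0" if p: "p \<in> set fs" for p
  proof -
    obtain k where k: "k < length fs" "fs ! k = p" using p by (auto simp: in_set_conv_nth)
    have "p = (\<Sum>i<length fs. (if i = k then 1 else 0) * fs ! i)"
      using k by (simp add: if_distrib[of "\<lambda>x. x * _"] cong: if_cong)
    then have "p \<in> pideal fs"
      unfolding pideal_def by (intro CollectI exI[of _ "\<lambda>i. if i = k then 1 else 0"]) simp
    then obtain P where "p = ind ord P" "in_ratideal G P" using fs(1) unfolding ind_ideal_def by blast
    then show ?thesis using indicial_root[OF solution_ratideal[OF sol] b] by blast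
  qed
  then show ?thesis using fs(2) by blast
qed

text \<open>With fewer than d initial exponents, some nontrivial combination of the solutions would
  vanish at all of them, although it is a nonzero solution with an initial exponent of its
  own.\<close>

lemma many_initial_exponents:
  fixes G :: "('n,'k::field_char_0) dop set"
  assumes "has_indep_solutions G d"
  shows "\<exists>B \<subseteq> {b. \<exists>f. is_solution G f \<and> lowest_exp ord f b}. finite B \<and> card B = d"
proof -
  let ?E = "{b. \<exists>f. is_solution G f \<and> lowest_exp ord f b}"
  obtain fs where sol: "\<And>i. i < d \<Longrightarrow> is_solution G (fs i)"
    and ind: "\<And>c. \<forall>w. (\<Sum>i<d. c i * fs i w) = 0 \<Longrightarrow> \<forall>i<d. c i = 0"
    using assms unfolding has_indep_solutions_def by blast
  show ?thesis
  proof (cases "finite ?E \<and> card ?E < d")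
    case True
    have "\<exists>c. (\<exists>i\<in>{..<d}. c i \<noteq> 0) \<and> (\<forall>b\<in>?E. (\<Sum>i<d. c i * fs i b) = 0)"
      by (rule linear_relation) (use True in auto)
    then obtain c where c: "\<exists>i<d. c i \<noteq> 0" "\<And>b. b \<in> ?E \<Longrightarrow> (\<Sum>i<d. c i * fs i b) = 0" by auto
    define f where "f w = (\<Sum>i<d. c i * fs i w)" for w
    have "is_solution G f"
      unfolding is_solution_def f_def
    proof (intro ballI ext)
      fix g w assume "g \<in> G"
      then have "apply_op g (fs i) w = 0" if "i < d" for i
        using sol[OF that] by (simp add: is_solution_def)
      then show "apply_op g (\<lambda>w. \<Sum>i<d. c i * fs i w) w = 0"
        unfolding apply_op_right_sum apply_op_right_cmul by simp
    qed
    moreover have "f \<noteq> (\<lambda>_. 0)" using ind[of c] c(1) unfolding f_def fun_eq_iff by blast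
    then obtain b where "lowest_exp ord f b" using ex_lowest unfolding lowest_exp_def by blast
    ultimately have "f b = 0" using c(2)[of b] unfolding f_def by blast
    then show ?thesis using \<open>lowest_exp ord f b\<close> by (simp add: lowest_exp_def)
  next
    case False
    show ?thesis
    proof (cases "finite ?E")
      case True
      then have "d \<le> card ?E" using False by simp
      then obtain B where "B \<subseteq> ?E" "card B = d" "finite B" by (rule obtain_subset_with_card_n)
      then show ?thesis by blast
    next
      case inf: False
      obtain B where "finite B" "card B = d" "B \<subseteq> ?E" using infinite_arbitrarily_large[OF inf] by blast
      then show ?thesis by blast
    qed
  qed
qed

text \<open>Back substitution, from the largest exponent downwards; \<open>A\<close> stands for a
  linear space of series.\<close>

lemma echelon_series:
  fixes f :: "'n mexp \<Rightarrow> 'n mexp \<Rightarrow> 'k::field"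
  assumes U: "finite U" and low: "\<And>u. u \<in> U \<Longrightarrow> A (f u) \<and> lowest_exp ord (f u) u"
    and A_add: "\<And>g h. A g \<Longrightarrow> A h \<Longrightarrow> A (\<lambda>w. g w + h w)" and A_cmul: "\<And>c g. A g \<Longrightarrow> A (\<lambda>w. c * g w)"
    and u: "u \<in> U"
  shows "\<exists>h. A h \<and> (\<forall>v\<in>U. h v = (if v = u then 1 else 0))"
  using u
proof (induction "card {v \<in> U. ord u v \<and> v \<noteq> u}" arbitrary: u rule: less_induct)
  case less
  let ?V = "{v \<in> U. ord u v \<and> v \<noteq> u}"
  have "\<exists>h. A h \<and> (\<forall>v\<in>U. h v = (if v = u' then 1 else 0))" if u': "u' \<in> ?V" for u'
  proof (rule less.hyps)
    have "{v \<in> U. ord u' v \<and> v \<noteq> u'} \<subset> ?V"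
      using u' ord_trans ord_antisym by blast
    then show "card {v \<in> U. ord u' v \<and> v \<noteq> u'} < card ?V"
      using U by (intro psubset_card_mono) auto
  qed (use u' in auto)
  then have "\<forall>u'\<in>?V. \<exists>h. A h \<and> (\<forall>v\<in>U. h v = (if v = u' then 1 else 0))" by blast
  from bchoice[OF this]
  obtain h where h: "\<forall>v\<in>?V. A (h v) \<and> (\<forall>v'\<in>U. h v v' = (if v' = v then 1 else 0))" ..
  have fu: "A (f u)" "f u u \<noteq> 0" "\<And>v. f u v \<noteq> 0 \<Longrightarrow> ord u v"
    using low[OF less.prems] by (auto simp: lowest_exp_def)
  have zero: "A (\<lambda>_. 0)" using A_cmul[OF fu(1), of 0] by simp
  have "A (\<lambda>w. \<Sum>v\<in>V. - f u v * h v w)" if "finite V" "V \<subseteq> ?V" for V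
    using that
  proof (induction V rule: finite_induct)
    case empty
    then show ?case using zero by simp
  next
    case (insert v V)
    then show ?case using A_add[OF A_cmul[of "h v" "- f u v"] insert.IH] h by simp
  qed
  \<comment> \<open>The dual series of the larger exponents clear \<open>f u\<close> there, and at
    smaller exponents \<open>f u\<close> is already zero; the inverse normalizes the value at
    \<open>u\<close>.\<close>
  then have "A (\<lambda>w. inverse (f u u) * (f u w + (\<Sum>v\<in>?V. - f u v * h v w)))"
    using U by (intro A_cmul A_add fu(1)) auto
  moreover have "inverse (f u u) * (f u w + (\<Sum>v\<in>?V. - f u v * h v w)) = (if w = u then 1 else 0)"
    if w: "w \<in> U" for w
  proof -
    have "(\<Sum>v\<in>?V. - f u v * h v w) = (\<Sum>v\<in>?V. if v = w then - f u w else 0)"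
      using h w by (intro sum.cong) auto
    also have "\<dots> = (if w \<in> ?V then - f u w else 0)" using U by simp
    finally show ?thesis using fu(2) fu(3)[of w] w by auto
  qed
  ultimately show ?case by blast
qed

end

section \<open>Dickson's lemma\<close>

text \<open>Take the positions whose value is never undercut later. There are infinitely many,
  because beyond any \<open>N\<close> a position of least value is one.\<close>

lemma mono_subsequence_nat:
  fixes y :: "nat \<Rightarrow> nat"
  shows "\<exists>r :: nat \<Rightarrow> nat. strict_mono r \<and> mono (\<lambda>k. y (r k))"
proof -
  let ?A = "{n. \<forall>m\<ge>n. y n \<le> y m}"
  have "\<exists>n>N. n \<in> ?A" for N
  proof -
    obtain n where "n > N" "\<And>m. m > N \<Longrightarrow> y n \<le> y m"
      using ex_has_least_nat[of "\<lambda>n. n > N" "Suc N" y] by blast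
    then show ?thesis by (intro exI[of _ n]) auto
  qed
  then have inf: "infinite ?A" by (simp add: infinite_nat_iff_unbounded)
  have "y (enumerate ?A k) \<le> y (enumerate ?A l)" if "k \<le> l" for k l
    using enumerate_in_set[OF inf, of k] strict_mono_less_eq[OF strict_mono_enumerate[OF inf]] that
    by blast
  then show ?thesis using strict_mono_enumerate[OF inf] by (intro exI[of _ "enumerate ?A"]) (auto intro: monoI)
qed

lemma mono_subsequence:
  fixes \<Phi> :: "('a \<Rightarrow> nat) set" and x :: "nat \<Rightarrow> 'a"
  assumes "finite \<Phi>"
  shows "\<exists>r :: nat \<Rightarrow> nat. strict_mono r \<and> (\<forall>\<phi>\<in>\<Phi>. mono (\<lambda>k. \<phi> (x (r k))))"
  using assms
proof (induction \<Phi> rule: finite_induct)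
  case empty
  then show ?case by (intro exI[of _ id]) (simp add: strict_mono_def)
next
  case (insert \<phi> \<Phi>)
  then obtain r :: "nat \<Rightarrow> nat" where r: "strict_mono r" "\<And>\<psi>. \<psi> \<in> \<Phi> \<Longrightarrow> mono (\<lambda>k. \<psi> (x (r k)))" by blast
  obtain s :: "nat \<Rightarrow> nat" where s: "strict_mono s" "mono (\<lambda>k. \<phi> (x (r (s k))))"
    using mono_subsequence_nat[of "\<lambda>k. \<phi> (x (r k))"] by blast
  have "mono (\<lambda>k. \<psi> (x (r (s k))))" if "\<psi> \<in> \<Phi>" for \<psi>
    using r(2)[OF that] strict_mono_mono[OF s(1)] by (auto simp: mono_def)
  moreover have "strict_mono (\<lambda>k. r (s k))" using r(1) s(1) by (auto simp: strict_mono_def)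
  ultimately show ?case using s(2) by (intro exI[of _ "\<lambda>k. r (s k)"]) auto
qed

text \<open>Stated for functions into the natural numbers so that divisibility of exponents, a
  degree defect and equality of derivative exponents can be treated together.\<close>

lemma dickson_basis:
  fixes \<Phi> :: "('a \<Rightarrow> nat) set"
  assumes "finite \<Phi>"
  shows "\<exists>F \<subseteq> X. finite F \<and> (\<forall>h\<in>X. \<exists>g\<in>F. \<forall>\<phi>\<in>\<Phi>. \<phi> g \<le> \<phi> h)"
proof (rule ccontr)
  define le where "le g h \<longleftrightarrow> (\<forall>\<phi>\<in>\<Phi>. \<phi> g \<le> \<phi> h)" for g h
  assume "\<not> ?thesis"
  then have neg: "\<not> (\<exists>F \<subseteq> X. finite F \<and> (\<forall>h\<in>X. \<exists>g\<in>F. le g h))" by (unfold le_def)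
  \<comment> \<open>Greedy choices give a sequence in which no element is below a later one; a
    subsequence on which all functions are monotone refutes this.\<close>
  define pick where "pick F = (SOME h. h \<in> X \<and> (\<forall>g\<in>F. \<not> le g h))" for F
  have pick: "pick F \<in> X \<and> (\<forall>g\<in>F. \<not> le g (pick F))" if "F \<subseteq> X" "finite F" for F
    unfolding pick_def
  proof (rule someI_ex)
    have "\<not> (\<forall>h\<in>X. \<exists>g\<in>F. le g h)"
    proof
      assume "\<forall>h\<in>X. \<exists>g\<in>F. le g h"
      then have "\<exists>F \<subseteq> X. finite F \<and> (\<forall>h\<in>X. \<exists>g\<in>F. le g h)" using that by (intro exI[of _ F]) simp
      then show False using neg by contradiction
    qed
    then show "\<exists>h. h \<in> X \<and> (\<forall>g\<in>F. \<not> le g h)" by auto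
  qed
  define A where "A = rec_nat {} (\<lambda>_ F. insert (pick F) F)"
  have A: "A 0 = {}" "A (Suc n) = insert (pick (A n)) (A n)" for n by (simp_all add: A_def)
  have fin: "A n \<subseteq> X \<and> finite (A n)" for n
    by (induction n) (use A pick in auto)
  have "pick (A m) \<in> A n" if "m < n" for m n
    using that by (induction n) (auto simp: A less_Suc_eq)
  then have bad: "\<not> le (pick (A m)) (pick (A n))" if "m < n" for m n
    using pick fin that by blast
  obtain r :: "nat \<Rightarrow> nat" where r: "strict_mono r" "\<And>\<phi>. \<phi> \<in> \<Phi> \<Longrightarrow> mono (\<lambda>k. \<phi> (pick (A (r k))))"
    using mono_subsequence[OF assms, of "\<lambda>n. pick (A n)"] by blast
  have "le (pick (A (r 0))) (pick (A (r 1)))"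
    unfolding le_def using r(2) by (auto simp: mono_def)
  moreover have "r 0 < r 1" using r(1) by (simp add: strict_mono_def)
  ultimately show False using bad by blast
qed

section \<open>Clearing denominators locally\<close>

text \<open>A variant of Mora's tangent cone argument: terms of an operator are pairs of an
  \<open>x\<close>-exponent and a derivative exponent, and the lowest one plays the role of the head term.\<close>

definition terms :: "('n,'k::zero) dop \<Rightarrow> ('n mexp \<times> 'n mexp) set" where
  "terms h = {(w, v). lookup (lookup h v) w \<noteq> 0}"

lemma in_keys_of_coeff: "lookup (lookup P u) w \<noteq> 0 \<Longrightarrow> u \<in> keys P"
  by (metis in_keys_iff lookup_zero)

lemma mem_terms: "(w, v) \<in> terms h \<longleftrightarrow> lookup (lookup h v) w \<noteq> 0"
  by (simp add: terms_def)

lemma finite_terms: "finite (terms h)"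
proof (rule finite_subset)
  show "terms h \<subseteq> (\<Union>v\<in>keys h. (\<lambda>w. (w, v)) ` keys (lookup h v))"
  proof
    fix p assume "p \<in> terms h"
    then obtain w v where p: "p = (w, v)" "lookup (lookup h v) w \<noteq> 0" unfolding terms_def by blast
    then have "v \<in> keys h" "w \<in> keys (lookup h v)" by (auto simp: in_keys_of_coeff in_keys_iff[of w])
    then show "p \<in> (\<Union>v\<in>keys h. (\<lambda>w. (w, v)) ` keys (lookup h v))" using p(1) by blast
  qed
qed auto

lemma terms_nonempty: "h \<noteq> 0 \<Longrightarrow> terms h \<noteq> {}"
  by (metis ex_in_conv lookup_zero mem_terms poly_mapping_eqI)

text \<open>Its excess over the degree of the lowest term is the ecart in Mora's algorithm.\<close>

definition xdegree :: "('n::finite,'k::zero) dop \<Rightarrow> nat" where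
  "xdegree h = Max (insert 0 ((\<lambda>p. tdeg (fst p)) ` terms h))"

lemma xdegree_ge: "p \<in> terms h \<Longrightarrow> tdeg (fst p) \<le> xdegree h"
  unfolding xdegree_def by (rule Max_ge) (auto simp: finite_terms)

lemma xdegree_le: "(\<And>p. p \<in> terms h \<Longrightarrow> tdeg (fst p) \<le> D) \<Longrightarrow> xdegree h \<le> D"
  unfolding xdegree_def by (auto simp: finite_terms)

lemma keys_smul_diff:
  assumes "keys b \<subseteq> U" "keys c \<subseteq> U"
  shows "keys (s \<odot> b - a \<odot> c) \<subseteq> U"
proof
  fix u assume "u \<in> keys (s \<odot> b - a \<odot> c)"
  then have "lookup b u \<noteq> 0 \<or> lookup c u \<noteq> 0" by (auto simp: in_keys_iff lookup_minus)
  then show "u \<in> U" using assms by (auto simp: in_keys_iff)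
qed

lemma lookup_single_times:
  "lookup (single a c * p) w = (if mdvd a w then c * lookup (p :: ('n::finite,'k::comm_ring_1) xpoly) (w - a) else 0)"
  by (simp add: lookup_times pact_single)

context graded_order
begin

text \<open>The x-exponent decides first, so lowest terms reflect the order of vanishing at the
  origin; the derivative exponent only breaks ties.\<close>

definition tord :: "'n mexp \<times> 'n mexp \<Rightarrow> 'n mexp \<times> 'n mexp \<Rightarrow> bool" where
  "tord p q \<longleftrightarrow> fst p \<noteq> fst q \<and> ord (fst p) (fst q) \<or> fst p = fst q \<and> ord (snd p) (snd q)"

lemma tord_total: "tord p q \<or> tord q p"
  using ord_linear unfolding tord_def by metis

lemma tord_trans: "tord p q \<Longrightarrow> tord q r \<Longrightarrow> tord p r"
  using ord_trans[of "fst p" "fst q" "fst r"] ord_trans[of "snd p" "snd q" "snd r"]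
    ord_antisym[of "fst p" "fst q"] unfolding tord_def by auto

lemma tord_antisym: "tord p q \<Longrightarrow> tord q p \<Longrightarrow> p = q"
  unfolding tord_def using ord_antisym by (metis prod_eqI)

lemma tord_fst: "tord p q \<Longrightarrow> ord (fst p) (fst q)"
  unfolding tord_def by (metis ord_refl)

lemma tord_shift: "tord (w, v) (w', v') \<Longrightarrow> tord (w + a, v) (w' + a, v')"
  unfolding tord_def using ord_add_right by auto

definition is_low :: "('n,'k::zero) dop \<Rightarrow> 'n mexp \<times> 'n mexp \<Rightarrow> bool" where
  "is_low h p \<longleftrightarrow> p \<in> terms h \<and> (\<forall>q\<in>terms h. tord p q)"

definition low :: "('n,'k::zero) dop \<Rightarrow> 'n mexp \<times> 'n mexp" where
  "low h = (SOME p. is_low h p)"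

lemma is_low_low: "h \<noteq> 0 \<Longrightarrow> is_low h (low h)"
  unfolding low_def
proof (rule someI_ex)
  assume "h \<noteq> 0"
  have "\<exists>p\<in>terms h. \<forall>q\<in>terms h. tord p q"
    by (rule finite_total_has_min[OF finite_terms terms_nonempty[OF \<open>h \<noteq> 0\<close>] tord_total]) (rule tord_trans)
  then show "\<exists>p. is_low h p" unfolding is_low_def by blast
qed

lemma finite_tord_max:
  assumes "finite A" "A \<noteq> {}"
  shows "\<exists>p\<in>A. \<forall>q\<in>A. tord q p"
  by (rule finite_total_has_min[OF assms, of "\<lambda>p q. tord q p"]) (use tord_total tord_trans in blast)+

text \<open>The second conclusion records where the remaining terms come from, which later controls
  the degree in x.\<close>

lemma cancel_low:
  fixes h g :: "('n,'k::field) dop"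
  assumes h: "is_low h (w, v)" and g: "is_low g (w0, v)" and d: "mdvd w0 w"
  obtains c where "\<forall>r\<in>terms (h - single (w - w0) c \<odot> g). tord (w, v) r \<and> r \<noteq> (w, v)"
    and "\<forall>r\<in>terms (h - single (w - w0) c \<odot> g).
      r \<in> terms h \<or> (\<exists>r'\<in>terms g. fst r = fst r' + (w - w0))"
proof -
  let ?a = "w - w0"
  define c where "c = lookup (lookup h v) w / lookup (lookup g v) w0"
  let ?h = "h - single ?a c \<odot> g"
  have w: "w0 + ?a = w" using mdvd_diff_add[OF d] by (simp add: add.commute)
  have g0: "lookup (lookup g v) w0 \<noteq> 0" using g by (simp add: is_low_def mem_terms)
  have coeff: "lookup (lookup ?h v') w' = lookup (lookup h v') w' -
      (if mdvd ?a w' then c * lookup (lookup g v') (w' - ?a) else 0)" for v' w'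
    by (simp add: lookup_minus lookup_single_times)
  have cases: "(w', v') \<in> terms h \<or> mdvd ?a w' \<and> (w' - ?a, v') \<in> terms g" if "(w', v') \<in> terms ?h" for w' v'
    using that unfolding mem_terms coeff by (auto split: if_splits)
  have wa: "w - ?a = w0" "mdvd ?a w" using w mdvd_add(2)[of ?a w0] by (metis add_diff_cancel_right', simp)
  have "tord (w, v) r \<and> r \<noteq> (w, v)" if r: "r \<in> terms ?h" for r
  proof
    obtain w' v' where rw: "r = (w', v')" by (cases r)
    show "tord (w, v) r"
      using cases[of w' v'] r
    proof (simp add: rw, elim disjE conjE)
      assume "(w', v') \<in> terms h"
      then show "tord (w, v) (w', v')" using h by (simp add: is_low_def)
    next
      assume "mdvd ?a w'" "(w' - ?a, v') \<in> terms g"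
      then have "tord (w0 + ?a, v) (w' - ?a + ?a, v')" using g by (intro tord_shift) (simp add: is_low_def)
      then show "tord (w, v) (w', v')" by (simp only: w mdvd_diff_add[OF \<open>mdvd ?a w'\<close>])
    qed
    have "lookup (lookup ?h v) w = 0"
      unfolding coeff wa(1) using wa(2) g0 by (simp add: c_def)
    then show "r \<noteq> (w, v)" using r by (auto simp: mem_terms)
  qed
  moreover have "r \<in> terms h \<or> (\<exists>r'\<in>terms g. fst r = fst r' + ?a)" if "r \<in> terms ?h" for r
    using cases[of "fst r" "snd r"] that mdvd_diff_add[of ?a "fst r"] by force
  ultimately show ?thesis using that by blast
qed

text \<open>If no \<open>s b - a c\<close> were zero, division by the lowest term of
  \<open>a\<close> would go on forever, with growing degree in x. Reducing instead by members of
  \<open>H\<close> of no larger ecart keeps that degree bounded, and then only finitely many lowest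
  terms are available.\<close>

lemma local_denominator:
  fixes a :: "('n,'k::field) xpoly" and b :: "('n,'k) dop"
  assumes U: "finite U" and b: "keys b \<subseteq> U" and a: "lookup a \<alpha> \<noteq> 0" "\<And>v. lookup a v \<noteq> 0 \<Longrightarrow> ord \<alpha> v"
    and div: "\<And>s c. lookup s 0 \<noteq> 0 \<Longrightarrow> keys c \<subseteq> U \<Longrightarrow> s \<odot> b - a \<odot> c \<noteq> 0 \<Longrightarrow>
      mdvd \<alpha> (fst (low (s \<odot> b - a \<odot> c)))"
  shows "\<exists>s c. lookup s 0 \<noteq> 0 \<and> keys c \<subseteq> U \<and> s \<odot> b = a \<odot> c"
proof (rule ccontr)
  assume neg: "\<not> ?thesis"
  define H where "H = {s \<odot> b - a \<odot> c | s c. lookup s 0 \<noteq> 0 \<and> keys c \<subseteq> U}"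
  have nz: "h \<noteq> 0" if "h \<in> H" for h using that neg unfolding H_def by auto
  have low: "is_low h (low h)" if "h \<in> H" for h using is_low_low nz that by blast
  have dvd: "mdvd \<alpha> (fst (low h))" if "h \<in> H" for h using that nz[OF that] div unfolding H_def by auto
  have keysU: "keys h \<subseteq> U" if "h \<in> H" for h
    using that keys_smul_diff[OF b] unfolding H_def by auto
  have pos: "snd (low h) \<in> U" if "h \<in> H" for h
    using low[OF that] keysU[OF that] unfolding is_low_def terms_def by (force simp: in_keys_iff)
  have low_deg: "tdeg (fst (low h)) \<le> xdegree h" if "h \<in> H" for h
    using low[OF that] xdegree_ge unfolding is_low_def by blast
  have lessI: "tord p (low h) \<and> low h \<noteq> p" if "h \<in> H" "\<forall>r\<in>terms h. tord p r \<and> r \<noteq> p" for h p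
    using low[OF that(1)] that(2) unfolding is_low_def by blast
  have raise_low: "\<exists>h'\<in>H. tord (low h) (low h') \<and> low h' \<noteq> low h" if h: "h \<in> H" for h
  proof -
    \<comment> \<open>By \<open>div\<close> the lowest term of \<open>h\<close> is a multiple of
      that of a d^v; subtracting this multiple raises it and leaves \<open>s\<close> alone.\<close>
    obtain w v where wv: "low h = (w, v)" by (cases "low h")
    have low_a: "is_low (single v a) (\<alpha>, v)"
      unfolding is_low_def terms_def tord_def using a
      by (auto simp: lookup_single when_def split: if_splits)
    have low_h: "is_low h (w, v)" and d: "mdvd \<alpha> w" using low[OF h] dvd[OF h] wv by auto
    obtain c where c: "\<forall>r\<in>terms (h - single (w - \<alpha>) c \<odot> single v a). tord (w, v) r \<and> r \<noteq> (w, v)"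
      using cancel_low[OF low_h low_a d] by metis
    obtain s d where sd: "h = s \<odot> b - a \<odot> d" "lookup s 0 \<noteq> 0" "keys d \<subseteq> U" using h unfolding H_def by blast
    have "h - single (w - \<alpha>) c \<odot> single v a = s \<odot> b - a \<odot> (d + single v (single (w - \<alpha>) c))"
      by (simp add: sd(1) distrib_left mult_single mult.commute)
    moreover have "v \<in> U" using pos[OF h] wv by simp
    then have "keys (d + single v (single (w - \<alpha>) c)) \<subseteq> U"
      using sd(3) keys_add[of d "single v (single (w - \<alpha>) c)"] by (auto split: if_splits)
    ultimately have "h - single (w - \<alpha>) c \<odot> single v a \<in> H" unfolding H_def using sd(2) by blast
    then show ?thesis using lessI c wv by (intro bexI[of _ "h - single (w - \<alpha>) c \<odot> single v a"]) auto
  qed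
  \<comment> \<open>Lowest terms of bounded degree are finite in number, and
    \<open>raise_low\<close> excludes a largest one.\<close>
  have unbounded: "\<exists>h\<in>H. tdeg (fst (low h)) > N" for N
  proof (rule ccontr)
    assume "\<not> ?thesis"
    then have "low ` H \<subseteq> {w. tdeg w \<le> N} \<times> U"
      using pos by (intro image_subsetI) (simp add: not_less mem_Times_iff)
    then have "finite (low ` H)" using U finite_tdeg_le finite_subset by blast
    moreover have "b - a \<odot> 0 \<in> H" unfolding H_def by (rule CollectI, rule exI[of _ 1], rule exI[of _ 0]) simp
    ultimately obtain h where "h \<in> H" "\<And>h'. h' \<in> H \<Longrightarrow> tord (low h') (low h)"
      using finite_tord_max[of "low ` H"] by blast
    then show False using raise_low tord_antisym by blast
  qed
  \<comment> \<open>The coordinates of the lowest exponent, the ecart, and one indicator per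
    derivative exponent; comparing indicators forces equal derivative exponents.\<close>
  define \<Phi> :: "(('n,'k) dop \<Rightarrow> nat) set" where "\<Phi> =
    range (\<lambda>i h. lookup (fst (low h)) i) \<union> {\<lambda>h. xdegree h - tdeg (fst (low h))} \<union>
    (\<lambda>v h. if snd (low h) = v then 1 else 0) ` U"
  have "finite \<Phi>" using U by (simp add: \<Phi>_def)
  from dickson_basis[OF this, of H]
  obtain F where F: "F \<subseteq> H" "finite F" and red: "\<forall>h\<in>H. \<exists>g\<in>F. \<forall>\<phi>\<in>\<Phi>. \<phi> g \<le> \<phi> h"
    by (elim exE conjE)
  define N where "N = Max (insert 0 ((\<lambda>g. tdeg (fst (low g))) ` F))"
  have N: "tdeg (fst (low g)) \<le> N" if "g \<in> F" for g
    unfolding N_def using F(2) that by (intro Max_ge) auto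
  obtain h0 where h0: "h0 \<in> H" "tdeg (fst (low h0)) > N" using unbounded by blast
  \<comment> \<open>The bound on \<open>xdegree\<close> makes the lowest terms finite in number, so
    a maximal one exists; the bound \<open>N\<close> keeps them above those of all reducers in
    \<open>F\<close>.\<close>
  define H1 where "H1 = {h \<in> H. xdegree h \<le> xdegree h0 \<and> tdeg (fst (low h)) > N}"
  have "low ` H1 \<subseteq> {w. tdeg w \<le> xdegree h0} \<times> U"
    using pos low_deg unfolding H1_def by (intro image_subsetI) (force simp: mem_Times_iff)
  then have "finite (low ` H1)" using U finite_tdeg_le finite_subset by blast
  moreover have "h0 \<in> H1" using h0 by (simp add: H1_def)
  ultimately obtain h where h1: "h \<in> H1" and max: "\<And>h'. h' \<in> H1 \<Longrightarrow> tord (low h') (low h)"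
    using finite_tord_max[of "low ` H1"] by blast
  then have h: "h \<in> H" "xdegree h \<le> xdegree h0" "tdeg (fst (low h)) > N" by (auto simp: H1_def)
  obtain g where g: "g \<in> F" "\<And>\<phi>. \<phi> \<in> \<Phi> \<Longrightarrow> \<phi> g \<le> \<phi> h"
    using bspec[OF red h(1)] by (elim bexE) simp
  have gH: "g \<in> H" using g(1) F(1) by blast
  obtain w v where wv: "low h = (w, v)" by (cases "low h")
  obtain w0 v0 where wv0: "low g = (w0, v0)" by (cases "low g")
  have "(\<lambda>h. if snd (low h) = v0 then 1 else 0) \<in> \<Phi>" using pos[OF gH] wv0 by (simp add: \<Phi>_def)
  from g(2)[OF this] have v0: "v0 = v" using wv wv0 by (auto split: if_splits)
  have "(\<lambda>h. lookup (fst (low h)) i) \<in> \<Phi>" for i by (simp add: \<Phi>_def)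
  from g(2)[OF this] have d: "mdvd w0 w" using wv wv0 by (simp add: mdvd_def)
  have "(\<lambda>h. xdegree h - tdeg (fst (low h))) \<in> \<Phi>" by (simp add: \<Phi>_def)
  from g(2)[OF this] have ecart: "xdegree g - tdeg w0 \<le> xdegree h - tdeg w" using wv wv0 by simp
  have low_h: "is_low h (w, v)" and low_g: "is_low g (w0, v)"
    using low[OF h(1)] low[OF gH] wv wv0 v0 by auto
  obtain c where c: "\<forall>r\<in>terms (h - single (w - w0) c \<odot> g). tord (w, v) r \<and> r \<noteq> (w, v)"
    and c': "\<forall>r\<in>terms (h - single (w - w0) c \<odot> g).
      r \<in> terms h \<or> (\<exists>r'\<in>terms g. fst r = fst r' + (w - w0))"
    by (rule cancel_low[OF low_h low_g d])
  let ?h = "h - single (w - w0) c \<odot> g"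
  \<comment> \<open>A nonconstant multiplier leaves the value of \<open>s\<close> at the origin
    unchanged.\<close>
  have "w - w0 \<noteq> 0"
    using h(3) N[OF g(1)] wv wv0 mdvd_tdeg_diff[OF d] by (metis fst_conv not_less tdeg_zero diff_is_0_eq order_le_less_trans)
  then have c0: "lookup (single (w - w0) c) 0 = 0" by (simp add: lookup_single when_def)
  obtain s1 c1 s2 c2 where sc: "h = s1 \<odot> b - a \<odot> c1" "lookup s1 0 \<noteq> 0" "keys c1 \<subseteq> U"
      "g = s2 \<odot> b - a \<odot> c2" "lookup s2 0 \<noteq> 0" "keys c2 \<subseteq> U"
    using h(1) gH unfolding H_def by blast
  have "?h \<in> H" unfolding H_def
  proof (rule CollectI, intro exI conjI)
    have "single (w - w0) c \<odot> a \<odot> c2 = a \<odot> single (w - w0) c \<odot> c2"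
      by (simp add: smul_smul mult.commute)
    then show "?h = (s1 - single (w - w0) c * s2) \<odot> b - a \<odot> (c1 - single (w - w0) c \<odot> c2)"
      unfolding sc(1,4) single_diff left_diff_distrib right_diff_distrib smul_smul[symmetric] by simp
    show "lookup (s1 - single (w - w0) c * s2) 0 \<noteq> 0"
      using sc(2) c0 by (simp add: lookup_minus lookup_times_0)
    show "keys (c1 - single (w - w0) c \<odot> c2) \<subseteq> U"
      using sc(3,6) keys_diff[of c1 "single (w - w0) c \<odot> c2"] keys_smul[of "single (w - w0) c" c2] by blast
  qed
  \<comment> \<open>As the ecart of \<open>g\<close> is at most that of \<open>h\<close>, shifting
    \<open>g\<close> by \<open>w - w0\<close> does not exceed the x-degree of
    \<open>h\<close>.\<close>
  moreover have "xdegree ?h \<le> xdegree h0"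
  proof (rule xdegree_le)
    fix r assume "r \<in> terms ?h"
    then consider "r \<in> terms h" | r' where "r' \<in> terms g" "fst r = fst r' + (w - w0)" using c' by blast
    then show "tdeg (fst r) \<le> xdegree h0"
    proof cases
      case 1
      then show ?thesis using xdegree_ge h(2) order_trans by blast
    next
      case 2
      have "tdeg (fst r) = tdeg (fst r') + (tdeg w - tdeg w0)"
        by (simp add: 2 tdeg_add mdvd_tdeg_diff[OF d])
      moreover have "tdeg (fst r') \<le> xdegree g" using 2 xdegree_ge by blast
      moreover have "tdeg w \<le> xdegree h" "tdeg w0 \<le> xdegree g" "tdeg w0 \<le> tdeg w"
        using low_deg[OF h(1)] low_deg[OF gH] wv wv0 mdvd_tdeg[OF d] by simp_all
      ultimately show ?thesis using ecart h(2) by linarith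
    qed
  qed
  moreover have less: "tord (low h) (low ?h) \<and> low ?h \<noteq> low h"
    using lessI[OF \<open>?h \<in> H\<close>] c wv by metis
  moreover have "tdeg (fst (low ?h)) > N"
    using ord_tdeg[OF tord_fst] less h(3) by (meson less_le_trans)
  ultimately have "?h \<in> H1" by (simp add: H1_def)
  then show False using max less tord_antisym by blast
qed

text \<open>For \<open>v\<close> in \<open>U\<close> the constant term of d^v f is u! if v = u and 0
  otherwise, so at the lowest exponent \<open>w\<close> only the coefficient of d^u is seen.\<close>

lemma apply_op_low:
  fixes P :: "('n,'k::field_char_0) dop"
  assumes U: "finite U" and f: "\<And>v. v \<in> U \<Longrightarrow> f v = (if v = u then 1 else 0)" and u: "u \<in> U"
    and P: "keys P \<subseteq> U" and w: "\<And>v w'. lookup (lookup P v) w' \<noteq> 0 \<Longrightarrow> ord w w'"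
  shows "apply_op P f w = lookup (lookup P u) w * of_nat (ffallm u u)"
    and "apply_op P f w' \<noteq> 0 \<Longrightarrow> ord w w'"
proof -
  have "pact (lookup P v) (dact v f) w = (if v = u then lookup (lookup P u) w * of_nat (ffallm u u) else 0)"
    if "v \<in> U" for v
    using pact_lowest_coeff[of "lookup P v" w "dact v f" 0] w f[OF that] by (simp add: dact_def)
  then show "apply_op P f w = lookup (lookup P u) w * of_nat (ffallm u u)"
    using U u by (simp add: apply_op_eq[OF U P])
  assume "apply_op P f w' \<noteq> 0"
  then obtain v where "pact (lookup P v) (dact v f) w' \<noteq> 0"
    unfolding apply_op_eq[OF U P] by (auto elim: sum.not_neutral_contains_not_neutral)
  then show "ord w w'" using pact_lowest_le[of "lookup P v" w "dact v f" 0] w by simp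
qed

lemma low_le:
  assumes "h \<noteq> 0" "lookup (lookup h v) w' \<noteq> 0"
  shows "ord (fst (low h)) w'"
  using is_low_low[OF assms(1)] assms(2) tord_fst[of "low h" "(w', v)"] by (simp add: is_low_def mem_terms)

lemma zero_if_annihilates:
  fixes P :: "('n,'k::field_char_0) dop"
  assumes U: "finite U" and f: "\<And>u v. u \<in> U \<Longrightarrow> v \<in> U \<Longrightarrow> f u v = (if v = u then 1 else 0)"
    and P: "keys P \<subseteq> U" "\<And>u. u \<in> U \<Longrightarrow> apply_op P (f u) = (\<lambda>_. 0)"
  shows "P = 0"
proof (rule ccontr)
  assume P0: "P \<noteq> 0"
  obtain w u where wu: "low P = (w, u)" by (cases "low P")
  then have nz: "lookup (lookup P u) w \<noteq> 0" using is_low_low[OF P0] by (simp add: is_low_def mem_terms)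
  then have u: "u \<in> U" by (rule subsetD[OF P(1) in_keys_of_coeff])
  have "apply_op P (f u) w = lookup (lookup P u) w * of_nat (ffallm u u)"
    using low_le[OF P0] wu by (intro apply_op_low(1)[OF U f[OF u] u P(1)]) auto
  then show False using nz P(2)[OF u] by simp
qed

text \<open>The lowest term of s b - a c stays visible when the operator acts on a suitable
  \<open>f u\<close>. There the result is -a R for a series R, because a d^t + b annihilates
  \<open>f u\<close>; so its lowest exponent is a multiple of that of \<open>a\<close>.\<close>

lemma ex_local_operator:
  fixes a :: "('n,'k::field_char_0) xpoly" and b :: "('n,'k) dop"
  assumes U: "finite U" and f: "\<And>u v. u \<in> U \<Longrightarrow> v \<in> U \<Longrightarrow> f u v = (if v = u then 1 else 0)"
    and b: "keys b \<subseteq> U" and a: "a \<noteq> 0"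
    and ann: "\<And>u. u \<in> U \<Longrightarrow> apply_op (single t a + b) (f u) = (\<lambda>_. 0)"
  shows "\<exists>s c. lookup s 0 \<noteq> 0 \<and> keys c \<subseteq> U \<and> s \<odot> b = a \<odot> c"
proof -
  obtain \<alpha> where \<alpha>: "lookup a \<alpha> \<noteq> 0" "\<And>v. lookup a v \<noteq> 0 \<Longrightarrow> ord \<alpha> v"
    using ex_lowest_poly[OF a] by blast
  show ?thesis
  proof (rule local_denominator[OF U b \<alpha>])
    fix s c
    let ?h = "s \<odot> b - a \<odot> c"
    assume s: "lookup s 0 \<noteq> 0" and c: "keys c \<subseteq> U" and h0: "?h \<noteq> 0"
    obtain w u where wu: "low ?h = (w, u)" by (cases "low ?h")
    have hU: "keys ?h \<subseteq> U" by (rule keys_smul_diff[OF b c])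
    have nz: "lookup (lookup ?h u) w \<noteq> 0"
      using is_low_low[OF h0] unfolding wu is_low_def mem_terms by blast
    then have u: "u \<in> U" by (rule subsetD[OF hU in_keys_of_coeff])
    have le: "ord w w'" if "lookup (lookup ?h v) w' \<noteq> 0" for v w'
      using low_le[OF h0 that] wu by simp
    have hw: "apply_op ?h (f u) w \<noteq> 0"
      using apply_op_low(1)[OF U f[OF u] u hU le] no_zero_divisors[OF nz, of "of_nat (ffallm u u)"] by simp
    have hle: "ord w w'" if "apply_op ?h (f u) w' \<noteq> 0" for w'
      by (rule apply_op_low(2)[OF U f[OF u] u hU le that])
    define R where "R = apply_op (single t s + c) (f u)"
    \<comment> \<open>Adding and subtracting a s d^t brings in the annihilated operator.\<close>
    have eq: "?h = s \<odot> (single t a + b) - a \<odot> (single t s + c)"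
      by (simp add: distrib_left mult_single mult.commute)
    have hR: "apply_op ?h (f u) w' = - pact a R w'" for w'
      unfolding eq apply_op_diff apply_op_smul ann[OF u] R_def by simp
    then have "R \<noteq> (\<lambda>_. 0)" using hw by auto
    then obtain \<beta> where \<beta>: "R \<beta> \<noteq> 0" "\<And>v. R v \<noteq> 0 \<Longrightarrow> ord \<beta> v" using ex_lowest by blast
    have "pact a R (\<alpha> + \<beta>) \<noteq> 0" using pact_lowest_coeff[of a \<alpha> R \<beta>] \<alpha> \<beta> by simp
    then have "ord w (\<alpha> + \<beta>)" using hle hR by simp
    moreover have "ord (\<alpha> + \<beta>) w" using pact_lowest_le[of a \<alpha> R \<beta> w] \<alpha>(2) \<beta>(2) hw hR by simp
    ultimately have "w = \<alpha> + \<beta>" by (rule ord_antisym)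
    then show "mdvd \<alpha> (fst (low ?h))" using wu by simp
  qed
qed

end

section \<open>Primitive operators\<close>

definition pdegree :: "('n::finite,'k::zero) xpoly \<Rightarrow> nat" where
  "pdegree p = Max (insert 0 (tdeg ` keys p))"

context graded_order
begin

text \<open>Degrees add, and a nonzero polynomial of degree zero is a constant, hence a
  unit.\<close>

lemma pdegree_times_nonunit:
  fixes q r :: "('n,'k::field) xpoly"
  assumes q: "q \<noteq> 0" "\<not> q dvd 1" and r: "r \<noteq> 0"
  shows "pdegree r < pdegree (q * r)"
proof -
  obtain a where a: "a \<in> keys q" "\<And>v. v \<in> keys q \<Longrightarrow> ord v a"
    using ex_ord_max[of "keys q"] q(1) by auto
  obtain b where b: "b \<in> keys r" "\<And>v. v \<in> keys r \<Longrightarrow> ord v b"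
    using ex_ord_max[of "keys r"] r by auto
  have "a \<noteq> 0"
  proof
    assume "a = 0"
    then have "keys q \<subseteq> {0}" using a(2) ord_antisym ord_zero by blast
    then have q0: "q = single 0 (lookup q 0)"
      by (intro poly_mapping_eqI) (auto simp: lookup_single when_def in_keys_iff subset_iff)
    have "lookup q 0 \<noteq> 0" using a(1) \<open>a = 0\<close> by (simp add: in_keys_iff)
    then have "q * single 0 (inverse (lookup q 0)) = 1"
      by (subst q0) (simp add: mult_single)
    then show False using q(2) by (metis dvd_triv_left)
  qed
  then have "tdeg a > 0" using tdeg_eq_0_iff neq0_conv by blast
  have "lookup q v * lookup r (a + b - v) = (if v = a then lookup q a * lookup r b else 0)"
    if "mdvd v (a + b)" for v
  proof (cases "v = a")
    case False
    have s: "v + (a + b - v) = a + b" using mdvd_diff_add[OF that] by (simp add: add.commute)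
    have "v = a" if "lookup q v \<noteq> 0" "lookup r (a + b - v) \<noteq> 0"
      using ord_add_eq(1)[OF a(2) b(2) s] that by (simp add: in_keys_iff)
    then show ?thesis using False by auto
  qed simp
  then have "lookup (q * r) (a + b) = (\<Sum>v | mdvd v (a + b). if v = a then lookup q a * lookup r b else 0)"
    unfolding lookup_times pact_def by (intro sum.cong) auto
  then have "a + b \<in> keys (q * r)" using a(1) b(1) by (simp add: in_keys_iff)
  then have "tdeg (a + b) \<le> pdegree (q * r)" unfolding pdegree_def by (intro Max_ge) auto
  moreover have "pdegree r \<le> tdeg b" unfolding pdegree_def using b(2) ord_tdeg by auto
  ultimately show ?thesis using \<open>tdeg a > 0\<close> by (simp add: tdeg_add)
qed

text \<open>Dividing by a nonunit common factor lowers the degree of the fixed nonzero coefficient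
  at \<open>t\<close>, so repeated division ends.\<close>

lemma ex_primitive:
  fixes P :: "('n,'k::field) dop"
  assumes "lookup P t \<noteq> 0"
  shows "\<exists>q P'. P = q \<odot> P' \<and> primitive_op P'"
  using assms
proof (induction "pdegree (lookup P t)" arbitrary: P rule: less_induct)
  case less
  show ?case
  proof (cases "primitive_op P")
    case True
    then show ?thesis by (intro exI[of _ 1] exI[of _ P]) simp
  next
    case False
    then obtain q where q: "\<And>u. q dvd lookup P u" "\<not> q dvd 1" unfolding primitive_op_def by blast
    obtain r where r: "\<And>u. lookup P u = q * r u"
      using choice[of "\<lambda>u x. lookup P u = q * x"] q(1) unfolding dvd_def by blast
    define P' where "P' = (\<Sum>u\<in>keys P. single u (r u))"
    have "lookup (q \<odot> P') u = lookup P u" for u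
      by (auto simp: P'_def lookup_sum lookup_single when_def sum.delta r[symmetric] in_keys_iff)
    then have P: "P = q \<odot> P'" by (intro poly_mapping_eqI) simp
    then have Pt: "lookup P t = q * lookup P' t" by (metis lookup_smul)
    then have "q \<noteq> 0" "lookup P' t \<noteq> 0" using less.prems by auto
    then have "pdegree (lookup P' t) < pdegree (lookup P t)"
      unfolding Pt using pdegree_times_nonunit q(2) by blast
    then obtain q' P'' where "P' = q' \<odot> P''" "primitive_op P''"
      using less.hyps \<open>lookup P' t \<noteq> 0\<close> by blast
    then show ?thesis using P smul_smul by (intro exI[of _ "q * q'"] exI[of _ P'']) simp
  qed
qed

end

lemma ex_mdvd_tdeg:
  fixes u :: "'n::finite mexp"
  assumes "k \<le> tdeg u"
  shows "\<exists>t. mdvd t u \<and> tdeg t = k"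
  using assms
proof (induction u rule: mexp_induct)
  case zero
  then show ?case by auto
next
  case (add v i)
  show ?case
  proof (cases "k \<le> tdeg v")
    case True
    then obtain t where "mdvd t v" "tdeg t = k" using add.IH by blast
    then show ?thesis using mdvd_trans mdvd_add(1) by blast
  next
    case False
    then show ?thesis using add.prems by (intro exI[of _ "v + single i 1"]) (simp add: tdeg_add)
  qed
qed

section \<open>Apparent singularities become ordinary points\<close>

text \<open>No nonzero element has order at most \<open>m\<close>, while every exponent of degree
  \<open>m + 1\<close> is a head term. These exponents therefore generate all head terms, and
  \<open>U\<close> is the set of parametric terms.\<close>

lemma (in op_ideal) ex_reduced_GB_ordinary:
  fixes m :: nat
  defines "U \<equiv> {u. tdeg u \<le> m}"
  assumes f: "\<And>u v. u \<in> U \<Longrightarrow> v \<in> U \<Longrightarrow> f u v = (if v = u then 1 else 0)"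
    and ann: "\<And>P u. I P \<Longrightarrow> u \<in> U \<Longrightarrow> apply_op P (f u) = (\<lambda>_. 0)"
    and rel: "\<And>t. t \<notin> U \<Longrightarrow> \<exists>P. P \<noteq> 0 \<and> keys P \<subseteq> insert t U \<and> I P"
  shows "\<exists>M. reduced_prim_GB ord M I \<and> ordinary_origin ord M"
proof -
  have U: "finite U" unfolding U_def by (rule finite_tdeg_le)
  have inj: "P = 0" if "I P" "keys P \<subseteq> U" for P
    using zero_if_annihilates[OF U f that(2) ann[OF that(1)]] by blast
  let ?T = "{t :: 'n mexp. tdeg t = Suc m}"
  have "\<exists>g. I g \<and> primitive_op g \<and> keys g \<subseteq> insert t U \<and> lookup (lookup g t) 0 \<noteq> 0" if t: "t \<in> ?T" for t
  proof -
    have tU: "t \<notin> U" using t by (simp add: U_def)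
    obtain P where P: "P \<noteq> 0" "keys P \<subseteq> insert t U" "I P" using rel[OF tU] by blast
    define a where "a = lookup P t"
    define b where "b = P - single t a"
    have Pab: "P = single t a + b" by (simp add: b_def)
    have b: "keys b \<subseteq> U"
    proof
      fix u assume "u \<in> keys b"
      then have "lookup P u \<noteq> 0" "u \<noteq> t"
        by (auto simp: b_def a_def in_keys_iff lookup_minus lookup_single when_def split: if_splits)
      then show "u \<in> U" using P(2) by (auto simp: in_keys_iff)
    qed
    have a0: "a \<noteq> 0"
    proof
      assume "a = 0"
      then have "keys P \<subseteq> U" using b Pab by simp
      then show False using inj P by blast
    qed
    obtain s c where s: "lookup s 0 \<noteq> 0" and c: "keys c \<subseteq> U" and eq: "s \<odot> b = a \<odot> c"
      using ex_local_operator[OF U f b a0] ann[OF P(3)[unfolded Pab]] by blast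
    define Q where "Q = single t s + c"
    \<comment> \<open>Saturation cancels \<open>a\<close>, and \<open>s\<close> becomes the head
      coefficient.\<close>
    have "a \<odot> Q = s \<odot> P"
      unfolding Q_def Pab distrib_left eq by (simp add: mult_single mult.commute)
    then have "I Q" using smul[OF P(3)] sat[OF a0] by metis
    have "t \<notin> keys c" using c tU by blast
    then have Qt: "lookup Q t = s" by (simp add: Q_def lookup_add in_keys_iff)
    then have "lookup Q t \<noteq> 0" using s by auto
    then obtain q g where g: "Q = q \<odot> g" "primitive_op g" using ex_primitive by blast
    \<comment> \<open>The head coefficient of the primitive part divides \<open>s\<close>, so it too
      is nonzero at the origin.\<close>
    then have qg: "s = q * lookup g t" using Qt by (metis lookup_smul)
    then have g0: "lookup (lookup g t) 0 \<noteq> 0" and q0: "q \<noteq> 0"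
      using s by (auto simp: lookup_times_0)
    have "I g" using \<open>I Q\<close> g(1) sat[OF q0] by simp
    moreover have "keys g \<subseteq> insert t U"
    proof
      fix u assume "u \<in> keys g"
      then have "lookup Q u \<noteq> 0" using g(1) q0 xpoly_no_zero_divisors by (auto simp: in_keys_iff)
      then have "u = t \<or> lookup c u \<noteq> 0"
        by (auto simp: Q_def lookup_add lookup_single when_def split: if_splits)
      then show "u \<in> insert t U" using c by (auto simp: in_keys_iff)
    qed
    ultimately show ?thesis using g(2) g0 by blast
  qed
  then have "\<forall>t\<in>?T. \<exists>g. I g \<and> primitive_op g \<and> keys g \<subseteq> insert t U \<and> lookup (lookup g t) 0 \<noteq> 0"
    by blast
  from bchoice[OF this] obtain g where g: "\<forall>t\<in>?T. I (g t) \<and> primitive_op (g t) \<and>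
      keys (g t) \<subseteq> insert t U \<and> lookup (lookup (g t) t) 0 \<noteq> 0" ..
  have HT: "HT ord (g t) = t" if t: "t \<in> ?T" for t
  proof (rule HT_eqI)
    show "t \<in> keys (g t)" by (rule in_keys_of_coeff) (use g t in blast)
    fix v assume "v \<in> keys (g t)"
    then have "v = t \<or> tdeg v < tdeg t" using g t by (force simp: U_def)
    then show "ord v t" using ord_less_tdeg by auto
  qed
  have "finite ?T" by (rule finite_subset[OF _ finite_tdeg_le[of "Suc m"]]) auto
  have "is_GB ord (g ` ?T) I"
    unfolding is_GB_def
  proof (intro conjI ballI allI impI)
    show "0 \<notin> g ` ?T" using g by force
    show "I p" if "p \<in> g ` ?T" for p using that g by blast
    fix P assume P: "I P \<and> P \<noteq> 0"
    have "\<not> tdeg (HT ord P) \<le> m"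
    proof
      assume "tdeg (HT ord P) \<le> m"
      then have "keys P \<subseteq> U" using HT_max[of P] P ord_tdeg unfolding U_def by (auto intro: order_trans)
      then show False using inj P by blast
    qed
    then obtain t where "mdvd t (HT ord P)" "tdeg t = Suc m"
      using ex_mdvd_tdeg[of "Suc m" "HT ord P"] by auto
    then show "\<exists>p\<in>g ` ?T. mdvd (HT ord p) (HT ord P)" using HT by auto
  qed
  moreover have "\<not> mdvd (HT ord h) v" if ph: "p \<in> g ` ?T" "h \<in> g ` ?T" "h \<noteq> p" and v: "v \<in> keys p" for p h v
  proof
    assume d: "mdvd (HT ord h) v"
    obtain t t' where t: "t \<in> ?T" "p = g t" and t': "t' \<in> ?T" "h = g t'" using ph by blast
    \<comment> \<open>An exponent of degree \<open>m + 1\<close> divides nothing in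
      \<open>U\<close>, and distinct exponents of equal degree do not divide each other.\<close>
    have "v = t \<or> tdeg v \<le> m" using g t v by (force simp: U_def)
    moreover have "mdvd t' v" using d HT t' by simp
    ultimately have "t' = t" using mdvd_tdeg mdvd_tdeg_eq t(1) t'(1) by fastforce
    then show False using ph(3) t t' by simp
  qed
  ultimately have "reduced_prim_GB ord (g ` ?T) I"
    unfolding reduced_prim_GB_def using \<open>finite ?T\<close> g by auto
  moreover have "ordinary_origin ord (g ` ?T)"
    unfolding ordinary_origin_def singular_origin_def using g HT by (auto simp: HC_def)
  ultimately show ?thesis by blast
qed

lemma rank_eq_card_par_terms: "rank ord G = card (par_terms ord G)"
  by (simp add: rank_def par_terms_def)

lemma (in graded_order) ex_ordinary_GB_if_indep_solutions:
  fixes G :: "('n,'k::field_char_0) dop set" and S :: "'n mexp set"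
  assumes gb: "is_GB ord G (in_ratideal G)" and dfin: "dfinite G"
    and S: "initial_exponent_candidates ord G S" and card_S: "card S \<ge> rank ord G"
    and sol: "has_indep_solutions G (rank ord G)"
  defines "U \<equiv> {u. tdeg u \<le> Max (insert 0 (tdeg ` S))}"
  shows "\<exists>B \<subseteq> S. card B = rank ord G \<and> (\<exists>M. reduced_prim_GB ord M
      (\<lambda>P. in_ratideal G P \<and> (\<forall>u\<in>U - B. in_ratideal (euler_ops u) P)) \<and> ordinary_origin ord M)"
proof -
  interpret L: op_ideal ord "in_ratideal G" by (rule op_ideal_ratideal)
  obtain B where B: "B \<subseteq> {b. \<exists>f. is_solution G f \<and> lowest_exp ord f b}" "finite B" "card B = rank ord G"
    using many_initial_exponents[OF sol] by blast
  have BS: "B \<subseteq> S" using B(1) initial_exponent_candidate[OF S] by blast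
  have finU: "finite U" unfolding U_def by (rule finite_tdeg_le)
  have BU: "B \<subseteq> U"
  proof
    fix b assume b: "b \<in> B"
    \<comment> \<open>\<open>card\<close> is 0 on infinite sets, so a positive value yields the
      finiteness of \<open>S\<close> that \<open>Max\<close> relies on.\<close>
    then have "card S > 0" using B(2,3) card_S card_gt_0_iff[of B] by auto
    then have "finite S" using card_gt_0_iff by blast
    then show "b \<in> U" using b BS unfolding U_def by auto
  qed
  let ?I = "\<lambda>P. in_ratideal G P \<and> (\<forall>u\<in>U - B. in_ratideal (euler_ops u) P)"
  interpret L': op_ideal ord ?I
    by (rule L.op_ideal_Int) (rule op_ideal_ratideal)
  define A where "A f \<longleftrightarrow> (\<forall>P. ?I P \<longrightarrow> apply_op P f = (\<lambda>_. 0))" for f :: "'n mexp \<Rightarrow> 'k"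
  \<comment> \<open>For \<open>u\<close> in \<open>B\<close> a solution of \<open>G\<close> serves,
    otherwise the monomial x^u, which its Euler ideal annihilates.\<close>
  have "\<exists>f. A f \<and> lowest_exp ord f u" if u: "u \<in> U" for u
  proof (cases "u \<in> B")
    case True
    then obtain f where f: "is_solution G f" "lowest_exp ord f u" using B(1) by blast
    then have "A f" unfolding A_def using solution_ratideal by blast
    then show ?thesis using f(2) by blast
  next
    case False
    then have "A (mono_series u)" unfolding A_def using u in_ratideal_euler_iff by blast
    moreover have "lowest_exp ord (mono_series u :: 'n mexp \<Rightarrow> 'k) u"
      by (simp add: lowest_exp_def mono_series_def)
    ultimately show ?thesis by blast
  qed
  then have "\<forall>u\<in>U. \<exists>f. A f \<and> lowest_exp ord f u" by blast
  from bchoice[OF this] obtain f where f: "\<forall>u\<in>U. A (f u) \<and> lowest_exp ord (f u) u" ..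
  have "\<exists>h. A h \<and> (\<forall>v\<in>U. h v = (if v = u then 1 else 0))" if "u \<in> U" for u
  proof (rule echelon_series[OF finU _ _ _ that])
    show "A (f u) \<and> lowest_exp ord (f u) u" if "u \<in> U" for u using f that by blast
    show "A (\<lambda>w. g w + h w)" if "A g" "A h" for g h
      using that unfolding A_def fun_eq_iff apply_op_right_add by simp
    show "A (\<lambda>w. c * g w)" if "A g" for c g
      using that unfolding A_def fun_eq_iff apply_op_right_cmul by simp
  qed
  then have "\<forall>u\<in>U. \<exists>h. A h \<and> (\<forall>v\<in>U. h v = (if v = u then 1 else 0))" by blast
  from bchoice[OF this] obtain h where h: "\<forall>u\<in>U. A (h u) \<and> (\<forall>v\<in>U. h u v = (if v = u then 1 else 0))" ..
  have finG: "finite (par_terms ord G)" by (rule finite_par_terms_dfinite[OF gb dfin])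
  have "\<exists>M. reduced_prim_GB ord M ?I \<and> ordinary_origin ord M"
  proof (rule L'.ex_reduced_GB_ordinary[of "Max (insert 0 (tdeg ` S))" h, folded U_def])
    show "h u v = (if v = u then 1 else 0)" if "u \<in> U" "v \<in> U" for u v using h that by blast
    show "apply_op P (h u) = (\<lambda>_. 0)" if "?I P" "u \<in> U" for P u using h that unfolding A_def by blast
    fix t assume t: "t \<notin> U"
    have "L.spanned {q. q \<noteq> 0} (dterm ` par_terms ord G) (dterm x)" for x
    proof (rule L.spanned_parametric[OF gb L.multiplicative_nonzero _ finG])
      show "HC ord g \<in> {q. q \<noteq> 0}" if "g \<in> G" for g
        using that gb HT_in_keys[of g] by (auto simp: HC_def in_keys_iff is_GB_def)
    qed
    \<comment> \<open>As |B| = d, the d + |U - B| conditions number exactly |U|, and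
      \<open>t\<close> supplies the one extra unknown.\<close>
    moreover have "card (dterm ` par_terms ord G :: ('n,'k) dop set) + card (U - B) < card (insert t U)"
    proof -
      have "card (dterm ` par_terms ord G :: ('n,'k) dop set) = card B"
        using B(3) rank_eq_card_par_terms[of ord G] by (simp add: card_image inj_on_subset[OF inj_dterm])
      moreover have "card B + card (U - B) = card U"
        using BU finU B(2) card_mono[OF finU BU] by (simp add: card_Diff_subset)
      ultimately show ?thesis using t finU by simp
    qed
    ultimately show "\<exists>P. P \<noteq> 0 \<and> keys P \<subseteq> insert t U \<and> ?I P"
      using L.relation_of_dterms[of "dterm ` par_terms ord G" "insert t U" "U - B"] finG finU
      unfolding in_ratideal_euler_iff by auto
  qed
  then show ?thesis using BS B(3) by blast
qed

theorem mainTheorem6: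
  fixes ord :: "'n::finite mexp \<Rightarrow> 'n mexp \<Rightarrow> bool"
    and G :: "('n, 'k::field_char_0) dop set"
    and S :: "'n mexp set"
  assumes "graded_term_order ord"
    and "finite G"
    and "is_GB ord G (in_ratideal G)"
    and "dfinite G"
    and "singular_origin ord G"
    and "initial_exponent_candidates ord G S"
    and "card S \<ge> rank ord G"
  shows "apparent_origin ord G \<longleftrightarrow>
    (\<exists>B \<subseteq> S. card B = rank ord G \<and>
       (\<exists>M. reduced_prim_GB ord M
              (\<lambda>P. in_ratideal G P \<and>
                   (\<forall>u \<in> {u. tdeg u \<le> Max (insert 0 (tdeg ` S))} - B. in_ratideal (euler_ops u) P))
          \<and> ordinary_origin ord M))"
    (is "_ \<longleftrightarrow> ?rhs")
proof
  interpret graded_order ord using assms(1) by unfold_locales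
  {
    assume "apparent_origin ord G"
    then show ?rhs
      using ex_ordinary_GB_if_indep_solutions[OF assms(3,4,6,7)] by (simp add: apparent_origin_def)
  next
    assume ?rhs
    then obtain B M where "is_GB ord M (\<lambda>P. in_ratideal G P \<and>
        (\<forall>u \<in> {u. tdeg u \<le> Max (insert 0 (tdeg ` S))} - B. in_ratideal (euler_ops u) P))"
      "ordinary_origin ord M" unfolding reduced_prim_GB_def by blast
    from has_indep_solutions_if_ordinary[OF assms(3,4) finite_Diff[OF finite_tdeg_le] this]
    have "has_indep_solutions G (rank ord G)" unfolding rank_eq_card_par_terms .
    then show "apparent_origin ord G" using assms(5) by (simp add: apparent_origin_def)
  }
qed

end
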